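(* Let $\alpha(t)=(y_1(t),y_2(t))$, $t\in\mathbb{R}$, be a solution of $$\ddot y_1=\frac{\partial\omega}{\partial y_1}+2\dot y_2,\qquad \ddot y_2=\frac{\partial\omega}{\partial y_2}-2\dot y_1$$ with Jacobian integral equal to $C$. Assume that: (i) $\alpha$ is periodic: there is $T>0$ such that $\alpha(t+T)=\alpha(t)$ for all $t\in\mathbb{R}$; (ii) $\alpha$ is regular: $|\dot\alpha(t)|\neq 0$ for all $t\in\mathbb{R}$; (iii) $\alpha$ is simple: $\alpha:[0,T)\to\mathbb{R}^2$ is injective. Let $\Omega$ be the region enclosed by the curve $\alpha$ and let $f=\sqrt{2\omega-C}$. Then: - if $\Omega$ contains the point $(1-\mu,0)$ and is contained in $U_C\cup\{(1-\mu,0)\}$, and $\alpha$ goes clockwise around $\Omega$, then $\displaystyle 2T=\pi+\iint_\Omega \Delta\ln f\,dy_1dy_2$; - if $\Omega$ contains the point $(1-\mu,0)$ and is contained in $U_C\cup\{(1-\mu,0)\}$, and $\alpha$ goes counterclockwise around $\Omega$, then $\displaystyle 2T=-\pi-\iint_\Omega \Delta\ln f\,dy_1dy_2$; - if $\Omega$ contains the points $(-\mu,0)$ and $(1-\mu,0)$ and is contained in $U_C\cup\{(-\mu,0),(1-\mu,0)\}$, and $\alpha$ goes clockwise around $\Omega$, then $\displaystyle 2T=\iint_\Omega \Delta\ln f\,dy_1dy_2$; - if $\Omega$ contains the points $(-\mu,0)$ and $(1-\mu,0)$ and is contained in $U_C\cup\{(-\mu,0),(1-\mu,0)\}$, and $\alpha$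 goes counterclockwise around $\Omega$, then $\displaystyle 2T=-\iint_\Omega \Delta\ln f\,dy_1dy_2$.
   Context: Fix a real number $\mu$ with $0<\mu\le \frac12$ (mass parameter of the planar circular restricted three body problem, in rotating coordinates). On $\mathbb{R}^2\setminus\{(-\mu,0),(1-\mu,0)\}$ define $$\omega(y_1,y_2)=\frac12(y_1^2+y_2^2)+\frac{1-\mu}{\sqrt{(y_1+\mu)^2+y_2^2}}+\frac{\mu}{\sqrt{(y_1+\mu-1)^2+y_2^2}}.$$ For every solution of the differential equation the quantity $-\dot y_1^2-\dot y_2^2+2\omega(y_1,y_2)$ is a constant $C$, called its Jacobian integral. For a constant $C$, $U_C=\{(y_1,y_2): 2\omega(y_1,y_2)-C\ge 0\}$, where the two points $(-\mu,0)$ and $(1-\mu,0)$ (at which $\omega$ is undefined) are not considered part of $U_C$. $\Delta=\partial_{y_1}^2+\partial_{y_2}^2$ is the Laplacian; $\ln f$ is not defined at $(-\mu,0)$ and $(1-\mu,0)$, and the integral over $\Omega$ is over $\Omega$ minus these points. The region enclosed by a simple closed curve is the bounded component of its complement.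
   Formalization: The formal theorem also assumes that f does not vanish on Ω away from the two primaries; a zero could occur only at a triangular equilibrium when C = 3 − μ + μ², where ln f is undefined and Δ ln f is not integrable over Ω. *)

theory Defs
  imports "HOL-Complex_Analysis.Complex_Analysis"
begin

definition primary1 :: "real \<Rightarrow> real \<times> real" where
  "primary1 \<mu> = (- \<mu>, 0)"

definition primary2 :: "real \<Rightarrow> real \<times> real" where
  "primary2 \<mu> = (1 - \<mu>, 0)"

text \<open>The values of \<open>omega\<close> at the two primaries are artefacts of division by zero; every notion
  below excludes the primaries explicitly.\<close>

definition omega :: "real \<Rightarrow> real \<times> real \<Rightarrow> real" where
  "omega \<mu> = (\<lambda>(y1, y2). (y1\<^sup>2 + y2\<^sup>2) / 2
     + (1 - \<mu>) / sqrt ((y1 + \<mu>)\<^sup>2 + y2\<^sup>2)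
     + \<mu> / sqrt ((y1 + \<mu> - 1)\<^sup>2 + y2\<^sup>2))"

definition partial1 :: "(real \<times> real \<Rightarrow> real) \<Rightarrow> real \<times> real \<Rightarrow> real" where
  "partial1 g = (\<lambda>(a, b). deriv (\<lambda>s. g (s, b)) a)"

definition partial2 :: "(real \<times> real \<Rightarrow> real) \<Rightarrow> real \<times> real \<Rightarrow> real" where
  "partial2 g = (\<lambda>(a, b). deriv (\<lambda>s. g (a, s)) b)"

definition laplacian :: "(real \<times> real \<Rightarrow> real) \<Rightarrow> real \<times> real \<Rightarrow> real" where
  "laplacian g p = partial1 (partial1 g) p + partial2 (partial2 g) p"

text \<open>The \<open>has_real_derivative\<close> clauses include the existence of the first and second derivatives.\<close>

definition pcrtbp_solution :: "real \<Rightarrow> (real \<Rightarrow> real) \<Rightarrow> (real \<Rightarrow> real) \<Rightarrow> bool" where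
  "pcrtbp_solution \<mu> y1 y2 \<longleftrightarrow> (\<forall>t.
     (y1 t, y2 t) \<notin> {primary1 \<mu>, primary2 \<mu>} \<and>
     (y1 has_real_derivative deriv y1 t) (at t) \<and>
     (y2 has_real_derivative deriv y2 t) (at t) \<and>
     (deriv y1 has_real_derivative partial1 (omega \<mu>) (y1 t, y2 t) + 2 * deriv y2 t) (at t) \<and>
     (deriv y2 has_real_derivative partial2 (omega \<mu>) (y1 t, y2 t) - 2 * deriv y1 t) (at t))"

definition has_jacobian_integral ::
    "real \<Rightarrow> real \<Rightarrow> (real \<Rightarrow> real) \<Rightarrow> (real \<Rightarrow> real) \<Rightarrow> bool" where
  "has_jacobian_integral \<mu> C y1 y2 \<longleftrightarrow>
     (\<forall>t. - (deriv y1 t)\<^sup>2 - (deriv y2 t)\<^sup>2 + 2 * omega \<mu> (y1 t, y2 t) = C)"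

definition U :: "real \<Rightarrow> real \<Rightarrow> (real \<times> real) set" where
  "U \<mu> C = {p. p \<notin> {primary1 \<mu>, primary2 \<mu>} \<and> 2 * omega \<mu> p - C \<ge> 0}"

text \<open>\<open>speed \<mu> C\<close> is the function \<open>f\<close>: a solution with Jacobian integral \<open>C\<close> passes through
  \<open>p\<close> with speed \<open>f p\<close>.\<close>

definition speed :: "real \<Rightarrow> real \<Rightarrow> real \<times> real \<Rightarrow> real" where
  "speed \<mu> C p = sqrt (2 * omega \<mu> p - C)"

definition enclosed_region :: "(real \<Rightarrow> real \<times> real) \<Rightarrow> (real \<times> real) set" where
  "enclosed_region \<alpha> = inside (range \<alpha>)"

text \<open>One period of the curve, reparametrised over \<open>[0, 1]\<close> in the complex plane; the orientation
  is the sign of its winding number around the enclosed points.\<close>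

definition complex_loop :: "(real \<Rightarrow> real \<times> real) \<Rightarrow> real \<Rightarrow> real \<Rightarrow> complex" where
  "complex_loop \<alpha> T s = Complex (fst (\<alpha> (T * s))) (snd (\<alpha> (T * s)))"

definition counterclockwise :: "(real \<Rightarrow> real \<times> real) \<Rightarrow> real \<Rightarrow> bool" where
  "counterclockwise \<alpha> T \<longleftrightarrow>
     (\<forall>(a, b) \<in> enclosed_region \<alpha>. winding_number (complex_loop \<alpha> T) (Complex a b) = 1)"

definition clockwise :: "(real \<Rightarrow> real \<times> real) \<Rightarrow> real \<Rightarrow> bool" where
  "clockwise \<alpha> T \<longleftrightarrow>
     (\<forall>(a, b) \<in> enclosed_region \<alpha>. winding_number (complex_loop \<alpha> T) (Complex a b) = - 1)"

definition ln_f_lap_integrable :: "real \<Rightarrow> real \<Rightarrow> (real \<times> real) set \<Rightarrow> bool" where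
  "ln_f_lap_integrable \<mu> C \<Omega> \<longleftrightarrow>
     set_integrable lborel (\<Omega> - {primary1 \<mu>, primary2 \<mu>})
       (laplacian (\<lambda>p. ln (speed \<mu> C p)))"

definition ln_f_lap_integral :: "real \<Rightarrow> real \<Rightarrow> (real \<times> real) set \<Rightarrow> real" where
  "ln_f_lap_integral \<mu> C \<Omega> =
     (LINT p:\<Omega> - {primary1 \<mu>, primary2 \<mu>}|lborel. laplacian (\<lambda>q. ln (speed \<mu> C q)) p)"

end

theory Submission
  imports Defs
begin

text \<open>By the equations of motion, the argument \<open>\<theta>\<close> of the velocity satisfies
  \<open>\<theta>' = (\<alpha>' \<times> \<nabla> ln f) - 2\<close>, because \<open>|\<alpha>'| = f\<close> and \<open>\<nabla> ln f = \<nabla> \<omega> / f\<^sup>2\<close> along the orbit. Over one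
  period \<open>\<theta>\<close> changes by \<open>\<plusminus> 2 \<pi>\<close> (Hopf's Umlaufsatz), and the integral of \<open>\<alpha>' \<times> \<nabla> ln f\<close> is a flux,
  which Green's formula turns into the integral of \<open>\<Delta> ln f\<close>. Since \<open>f\<^sup>2 r\<^sub>1 r\<^sub>2\<close> is positive on the closed
  region, each enclosed primary contributes only the term \<open>- ln r / 2\<close>, which is harmonic and
  has flux \<open>\<plusminus> \<pi>\<close>.

  Green's formula for the interior of the orbit follows from the Cauchy-Pompeiu formula for compactly
  supported functions: integrated along the orbit, its kernel becomes the winding number.\<close>

subsection \<open>Integrability of the Cauchy kernel\<close>

text \<open>The region is given only as \<open>inside\<close> of the orbit, so nothing is known
  about its boundary beyond the curve itself being a null set. The usable information is the winding
  number: \<open>n\<close> on the region, by the orientation hypothesis, and 0 in the outside.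
  Green's formula is therefore stated with winding numbers, and the Umlaufsatz, which concerns the
  tangent alone, must be tied to the same \<open>n\<close>.

  The other obstacle is regularity. The gradient of ln of
  \<open>f\<^sup>2 r\<^sub>1 r\<^sub>2\<close> stays bounded at the primaries but need not extend
  continuously, because it contains cosine and sine of the polar angle; its partials grow like the
  inverse distance. This growth is still integrable in the plane, so the Cauchy-Pompeiu formula is
  set up to admit it at finitely many points. The field also makes sense only where
  \<open>f\<^sup>2 r\<^sub>1 r\<^sub>2\<close> is nonzero; a positive lower bound on the compact
  closed region allows it to be altered elsewhere and extended to the plane with compact support.

  The four claims are instances of one identity in \<open>n\<close> and the set of enclosed
  primaries.\<close>

lemma AE_lborel_closed_negligible:
  fixes N :: "'a::euclidean_space set"
  assumes "negligible N" "closed N"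
  shows "AE x in lborel. x \<notin> N"
proof -
  have "N \<in> null_sets lebesgue"
    using assms(1) by (simp add: negligible_iff_null_sets)
  then have "N \<in> null_sets lborel"
    using assms(2) by (simp add: null_sets_completion_iff borel_closed)
  then show ?thesis
    by (rule AE_not_in)
qed

text \<open>One factor of the product majorant for \<open>1 / norm w\<close>. The exponent -1/2
  exceeds -1, and the negative half line is a reflection of the positive one.\<close>

lemma integrable_inverse_sqrt:
  fixes R :: real
  assumes "R \<ge> 0"
  shows "integrable lborel (\<lambda>x::real. indicator {-R..R} x * (\<bar>x\<bar> powr (-1/2)))"
proof -
  let ?f = "\<lambda>x::real. indicator {0..R} x * (x powr (-1/2))"
  have "(\<lambda>x::real. x powr (-1/2)) integrable_on {0..R}"
    using has_integral_powr_from_0[of "-1/2" R] assms by (auto simp: integrable_on_def)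
  then have "(\<lambda>x::real. x powr (-1/2)) absolutely_integrable_on {0..R}"
    by (intro nonnegative_absolutely_integrable_1) auto
  then have "integrable lebesgue ?f"
    by (simp add: set_integrable_def)
  then have f: "integrable lborel ?f"
    by (subst (asm) integrable_completion) auto
  then have f': "integrable lborel (\<lambda>x. ?f (0 + (-1) * x))"
    by (rule lborel_integrable_real_affine) simp
  show ?thesis
  proof (rule Bochner_Integration.integrable_bound[OF Bochner_Integration.integrable_add[OF f f']])
    show "AE x in lborel. norm (indicator {- R..R} x * \<bar>x\<bar> powr (- 1 / 2)) \<le> norm (?f x + ?f (0 + - 1 * x))"
      by (rule AE_I2) (auto simp: indicator_def)
  qed auto
qed

lemma sets_borel_cball_real2 [measurable]: "cball (a :: real \<times> real) R \<in> sets borel"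
  by (intro borel_closed closed_cball)

text \<open>Since \<open>\<bar>x\<bar> * \<bar>y\<bar> \<le> x\<^sup>2 + y\<^sup>2\<close>, the
  function is dominated by the product of \<open>\<bar>x\<bar> powr (-1/2)\<close> and
  \<open>\<bar>y\<bar> powr (-1/2)\<close>, and Fubini reduces the claim to one dimension.\<close>

lemma integrable_inverse_norm_cball:
  fixes R :: real
  assumes "R \<ge> 0"
  shows "integrable lborel (\<lambda>w::real \<times> real. indicator (cball 0 R) w * (1 / norm w))"
proof -
  let ?g = "\<lambda>x::real. indicator {-R..R} x * (\<bar>x\<bar> powr (-1/2))"
  have g: "integrable lborel ?g"
    by (rule integrable_inverse_sqrt[OF assms])
  have "integrable (lborel \<Otimes>\<^sub>M lborel) (\<lambda>(x, y). ?g x * ?g y)"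
  proof (rule lborel_pair.Fubini_integrable)
    have "integrable lborel (\<lambda>x. \<bar>?g x\<bar> * (LINT y|lborel. \<bar>?g y\<bar>))"
      using g by (intro integrable_mult_left integrable_abs)
    then show "integrable lborel (\<lambda>x. LINT y|lborel. norm (case (x, y) of (x, y) \<Rightarrow> ?g x * ?g y))"
      by (simp add: abs_mult)
    show "AE x in lborel. integrable lborel (\<lambda>y. case (x, y) of (x, y) \<Rightarrow> ?g x * ?g y)"
      using g by (intro AE_I2) (simp only: prod.case, intro integrable_mult_right, simp)
  qed auto
  then have prod: "integrable lborel (\<lambda>w::real \<times> real. ?g (fst w) * ?g (snd w))"
    unfolding lborel_prod case_prod_beta .
  \<comment> \<open>On the axes the majorant fails: \<open>0 powr (-1/2)\<close> is 0, so the
    product vanishes there.\<close>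
  have "negligible {w::real \<times> real. (1, 0) \<bullet> w = 0}" "negligible {w::real \<times> real. (0, 1) \<bullet> w = 0}"
    by ((rule negligible_hyperplane, simp add: zero_prod_def)+)
  then have ax: "AE w::real \<times> real in lborel. w \<notin> {w. (1, 0) \<bullet> w = 0}"
    "AE w::real \<times> real in lborel. w \<notin> {w. (0, 1) \<bullet> w = 0}"
    using AE_lborel_closed_negligible closed_hyperplane by blast+
  show ?thesis
  proof (rule Bochner_Integration.integrable_bound[OF prod])
    show "AE w::real \<times> real in lborel. norm (indicator (cball 0 R) w * (1 / norm w)) \<le> norm (?g (fst w) * ?g (snd w))"
      using ax
    proof eventually_elim
      case (elim w)
      obtain x y where w: "w = (x, y)" by force
      then have xy: "x \<noteq> 0" "y \<noteq> 0" using elim by auto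
      have n: "norm w = sqrt (x\<^sup>2 + y\<^sup>2)" by (simp add: w norm_Pair)
      show ?case
      proof (cases "w \<in> cball 0 R")
        case True
        then have "norm w \<le> R" by simp
        then have "\<bar>x\<bar> \<le> R" "\<bar>y\<bar> \<le> R"
          using norm_fst_le[of x y] norm_snd_le[of y x] by (auto simp: w)
        then have ind: "x \<in> {-R..R}" "y \<in> {-R..R}" by auto
        have "\<bar>x\<bar> * \<bar>y\<bar> \<le> x\<^sup>2 + y\<^sup>2"
          using sum_squares_bound[of "\<bar>x\<bar>" "\<bar>y\<bar>"] mult_nonneg_nonneg[of "\<bar>x\<bar>" "\<bar>y\<bar>"]
          unfolding power2_abs mult.assoc by linarith
        then have "sqrt \<bar>x\<bar> * sqrt \<bar>y\<bar> \<le> norm w"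
          by (simp add: n flip: real_sqrt_mult)
        moreover have "sqrt \<bar>x\<bar> * sqrt \<bar>y\<bar> > 0" using xy by simp
        ultimately have "1 / norm w \<le> 1 / (sqrt \<bar>x\<bar> * sqrt \<bar>y\<bar>)"
          by (intro divide_left_mono mult_pos_pos) auto
        also have "\<dots> = \<bar>x\<bar> powr (-1/2) * \<bar>y\<bar> powr (-1/2)"
          using xy by (simp add: powr_minus powr_half_sqrt field_simps)
        finally show ?thesis
          using True ind by (simp add: w)
      qed auto
    qed
    have "(\<lambda>w::real \<times> real. indicator (cball 0 R) w * (1 / norm w)) \<in> borel_measurable borel"
      by measurable
    then show "(\<lambda>w::real \<times> real. indicator (cball 0 R) w * (1 / norm w)) \<in> borel_measurable lborel"
      by simp
  qed
qed

text \<open>The equations and the area integrals live on \<open>real \<times> real\<close>, winding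
  numbers and the Cauchy kernel on \<open>complex\<close>; this isometry passes between
  them.\<close>

definition cpx :: "real \<times> real \<Rightarrow> complex" where
  "cpx w = Complex (fst w) (snd w)"

lemma norm_cpx [simp]: "norm (cpx w) = norm w"
  by (simp add: cpx_def cmod_def norm_prod_def)

lemma cpx_diff: "cpx (u - v) = cpx u - cpx v"
  by (simp add: cpx_def complex_eq_iff)

lemma dist_cpx [simp]: "dist (cpx u) (cpx v) = dist u v"
  by (simp add: dist_norm flip: cpx_diff)

lemma cpx_eq_iff [simp]: "cpx u = cpx v \<longleftrightarrow> u = v"
  by (metis dist_cpx dist_eq_0_iff)

lemma Re_cpx [simp]: "Re (cpx w) = fst w" and Im_cpx [simp]: "Im (cpx w) = snd w"
  by (simp_all add: cpx_def)

lemma cpx_Re_Im [simp]: "cpx (Re z, Im z) = z"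
  by (simp add: complex_eq_iff)

lemma cpx_altdef: "cpx w = of_real (fst w) + \<i> * of_real (snd w)"
  by (simp add: complex_eq_iff)

lemma continuous_on_cpx [continuous_intros]:
  "continuous_on A f \<Longrightarrow> continuous_on A (\<lambda>x. cpx (f x))"
  unfolding cpx_altdef by (intro continuous_intros)

lemma borel_measurable_cpx [measurable]:
  "f \<in> borel_measurable M \<Longrightarrow> (\<lambda>x. cpx (f x)) \<in> borel_measurable M"
  by (rule borel_measurable_continuous_on[where f = cpx]) (intro continuous_on_cpx continuous_on_id)

text \<open>Translation by \<open>z\<close> moves the disc of radius \<open>R\<close> into the one
  of radius \<open>R + K\<close>, so a single \<open>B\<close> serves all these \<open>z\<close>.
  The uniformity is what later permits integration along the curve.\<close>

lemma inverse_dist_integral_bound: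
  fixes R K :: real
  assumes "R \<ge> 0" "K \<ge> 0"
  obtains B where "B \<ge> 0" "\<And>z. norm z \<le> K \<Longrightarrow>
     integrable lborel (\<lambda>w::real \<times> real. indicator (cball 0 R) w * (1 / dist w z)) \<and>
     (LINT w|lborel. indicator (cball 0 R) w * (1 / dist w z)) \<le> B"
proof -
  let ?h = "\<lambda>w::real \<times> real. indicator (cball 0 (R + K)) w * (1 / norm w)"
  have h: "integrable lborel ?h"
    using assms by (intro integrable_inverse_norm_cball) auto
  have meas: "?h \<in> borel_measurable borel"
    using borel_measurable_integrable[OF h] by simp
  show ?thesis
  proof (rule that)
    show "integral\<^sup>L lborel ?h \<ge> 0" by (rule integral_nonneg_AE) auto
    fix z :: "real \<times> real" assume z: "norm z \<le> K"
    have distr: "distr lborel borel (\<lambda>w. - z + w) = lborel"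
      by (fact lborel_distr_plus)
    have "integrable (distr lborel borel (\<lambda>w. - z + w)) ?h"
      unfolding distr by (rule h)
    then have int: "integrable lborel (\<lambda>w. ?h (- z + w))"
      using meas by (subst (asm) integrable_distr_eq) auto
    have "integral\<^sup>L (distr lborel borel (\<lambda>w. - z + w)) ?h = (LINT w|lborel. ?h (- z + w))"
      using meas by (subst integral_distr) auto
    then have eq: "integral\<^sup>L lborel ?h = (LINT w|lborel. ?h (- z + w))"
      unfolding distr .
    have le: "indicator (cball 0 R) w * (1 / dist w z) \<le> ?h (- z + w)" for w
    proof (cases "w \<in> cball 0 R")
      case True
      then have "norm (- z + w) \<le> R + K"
        using z norm_triangle_ineq[of "- z" w] by simp
      then show ?thesis using True by (simp add: indicator_def dist_norm norm_minus_commute)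
    qed auto
    have int': "integrable lborel (\<lambda>w::real \<times> real. indicator (cball 0 R) w * (1 / dist w z))"
    proof (rule Bochner_Integration.integrable_bound[OF int])
      have "(\<lambda>w. indicator (cball 0 R) w * (1 / dist w z)) \<in> borel_measurable borel"
        by measurable
      then show "(\<lambda>w. indicator (cball 0 R) w * (1 / dist w z)) \<in> borel_measurable lborel"
        by simp
    qed (rule AE_I2, use le in \<open>simp add: abs_mult\<close>)
    show "integrable lborel (\<lambda>w::real \<times> real. indicator (cball 0 R) w * (1 / dist w z)) \<and>
     (LINT w|lborel. indicator (cball 0 R) w * (1 / dist w z)) \<le> integral\<^sup>L lborel ?h"
      unfolding eq using le by (intro conjI int' integral_mono int) auto
  qed
qed

subsection \<open>A regularised Cauchy kernel\<close>

text \<open>The lines in \<open>N\<close> will be those through singularities of the integrand, the points in \<open>P\<close> the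
  kinks of a regularised kernel.\<close>

lemma integral_x_derivative_eq_0:
  fixes H Hx :: "real \<times> real \<Rightarrow> 'a::euclidean_space"
  assumes int: "integrable lborel Hx" and "finite N"
    and cont: "\<And>y. y \<notin> N \<Longrightarrow> continuous_on UNIV (\<lambda>x. H (x, y))"
    and deriv: "\<And>y. y \<notin> N \<Longrightarrow> \<exists>P. finite P \<and>
       (\<forall>x. x \<notin> P \<longrightarrow> ((\<lambda>x. H (x, y)) has_vector_derivative Hx (x, y)) (at x))"
    and supp: "\<And>w. w \<notin> cball 0 R \<Longrightarrow> H w = 0 \<and> Hx w = 0"
  shows "integral\<^sup>L lborel Hx = 0"
proof -
  have int': "integrable (lborel \<Otimes>\<^sub>M lborel) (case_prod (\<lambda>x y. Hx (x, y)))"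
    using int by (simp add: lborel_prod)
  have "AE y in lborel. y \<notin> N"
    using \<open>finite N\<close> by (intro AE_lborel_closed_negligible negligible_finite finite_imp_closed)
  moreover have "AE y in lborel. integrable lborel (\<lambda>x. Hx (x, y))"
    by (rule lborel_pair.AE_integrable_snd[OF int'])
  ultimately have inner: "AE y in lborel. (LINT x|lborel. Hx (x, y)) = 0"
  proof eventually_elim
    case (elim y)
    \<comment> \<open>Nothing is assumed about the sign of \<open>R\<close>; with this choice the
      interval is never empty and its end points lie outside the support.\<close>
    define a where "a = \<bar>R\<bar> + 1"
    have out: "H (x, y) = 0 \<and> Hx (x, y) = 0" if "\<bar>x\<bar> \<ge> a" for x
    proof (rule supp)
      show "(x, y) \<notin> cball 0 R"
        using norm_fst_le[of x y] that by (auto simp: a_def)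
    qed
    obtain P where P: "finite P" "\<And>x. x \<notin> P \<Longrightarrow> ((\<lambda>x. H (x, y)) has_vector_derivative Hx (x, y)) (at x)"
      using deriv[OF elim(1)] by blast
    have "((\<lambda>x. Hx (x, y)) has_integral (H (a, y) - H (- a, y))) {- a..a}"
      using P cont[OF elim(1)]
      by (intro fundamental_theorem_of_calculus_strong[of P]) (auto simp: a_def intro: continuous_on_subset)
    then have "((\<lambda>x. Hx (x, y)) has_integral 0) {- a..a}"
      using out[of a] out[of "-a"] by (simp add: a_def)
    then have "((\<lambda>x. Hx (x, y)) has_integral 0) UNIV"
      by (rule has_integral_on_superset) (use out in \<open>auto simp: abs_if split: if_splits\<close>)
    then show ?case
      by (rule has_integral_unique[OF has_integral_integral_lborel[OF elim(2)]])
  qed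
  have "integral\<^sup>L lborel Hx = (LINT y|lborel. LINT x|lborel. Hx (x, y))"
    using lborel_pair.integral_snd[OF int'] by (simp add: lborel_prod)
  also have "\<dots> = 0"
    by (rule integral_eq_zero_AE[OF inner])
  finally show ?thesis .
qed

lemma integral_y_derivative_eq_0:
  fixes H Hy :: "real \<times> real \<Rightarrow> 'a::euclidean_space"
  assumes int: "integrable lborel Hy" and "finite N"
    and cont: "\<And>x. x \<notin> N \<Longrightarrow> continuous_on UNIV (\<lambda>y. H (x, y))"
    and deriv: "\<And>x. x \<notin> N \<Longrightarrow> \<exists>P. finite P \<and>
       (\<forall>y. y \<notin> P \<longrightarrow> ((\<lambda>y. H (x, y)) has_vector_derivative Hy (x, y)) (at y))"
    and supp: "\<And>w. w \<notin> cball 0 R \<Longrightarrow> H w = 0 \<and> Hy w = 0"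
  shows "integral\<^sup>L lborel Hy = 0"
proof -
  have int': "integrable (lborel \<Otimes>\<^sub>M lborel) Hy"
    using int by (simp add: lborel_prod)
  have "integrable lborel (\<lambda>(x, y). Hy (y, x))"
    using lborel_pair.integrable_product_swap[OF int'] by (simp add: lborel_prod)
  then have "integral\<^sup>L lborel (\<lambda>(x, y). Hy (y, x)) = 0"
  proof (rule integral_x_derivative_eq_0[where H = "\<lambda>(x, y). H (y, x)" and N = N and R = R])
    fix w :: "real \<times> real" assume "w \<notin> cball 0 R"
    then show "(case w of (x, y) \<Rightarrow> H (y, x)) = 0 \<and> (case w of (x, y) \<Rightarrow> Hy (y, x)) = 0"
      using supp[of "(snd w, fst w)"] by (cases w) (auto simp: norm_Pair add.commute)
  qed (use assms in auto)
  then show ?thesis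
    using lborel_pair.integral_product_swap[OF borel_measurable_integrable[OF int']]
    by (simp add: lborel_prod)
qed

text \<open>A Lipschitz regularisation of the Cauchy kernel; \<open>\<partial>/\<partial>x + \<i> \<partial>/\<partial>y\<close> maps it to
  \<open>2 / \<epsilon>\<^sup>2\<close> times the indicator function of the disc of radius \<open>\<epsilon>\<close>.\<close>

definition cauchy_kernel :: "real \<Rightarrow> complex \<Rightarrow> complex" where
  "cauchy_kernel \<epsilon> u = cnj u / of_real ((max (norm u) \<epsilon>)\<^sup>2)"

lemma cauchy_kernel_inner: "norm u \<le> \<epsilon> \<Longrightarrow> cauchy_kernel \<epsilon> u = cnj u / of_real (\<epsilon>\<^sup>2)"
  by (simp add: cauchy_kernel_def max_def)

lemma cauchy_kernel_outer: "norm u \<ge> \<epsilon> \<Longrightarrow> cauchy_kernel \<epsilon> u = 1 / u"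
proof (cases "u = 0")
  case False
  assume "norm u \<ge> \<epsilon>"
  then show ?thesis
    using False complex_norm_square[of u]
    by (simp add: cauchy_kernel_def max_def field_simps del: of_real_power)
qed (simp add: cauchy_kernel_def)

lemma norm_cauchy_kernel_le: "norm (cauchy_kernel \<epsilon> u) \<le> 1 / norm u"
proof (cases "u = 0")
  case False
  have "norm u * norm u \<le> (max (norm u) \<epsilon>)\<^sup>2"
    unfolding power2_eq_square by (intro mult_mono) (auto simp: max_def intro: order_trans[OF norm_ge_zero])
  moreover have "norm u > 0" "(max (norm u) \<epsilon>) > 0" using False by (auto simp: less_max_iff_disj)
  ultimately have "norm u / (max (norm u) \<epsilon>)\<^sup>2 \<le> 1 / norm u"
    by (simp add: field_simps)
  then show ?thesis
    by (simp add: cauchy_kernel_def norm_divide norm_power)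
qed (simp add: cauchy_kernel_def)

lemma norm_cauchy_kernel_le':
  assumes "\<epsilon> > 0"
  shows "norm (cauchy_kernel \<epsilon> u) \<le> 1 / \<epsilon>"
proof (cases "norm u \<le> \<epsilon>")
  case True
  then show ?thesis using assms
    by (simp add: cauchy_kernel_inner norm_divide norm_power norm_mult field_simps power2_eq_square)
next
  case False
  then have "norm (cauchy_kernel \<epsilon> u) \<le> 1 / norm u"
    by (intro norm_cauchy_kernel_le)
  also have "\<dots> \<le> 1 / \<epsilon>" using False assms by (intro divide_left_mono mult_pos_pos) auto
  finally show ?thesis .
qed

lemma continuous_on_cauchy_kernel:
  assumes "\<epsilon> > 0" "continuous_on A f"
  shows "continuous_on A (\<lambda>x. cauchy_kernel \<epsilon> (f x))"
  unfolding cauchy_kernel_def using assms by (intro continuous_intros) auto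

text \<open>Partial derivatives of \<open>cauchy_kernel\<close> off the circle
  \<open>norm u = \<epsilon>\<close>. On the circle, where the kernel has a kink, the outer value is
  taken.\<close>

definition cauchy_kernel_x :: "real \<Rightarrow> complex \<Rightarrow> complex" where
  "cauchy_kernel_x \<epsilon> u = (if norm u < \<epsilon> then 1 / of_real (\<epsilon>\<^sup>2) else - 1 / u\<^sup>2)"

definition cauchy_kernel_y :: "real \<Rightarrow> complex \<Rightarrow> complex" where
  "cauchy_kernel_y \<epsilon> u = (if norm u < \<epsilon> then - \<i> / of_real (\<epsilon>\<^sup>2) else - \<i> / u\<^sup>2)"

lemma norm_cauchy_kernel_xy_le:
  assumes "\<epsilon> > 0"
  shows "norm (cauchy_kernel_x \<epsilon> u) \<le> 1 / \<epsilon>\<^sup>2" "norm (cauchy_kernel_y \<epsilon> u) \<le> 1 / \<epsilon>\<^sup>2"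
proof -
  have "1 / (norm u)\<^sup>2 \<le> 1 / \<epsilon>\<^sup>2" if "\<not> norm u < \<epsilon>"
    using assms that by (intro divide_left_mono mult_pos_pos power_mono zero_less_power) auto
  then show "norm (cauchy_kernel_x \<epsilon> u) \<le> 1 / \<epsilon>\<^sup>2" "norm (cauchy_kernel_y \<epsilon> u) \<le> 1 / \<epsilon>\<^sup>2"
    using assms by (auto simp: cauchy_kernel_x_def cauchy_kernel_y_def norm_divide norm_power)
qed

text \<open>Inside the disc the kernel is a multiple of \<open>cnj\<close>, hence
  \<open>cnj d\<close>; outside it is holomorphic, and the chain rule applies. Continuity of
  \<open>f\<close> keeps nearby values on the same side of the circle.\<close>

lemma has_vector_derivative_cauchy_kernel:
  fixes f :: "real \<Rightarrow> complex"
  assumes f: "(f has_vector_derivative d) (at x)" and "norm (f x) \<noteq> \<epsilon>" "\<epsilon> > 0"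
  shows "((\<lambda>x. cauchy_kernel \<epsilon> (f x)) has_vector_derivative
           (if norm (f x) < \<epsilon> then cnj d / of_real (\<epsilon>\<^sup>2) else - d / (f x)\<^sup>2)) (at x)"
proof -
  have cont: "isCont f x"
    using f has_vector_derivative_continuous by blast
  show ?thesis
  proof (cases "norm (f x) < \<epsilon>")
    case True
    have "eventually (\<lambda>t. norm (f t) < \<epsilon>) (nhds x)"
      using cont True by (intro order_tendstoD(2)[of _ "norm (f x)"] tendsto_norm)
        (simp_all add: isCont_def tendsto_at_iff_tendsto_nhds)
    then have ev: "eventually (\<lambda>t. cnj (f t) / of_real (\<epsilon>\<^sup>2) = cauchy_kernel \<epsilon> (f t)) (nhds x)"
      by eventually_elim (simp add: cauchy_kernel_inner)
    have "((\<lambda>t. cnj (f t) / of_real (\<epsilon>\<^sup>2)) has_vector_derivative cnj d / of_real (\<epsilon>\<^sup>2)) (at x)"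
      using f by (intro has_vector_derivative_divide has_vector_derivative_cnj)
    then show ?thesis
      using True ev unfolding eventually_nhds
      by (auto intro: has_vector_derivative_transform_within_open)
  next
    case False
    with assms have gt: "norm (f x) > \<epsilon>" by simp
    have "eventually (\<lambda>t. norm (f t) > \<epsilon>) (nhds x)"
      using cont gt by (intro order_tendstoD(1)[of _ "norm (f x)"] tendsto_norm)
        (simp_all add: isCont_def tendsto_at_iff_tendsto_nhds)
    then have ev: "eventually (\<lambda>t. 1 / f t = cauchy_kernel \<epsilon> (f t)) (nhds x)"
      by eventually_elim (simp add: cauchy_kernel_outer)
    have nz: "f x \<noteq> 0" using gt assms by auto
    have "((\<lambda>u. 1 / u) has_field_derivative - 1 / (f x)\<^sup>2) (at (f x))"
      using nz by (auto intro!: derivative_eq_intros simp: power2_eq_square)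
    from field_vector_diff_chain_at[OF f this]
    have "((\<lambda>t. 1 / f t) has_vector_derivative - d / (f x)\<^sup>2) (at x)"
      by (simp add: o_def)
    then show ?thesis
      using False ev unfolding eventually_nhds
      by (auto intro: has_vector_derivative_transform_within_open)
  qed
qed

text \<open>A line parallel to an axis meets the circle at most twice, so the kinks of the kernel
  form a finite exceptional set for the fundamental theorem of calculus.\<close>

lemma finite_circle_line:
  fixes a b \<epsilon> :: real
  shows "finite {x. sqrt ((x - a)\<^sup>2 + b\<^sup>2) = \<epsilon>}"
proof (rule finite_subset)
  show "{x. sqrt ((x - a)\<^sup>2 + b\<^sup>2) = \<epsilon>} \<subseteq> {a + sqrt (\<epsilon>\<^sup>2 - b\<^sup>2), a - sqrt (\<epsilon>\<^sup>2 - b\<^sup>2)}"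
  proof
    fix x assume "x \<in> {x. sqrt ((x - a)\<^sup>2 + b\<^sup>2) = \<epsilon>}"
    then have "\<epsilon>\<^sup>2 - b\<^sup>2 = (x - a)\<^sup>2" by auto
    then show "x \<in> {a + sqrt (\<epsilon>\<^sup>2 - b\<^sup>2), a - sqrt (\<epsilon>\<^sup>2 - b\<^sup>2)}"
      by (auto simp: abs_if)
  qed
qed auto

text \<open>Recovers the value at \<open>z\<close> from the disc averages that the regularised
  kernel produces. Once the disc is so small that \<open>F\<close> varies by less than
  \<open>r / 2\<close> on it, the average is off by at most \<open>r / 2\<close>.\<close>

lemma average_disc_tendsto:
  fixes F :: "real \<times> real \<Rightarrow> complex"
  assumes int: "integrable lborel F" and cont: "isCont F z"
    and e: "e \<longlonglongrightarrow> 0" "\<And>n::nat. e n > 0"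
  shows "(\<lambda>n. (1 / (pi * (e n)\<^sup>2)) *\<^sub>R (LINT w|lborel. indicator (ball z (e n)) w *\<^sub>R F w)) \<longlonglongrightarrow> F z"
proof (rule LIMSEQ_I)
  fix r :: real assume r: "r > 0"
  then obtain d where d: "d > 0" "\<And>w. dist w z < d \<Longrightarrow> dist (F w) (F z) < r / 2"
    using cont unfolding continuous_at_eps_delta by (metis half_gt_zero)
  obtain n0 where n0: "\<And>n. n \<ge> n0 \<Longrightarrow> e n < d"
    using order_tendstoD(2)[OF e(1) d(1)] by (auto simp: eventually_sequentially)
  show "\<exists>n0. \<forall>n\<ge>n0. norm ((1 / (pi * (e n)\<^sup>2)) *\<^sub>R (LINT w|lborel. indicator (ball z (e n)) w *\<^sub>R F w) - F z) < r"
  proof (intro exI allI impI)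
    fix n assume "n \<ge> n0"
    let ?B = "ball z (e n)" and ?A = "pi * (e n)\<^sup>2"
    have A: "measure lborel ?B = ?A"
      using content_ball[of "e n" z] e(2)[of n] by (simp add: unit_ball_vol_2 mult.commute power2_eq_square)
    have Apos: "?A > 0" using e(2)[of n] by simp
    have fin: "emeasure lborel ?B < \<infinity>" by (intro emeasure_bounded_finite) auto
    have i1: "integrable lborel (\<lambda>w. indicator ?B w *\<^sub>R F w)"
      using int by (intro integrable_mult_indicator) auto
    have i2: "integrable lborel (\<lambda>w. indicator ?B w *\<^sub>R c)" for c :: complex
      using fin by (intro integrable_scaleR_left) auto
    have ind: "(LINT w|lborel. indicator ?B w *\<^sub>R c) = ?A *\<^sub>R c" for c :: complex
      using fin A by simp
    have "norm ((LINT w|lborel. indicator ?B w *\<^sub>R F w) - ?A *\<^sub>R F z) =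
        norm (LINT w|lborel. indicator ?B w *\<^sub>R (F w - F z))"
      using i1 i2 by (subst ind[symmetric], subst Bochner_Integration.integral_diff[symmetric]) (auto simp: scaleR_diff_right)
    also have "\<dots> \<le> (LINT w|lborel. indicator ?B w * (r / 2))"
    proof (rule Bochner_Integration.integral_norm_bound_integral)
      show "integrable lborel (\<lambda>w. indicator ?B w *\<^sub>R (F w - F z))"
        using i1 i2[of "F z"] by (simp add: scaleR_diff_right)
      show "integrable lborel (\<lambda>w. indicator ?B w * (r / 2))"
        using fin by (intro integrable_mult_left) auto
      fix w
      show "norm (indicator ?B w *\<^sub>R (F w - F z)) \<le> indicator ?B w * (r / 2)"
        using d(2)[of w] n0[OF \<open>n \<ge> n0\<close>] by (auto simp: indicator_def dist_norm norm_minus_commute)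
    qed
    also have "\<dots> = ?A * (r / 2)" using fin A by simp
    finally have le: "norm ((LINT w|lborel. indicator ?B w *\<^sub>R F w) - ?A *\<^sub>R F z) \<le> ?A * (r / 2)" .
    have "(1 / ?A) *\<^sub>R (LINT w|lborel. indicator ?B w *\<^sub>R F w) - F z =
       (1 / ?A) *\<^sub>R ((LINT w|lborel. indicator ?B w *\<^sub>R F w) - ?A *\<^sub>R F z)"
      using e(2)[of n] by (simp add: scaleR_diff_right)
    then have "norm ((1 / ?A) *\<^sub>R (LINT w|lborel. indicator ?B w *\<^sub>R F w) - F z) =
        (1 / ?A) * norm ((LINT w|lborel. indicator ?B w *\<^sub>R F w) - ?A *\<^sub>R F z)"
      using Apos by (simp add: norm_scaleR)
    also have "\<dots> \<le> (1 / ?A) * (?A * (r / 2))" using Apos by (intro mult_left_mono le) auto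
    also have "\<dots> < r" using Apos r by simp
    finally show "norm ((1 / ?A) *\<^sub>R (LINT w|lborel. indicator ?B w *\<^sub>R F w) - F z) < r" .
  qed
qed

subsection \<open>The Cauchy-Pompeiu formula\<close>

lemma borel_measurable_continuous_off_finite:
  fixes f :: "'a::t1_space \<Rightarrow> 'b::real_normed_vector"
  assumes "finite S" "continuous_on (- S) f"
  shows "f \<in> borel_measurable borel"
proof (rule measurable_discrete_difference)
  have "- S \<in> sets borel"
    using assms(1) by (intro borel_open open_Compl finite_imp_closed)
  with assms(2) show "(\<lambda>x. indicator (- S) x *\<^sub>R f x) \<in> borel_measurable borel"
    by (intro borel_measurable_continuous_on_indicator)
  show "countable S" using assms(1) by (rule countable_finite)
qed (auto simp: indicator_def)

lemma integrable_mult_bounded_right: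
  fixes f g :: "'a \<Rightarrow> complex"
  assumes "integrable M f" "g \<in> borel_measurable M" "\<And>x. norm (g x) \<le> B"
  shows "integrable M (\<lambda>x. f x * g x)"
proof (rule Bochner_Integration.integrable_bound)
  show "integrable M (\<lambda>x. f x * of_real B)" using assms(1) by simp
  show "AE x in M. norm (f x * g x) \<le> norm (f x * of_real B)"
    using assms(3) by (intro AE_I2) (auto simp: norm_mult intro!: mult_left_mono order_trans[OF _ abs_ge_self])
  show "(\<lambda>x. f x * g x) \<in> borel_measurable M"
    using assms by measurable
qed

text \<open>Partial fractions: \<open>1 / (a * b)\<close> is
  \<open>(1 / a + 1 / b) / (a + b)\<close>. With \<open>a\<close>, \<open>b\<close> the distances to
  two points at least \<open>d\<close> apart, a product of two simple singularities is controlled by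
  their sum. If \<open>a\<close> or \<open>b\<close> is 0, the left side is 0 by convention.\<close>

lemma inverse_mult_le_inverse_add:
  fixes a b d :: real
  assumes "a \<ge> 0" "b \<ge> 0" "d > 0" "d \<le> a + b"
  shows "1 / a * (1 / b) \<le> (1 / a + 1 / b) / d"
proof (cases "a = 0 \<or> b = 0")
  case False
  then have "a > 0" "b > 0" using assms by auto
  then have "1 / a + 1 / b = (a + b) * (1 / a * (1 / b))"
    by (simp add: field_simps)
  then have "1 / a * (1 / b) = (1 / a + 1 / b) / (a + b)"
    using \<open>a > 0\<close> \<open>b > 0\<close> by (simp del: times_divide_eq_right)
  also have "\<dots> \<le> (1 / a + 1 / b) / d"
    using assms \<open>a > 0\<close> \<open>b > 0\<close> by (intro divide_left_mono) auto
  finally show ?thesis .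
qed (use assms in auto)

text \<open>The class for which the Cauchy-Pompeiu formula is proved. Inverse-distance growth of the
  gradient is what a direction-dependent bounded function, such as the cosine of the polar angle,
  shows at its centre.\<close>

locale compact_scalar_field =
  fixes S :: "(real \<times> real) set" and R M :: real and F Fx Fy :: "real \<times> real \<Rightarrow> real"
  assumes finite_S: "finite S"
    and R: "R \<ge> 0"
    and supp: "\<And>w. w \<notin> cball 0 R \<Longrightarrow> F w = 0 \<and> Fx w = 0 \<and> Fy w = 0"
    and dx: "\<And>x y. (x, y) \<notin> S \<Longrightarrow> ((\<lambda>x. F (x, y)) has_real_derivative Fx (x, y)) (at x)"
    and dy: "\<And>x y. (x, y) \<notin> S \<Longrightarrow> ((\<lambda>y. F (x, y)) has_real_derivative Fy (x, y)) (at y)"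
    and cont: "continuous_on (- S) F" "continuous_on (- S) Fx" "continuous_on (- S) Fy"
    and bound: "\<And>w. w \<notin> S \<Longrightarrow> \<bar>F w\<bar> \<le> M"
    and bound_x: "\<And>w. w \<notin> S \<Longrightarrow> \<bar>Fx w\<bar> \<le> M * (1 + (\<Sum>s\<in>S. 1 / dist w s))"
    and bound_y: "\<And>w. w \<notin> S \<Longrightarrow> \<bar>Fy w\<bar> \<le> M * (1 + (\<Sum>s\<in>S. 1 / dist w s))"
begin

lemma measurable_field [measurable]:
  "F \<in> borel_measurable borel" "Fx \<in> borel_measurable borel" "Fy \<in> borel_measurable borel"
  using finite_S cont by (auto intro: borel_measurable_continuous_off_finite)

text \<open>Twice the Wirtinger derivative of \<open>F\<close> with respect to the conjugate
  variable.\<close>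

definition E :: "real \<times> real \<Rightarrow> complex" where
  "E w = of_real (Fx w) + \<i> * of_real (Fy w)"

lemma measurable_E [measurable]: "E \<in> borel_measurable borel"
  unfolding E_def[abs_def] by measurable

lemma M_nonneg: "M \<ge> 0"
proof -
  have "infinite (UNIV :: (real \<times> real) set)"
    by (simp add: infinite_UNIV_char_0 finite_prod)
  then obtain w where "w \<notin> S" using finite_S by (metis UNIV_I finite_subset subsetI)
  then show ?thesis using bound[of w] by simp
qed

lemma AE_not_in_S: "AE w in lborel. w \<notin> S"
  using finite_S by (intro AE_lborel_closed_negligible negligible_finite finite_imp_closed)

lemma norm_E_le:
  assumes "w \<notin> S"
  shows "norm (E w) \<le> 2 * M * (indicator (cball 0 R) w * (1 + (\<Sum>s\<in>S. 1 / dist w s)))"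
proof (cases "w \<in> cball 0 R")
  case True
  have "norm (E w) \<le> \<bar>Fx w\<bar> + \<bar>Fy w\<bar>"
    unfolding E_def using norm_triangle_ineq[of "of_real (Fx w)" "\<i> * of_real (Fy w)"]
    by (simp add: norm_mult)
  also have "\<dots> \<le> 2 * M * (1 + (\<Sum>s\<in>S. 1 / dist w s))"
    using bound_x[OF assms] bound_y[OF assms] by simp
  finally show ?thesis using True by simp
qed (use supp[of w] in \<open>simp add: E_def\<close>)

text \<open>The integrand has singularities at \<open>z\<close> and at the points of
  \<open>S\<close>, and these stay at least \<open>d\<close> apart, so
  \<open>inverse_mult_le_inverse_add\<close> splits it into integrals of single inverse distances.
  The bound depends on \<open>z\<close> only through \<open>K\<close> and \<open>d\<close>, as
  Fubini along a curve requires.\<close>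

lemma E_kernel_bound:
  assumes "d > 0" "K \<ge> 0"
  obtains B where "B \<ge> 0" "\<And>z. norm z \<le> K \<Longrightarrow> (\<And>s. s \<in> S \<Longrightarrow> d \<le> dist z s) \<Longrightarrow>
     integrable lborel (\<lambda>w. norm (E w) / dist w z) \<and> (LINT w|lborel. norm (E w) / dist w z) \<le> B"
proof -
  \<comment> \<open>Enlarged so that the uniform bound also applies with centre at any point of
    \<open>S\<close>.\<close>
  define K' where "K' = K + (\<Sum>s\<in>S. norm s)"
  have "K' \<ge> 0" unfolding K'_def using assms by (intro add_nonneg_nonneg sum_nonneg) auto
  then obtain B where B: "B \<ge> 0" "\<And>z. norm z \<le> K' \<Longrightarrow>
     integrable lborel (\<lambda>w::real \<times> real. indicator (cball 0 R) w * (1 / dist w z)) \<and>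
     (LINT w|lborel. indicator (cball 0 R) w * (1 / dist w z)) \<le> B"
    using inverse_dist_integral_bound[OF R] by blast
  define k where "k = (\<lambda>z w::real \<times> real. indicator (cball 0 R) w * (1 / dist w z))"
  have Bk: "integrable lborel (k z)" "integral\<^sup>L lborel (k z) \<le> B" if "norm z \<le> K'" for z
    using B(2)[OF that] by (simp_all add: k_def[abs_def])
  have nS: "norm s \<le> K'" if "s \<in> S" for s
    using member_le_sum[OF that, of norm] finite_S assms by (simp add: K'_def)
  show ?thesis
  proof (rule that)
    show "2 * M * (B + (\<Sum>s\<in>S. (B + B) / d)) \<ge> 0"
      using M_nonneg B(1) assms by (intro mult_nonneg_nonneg add_nonneg_nonneg sum_nonneg) auto
    fix z assume z: "norm z \<le> K" and dz: "\<And>s. s \<in> S \<Longrightarrow> d \<le> dist z s"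
    have nz: "norm z \<le> K'"
      using z sum_nonneg[of S norm] by (simp add: K'_def)
    let ?g = "\<lambda>w. 2 * M * (k z w + (\<Sum>s\<in>S. (k s w + k z w) / d))"
    have g: "integrable lborel ?g"
      using Bk(1)[OF nz] Bk(1)[OF nS] 
      by (intro integrable_mult_right Bochner_Integration.integrable_add Bochner_Integration.integrable_sum integrable_divide) auto
    have le: "norm (E w) / dist w z \<le> ?g w" if w: "w \<notin> S" for w
    proof (cases "w \<in> cball 0 R")
      case True
      then have k: "k u w = 1 / dist w u" for u by (simp add: k_def)
      have "norm (E w) / dist w z \<le> 2 * M * (1 + (\<Sum>s\<in>S. 1 / dist w s)) / dist w z"
        using norm_E_le[OF w] True by (intro divide_right_mono) auto
      also have "\<dots> = 2 * M * (1 / dist w z + (\<Sum>s\<in>S. 1 / dist w s * (1 / dist w z)))"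
        by (simp add: add_divide_distrib distrib_left sum_distrib_left sum_divide_distrib)
      also have "\<dots> \<le> 2 * M * (1 / dist w z + (\<Sum>s\<in>S. (1 / dist w s + 1 / dist w z) / d))"
      proof (intro mult_left_mono add_left_mono sum_mono)
        fix s assume "s \<in> S"
        then have "d \<le> dist w s + dist w z"
          using dz[of s] dist_triangle2[of z s w] by (simp add: dist_commute)
        then show "1 / dist w s * (1 / dist w z) \<le> (1 / dist w s + 1 / dist w z) / d"
          using assms by (intro inverse_mult_le_inverse_add) auto
      qed (use M_nonneg in auto)
      finally show ?thesis by (simp add: k)
    next
      case False
      then show ?thesis using supp[of w] by (simp add: E_def k_def)
    qed
    have AEle: "AE w in lborel. norm (E w) / dist w z \<le> ?g w"
      using AE_not_in_S by eventually_elim (rule le)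
    have m: "(\<lambda>w. norm (E w) / dist w z) \<in> borel_measurable lborel"
      by measurable
    have int: "integrable lborel (\<lambda>w. norm (E w) / dist w z)"
    proof (rule Bochner_Integration.integrable_bound[OF g m])
      show "AE w in lborel. norm (norm (E w) / dist w z) \<le> norm (?g w)"
        using AEle by eventually_elim (auto intro: order_trans[OF _ abs_ge_self])
    qed
    have "(LINT w|lborel. norm (E w) / dist w z) \<le> integral\<^sup>L lborel ?g"
      by (rule integral_mono_AE[OF int g AEle])
    also have "integral\<^sup>L lborel ?g = 2 * M * (integral\<^sup>L lborel (k z) +
        (\<Sum>s\<in>S. (integral\<^sup>L lborel (k s) + integral\<^sup>L lborel (k z)) / d))"
      using Bk(1)[OF nz] Bk(1)[OF nS]
      by (simp add: Bochner_Integration.integral_add Bochner_Integration.integral_sum)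
    also have "\<dots> \<le> 2 * M * (B + (\<Sum>s\<in>S. (B + B) / d))"
      using M_nonneg Bk(2)[OF nz] Bk(2)[OF nS] assms
      by (intro mult_left_mono add_mono sum_mono divide_right_mono) auto
    finally show "integrable lborel (\<lambda>w. norm (E w) / dist w z) \<and>
       (LINT w|lborel. norm (E w) / dist w z) \<le> 2 * M * (B + (\<Sum>s\<in>S. (B + B) / d))"
      using int by blast
  qed
qed

lemma integrable_E: "integrable lborel E"
proof -
  let ?k = "\<lambda>z w::real \<times> real. indicator (cball 0 R) w * (1 / dist w z)"
  have k: "integrable lborel (?k z)" for z
    using inverse_dist_integral_bound[OF R norm_ge_zero[of z]] by (metis order_refl)
  have one: "integrable lborel (\<lambda>w::real \<times> real. indicator (cball 0 R) w :: real)"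
    by (intro integrable_real_indicator emeasure_bounded_finite) auto
  have "integrable lborel (\<lambda>w. 2 * M * (indicator (cball 0 R) w + (\<Sum>s\<in>S. ?k s w)))"
    by (intro integrable_mult_right Bochner_Integration.integrable_add Bochner_Integration.integrable_sum k one)
  then have "integrable lborel (\<lambda>w. 2 * M * (indicator (cball 0 R) w * (1 + (\<Sum>s\<in>S. 1 / dist w s))))"
    by (simp add: distrib_left sum_distrib_left)
  then show ?thesis
  proof (rule Bochner_Integration.integrable_bound)
    show "AE w in lborel. norm (E w) \<le> norm (2 * M * (indicator (cball 0 R) w * (1 + (\<Sum>s\<in>S. 1 / dist w s))))"
      using AE_not_in_S
      by eventually_elim (auto intro: order_trans[OF norm_E_le abs_ge_self] simp del: times_divide_eq_right)
  qed measurable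
qed

lemma integrable_Fx: "integrable lborel Fx" and integrable_Fy: "integrable lborel Fy"
  using integrable_Re[OF integrable_E] integrable_Im[OF integrable_E] by (simp_all add: E_def)

lemma integrable_F: "integrable lborel (\<lambda>w. complex_of_real (F w))"
proof (rule Bochner_Integration.integrable_bound)
  show "integrable lborel (\<lambda>w::real \<times> real. indicator (cball 0 R) w * M)"
    by (intro integrable_mult_left integrable_real_indicator emeasure_bounded_finite) auto
  show "AE w in lborel. norm (complex_of_real (F w)) \<le> norm (indicator (cball 0 R) w * M)"
    using AE_not_in_S
  proof eventually_elim
    case (elim w)
    then show ?case using bound[of w] supp[of w] by (cases "w \<in> cball 0 R") auto
  qed
qed measurable

text \<open>The derivatives of the compactly supported product of \<open>F\<close> and the kernel
  integrate to 0. By the product rule this balances the derivative of \<open>F\<close> against that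
  of the kernel. The regularised kernel is continuous across \<open>z\<close>, so almost every line
  can be integrated in full.\<close>

lemma integral_E_cauchy_kernel:
  assumes "e > 0"
  shows "(LINT w|lborel. E w * cauchy_kernel e (cpx w - cpx z)) =
     - 2 * pi * ((1 / (pi * e\<^sup>2)) *\<^sub>R (LINT w|lborel. indicator (ball z e) w *\<^sub>R complex_of_real (F w)))"
proof -
  let ?u = "\<lambda>w. cpx w - cpx z"
  let ?H = "\<lambda>w. of_real (F w) * cauchy_kernel e (?u w)"
  let ?Hx = "\<lambda>w. of_real (F w) * cauchy_kernel_x e (?u w) + of_real (Fx w) * cauchy_kernel e (?u w)"
  let ?Hy = "\<lambda>w. of_real (F w) * cauchy_kernel_y e (?u w) + of_real (Fy w) * cauchy_kernel e (?u w)"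
  have mK: "(\<lambda>w. cauchy_kernel e (?u w)) \<in> borel_measurable borel"
    using assms
    by (intro borel_measurable_continuous_onI continuous_on_cauchy_kernel) (auto intro!: continuous_intros)
  have mKx: "(\<lambda>w. cauchy_kernel_x e (?u w)) \<in> borel_measurable borel"
    unfolding cauchy_kernel_x_def by measurable
  have mKy: "(\<lambda>w. cauchy_kernel_y e (?u w)) \<in> borel_measurable borel"
    unfolding cauchy_kernel_y_def by measurable
  have iE: "integrable lborel (\<lambda>w. E w * cauchy_kernel e (?u w))"
    by (rule integrable_mult_bounded_right[OF integrable_E _ norm_cauchy_kernel_le'[OF assms]]) (use mK in simp)
  have iF: "integrable lborel (\<lambda>w. of_real (F w) * cauchy_kernel_x e (?u w))"
    "integrable lborel (\<lambda>w. of_real (F w) * cauchy_kernel_y e (?u w))"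
    using mKx mKy
    by (auto intro: integrable_mult_bounded_right[OF integrable_F _ norm_cauchy_kernel_xy_le(1)[OF assms]]
      integrable_mult_bounded_right[OF integrable_F _ norm_cauchy_kernel_xy_le(2)[OF assms]])
  have iFx: "integrable lborel (\<lambda>w. of_real (Fx w) * cauchy_kernel e (?u w))"
    "integrable lborel (\<lambda>w. of_real (Fy w) * cauchy_kernel e (?u w))"
    using mK integrable_Fx integrable_Fy
    by (auto intro!: integrable_mult_bounded_right[OF _ _ norm_cauchy_kernel_le'[OF assms]])
  have u_x: "((\<lambda>x. ?u (x, y)) has_vector_derivative 1) (at x)" for x y
    unfolding cpx_altdef by (auto intro!: derivative_eq_intros)
  have u_y: "((\<lambda>y. ?u (x, y)) has_vector_derivative \<i>) (at y)" for x y
    unfolding cpx_altdef by (auto intro!: derivative_eq_intros)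
  have 0: "integral\<^sup>L lborel ?Hx = 0"
  proof (rule integral_x_derivative_eq_0[where H = ?H and R = R and N = "snd ` S"])
    show "integrable lborel ?Hx" using iF iFx by auto
    show "finite (snd ` S)" using finite_S by simp
    fix y assume "y \<notin> snd ` S"
    then have y: "(x, y) \<notin> S" for x by force
    show "continuous_on UNIV (\<lambda>x. ?H (x, y))"
      using dx[OF y] assms
      by (intro continuous_intros continuous_on_cauchy_kernel) (auto intro!: continuous_at_imp_continuous_on DERIV_isCont)
    show "\<exists>P. finite P \<and> (\<forall>x. x \<notin> P \<longrightarrow> ((\<lambda>x. ?H (x, y)) has_vector_derivative ?Hx (x, y)) (at x))"
    proof (intro exI conjI allI impI)
      show "finite {x. norm (?u (x, y)) = e}"
        using finite_circle_line[of "fst z" "y - snd z" e] by (simp add: cmod_def)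
      fix x assume "x \<notin> {x. norm (?u (x, y)) = e}"
      then have "((\<lambda>x. cauchy_kernel e (?u (x, y))) has_vector_derivative cauchy_kernel_x e (?u (x, y))) (at x)"
        using has_vector_derivative_cauchy_kernel[OF u_x, of x y e] assms by (simp add: cauchy_kernel_x_def split: if_splits)
      moreover have "((\<lambda>x. complex_of_real (F (x, y))) has_vector_derivative of_real (Fx (x, y))) (at x)"
        by (rule has_vector_derivative_of_real[OF dx[OF y]])
      ultimately show "((\<lambda>x. ?H (x, y)) has_vector_derivative ?Hx (x, y)) (at x)"
        by (intro has_vector_derivative_mult)
    qed
  qed (use supp in auto)
  have 1: "integral\<^sup>L lborel ?Hy = 0"
  proof (rule integral_y_derivative_eq_0[where H = ?H and R = R and N = "fst ` S"])
    show "integrable lborel ?Hy" using iF iFx by auto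
    show "finite (fst ` S)" using finite_S by simp
    fix x assume "x \<notin> fst ` S"
    then have x: "(x, y) \<notin> S" for y by force
    show "continuous_on UNIV (\<lambda>y. ?H (x, y))"
      using dy[OF x] assms
      by (intro continuous_intros continuous_on_cauchy_kernel) (auto intro!: continuous_at_imp_continuous_on DERIV_isCont)
    show "\<exists>P. finite P \<and> (\<forall>y. y \<notin> P \<longrightarrow> ((\<lambda>y. ?H (x, y)) has_vector_derivative ?Hy (x, y)) (at y))"
    proof (intro exI conjI allI impI)
      show "finite {y. norm (?u (x, y)) = e}"
        using finite_circle_line[of "snd z" "x - fst z" e] by (simp add: cmod_def add.commute)
      fix y assume "y \<notin> {y. norm (?u (x, y)) = e}"
      then have "((\<lambda>y. cauchy_kernel e (?u (x, y))) has_vector_derivative cauchy_kernel_y e (?u (x, y))) (at y)"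
        using has_vector_derivative_cauchy_kernel[OF u_y, of x y e] assms by (simp add: cauchy_kernel_y_def split: if_splits)
      moreover have "((\<lambda>y. complex_of_real (F (x, y))) has_vector_derivative of_real (Fy (x, y))) (at y)"
        by (rule has_vector_derivative_of_real[OF dy[OF x]])
      ultimately show "((\<lambda>y. ?H (x, y)) has_vector_derivative ?Hy (x, y)) (at y)"
        by (intro has_vector_derivative_mult)
    qed
  qed (use supp in auto)
  \<comment> \<open>Outside the disc \<open>- 1 / u\<^sup>2\<close> and
    \<open>\<i> * (- \<i> / u\<^sup>2)\<close> cancel; inside, both contributions are
    \<open>1 / e\<^sup>2\<close>, whence the factor 2.\<close>
  have eq: "?Hx w + \<i> * ?Hy w =
      E w * cauchy_kernel e (?u w) + (2 / of_real (e\<^sup>2)) * (indicator (ball z e) w *\<^sub>R of_real (F w))" for w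
  proof -
    have "norm (?u w) < e \<longleftrightarrow> w \<in> ball z e"
      by (simp add: dist_commute flip: dist_norm)
    then have "cauchy_kernel_x e (?u w) + \<i> * cauchy_kernel_y e (?u w) = (2 / of_real (e\<^sup>2)) * indicator (ball z e) w"
      by (auto simp: cauchy_kernel_x_def cauchy_kernel_y_def indicator_def)
    then have "of_real (F w) * (cauchy_kernel_x e (?u w) + \<i> * cauchy_kernel_y e (?u w)) =
        (2 / of_real (e\<^sup>2)) * (indicator (ball z e) w *\<^sub>R of_real (F w))"
      by (simp add: scaleR_conv_of_real indicator_def)
    then show ?thesis by (simp add: E_def algebra_simps)
  qed
  have iB: "integrable lborel (\<lambda>w. indicator (ball z e) w *\<^sub>R complex_of_real (F w))"
    using integrable_F by (intro integrable_mult_indicator) auto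
  have "0 = integral\<^sup>L lborel ?Hx + \<i> * integral\<^sup>L lborel ?Hy"
    using 0 1 by simp
  also have "\<dots> = (LINT w|lborel. ?Hx w + \<i> * ?Hy w)"
    using iF iFx by (subst Bochner_Integration.integral_add) auto
  also have "\<dots> = (LINT w|lborel. E w * cauchy_kernel e (?u w)) +
      (2 / of_real (e\<^sup>2)) * (LINT w|lborel. indicator (ball z e) w *\<^sub>R complex_of_real (F w))"
    by (simp only: eq Bochner_Integration.integral_add[OF iE integrable_mult_right[OF iB]] integral_mult_right_zero)
  finally have "(LINT w|lborel. E w * cauchy_kernel e (?u w)) =
     - ((2 / of_real (e\<^sup>2)) * (LINT w|lborel. indicator (ball z e) w *\<^sub>R complex_of_real (F w)))"
    by (simp add: eq_neg_iff_add_eq_0)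
  then show ?thesis by (simp add: scaleR_conv_of_real field_simps)
qed

text \<open>The limit of \<open>integral_E_cauchy_kernel\<close> as the radius tends to 0. On the
  left, convergence is dominated by \<open>norm (E w) / dist w z\<close>, and for each
  \<open>w\<close> other than \<open>z\<close> the kernels eventually equal the Cauchy kernel; on
  the right, disc averages converge by continuity at \<open>z\<close>.\<close>

theorem cauchy_pompeiu:
  assumes "z \<notin> S"
  shows "(LINT w|lborel. E w / (cpx w - cpx z)) = - 2 * pi * F z"
proof -
  define e where "e n = 1 / real (Suc n)" for n
  have e: "e \<longlonglongrightarrow> 0" "\<And>n. e n > 0"
    unfolding e_def using LIMSEQ_inverse_real_of_nat by (simp_all add: inverse_eq_divide)
  obtain d where d: "d > 0" "\<And>s. s \<in> S \<Longrightarrow> d \<le> dist z s"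
    using finite_set_avoid[OF finite_S, of z] assms by metis
  have int: "integrable lborel (\<lambda>w. norm (E w) / dist w z)"
    using E_kernel_bound[OF d(1) norm_ge_zero[of z]] d(2) by (metis order_refl)
  have lim1: "(\<lambda>n. LINT w|lborel. E w * cauchy_kernel (e n) (cpx w - cpx z)) \<longlonglongrightarrow>
      (LINT w|lborel. E w / (cpx w - cpx z))"
  proof (rule integral_dominated_convergence[OF _ _ int])
    show "(\<lambda>w. E w / (cpx w - cpx z)) \<in> borel_measurable lborel" by measurable
    show "(\<lambda>w. E w * cauchy_kernel (e n) (cpx w - cpx z)) \<in> borel_measurable lborel" for n
    proof -
      have "(\<lambda>w. cauchy_kernel (e n) (cpx w - cpx z)) \<in> borel_measurable borel"
        using e(2)[of n]
        by (intro borel_measurable_continuous_onI continuous_on_cauchy_kernel) (auto intro!: continuous_intros)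
      then show ?thesis by measurable
    qed
    show "AE w in lborel. norm (E w * cauchy_kernel (e n) (cpx w - cpx z)) \<le> norm (E w) / dist w z" for n
    proof (rule AE_I2)
      fix w
      have "norm (cauchy_kernel (e n) (cpx w - cpx z)) \<le> 1 / dist w z"
        using norm_cauchy_kernel_le[of "e n" "cpx w - cpx z"] by (simp flip: dist_norm)
      from mult_left_mono[OF this norm_ge_zero[of "E w"]]
      show "norm (E w * cauchy_kernel (e n) (cpx w - cpx z)) \<le> norm (E w) / dist w z"
        by (simp add: norm_mult)
    qed
    have "AE w in lborel. w \<noteq> z"
      by (rule AE_lborel_singleton)
    then show "AE w in lborel. (\<lambda>n. E w * cauchy_kernel (e n) (cpx w - cpx z)) \<longlonglongrightarrow> E w / (cpx w - cpx z)"
    proof eventually_elim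
      case (elim w)
      then have "norm (cpx w - cpx z) > 0" by simp
      from order_tendstoD(2)[OF e(1) this]
      have "\<forall>\<^sub>F n in sequentially. E w * cauchy_kernel (e n) (cpx w - cpx z) = E w / (cpx w - cpx z)"
        by eventually_elim (simp add: cauchy_kernel_outer)
      then show ?case by (rule tendsto_eventually)
    qed
  qed
  have "isCont (\<lambda>w. complex_of_real (F w)) z"
    using cont(1) finite_S assms
    by (intro continuous_intros) (auto simp: continuous_on_eq_continuous_at open_Compl finite_imp_closed)
  from tendsto_mult_left[OF average_disc_tendsto[OF integrable_F this e], of "- 2 * pi"]
  have "(\<lambda>n. LINT w|lborel. E w * cauchy_kernel (e n) (cpx w - cpx z)) \<longlonglongrightarrow> - 2 * pi * F z"
    by (simp add: integral_E_cauchy_kernel[OF e(2)])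
  with lim1 show ?thesis
    by (simp add: LIMSEQ_unique)
qed

end

subsection \<open>Green's formula with winding numbers\<close>

lemma winding_number_integral:
  fixes c c' :: "real \<Rightarrow> complex"
  assumes c: "\<And>s. (c has_vector_derivative c' s) (at s)" and c': "continuous_on UNIV c'"
    and z: "z \<notin> c ` {0..1}"
  shows "integral {0..1} (\<lambda>s. c' s / (c s - z)) = 2 * pi * \<i> * winding_number c z"
proof -
  have "c C1_differentiable_on {0..1}"
    unfolding C1_differentiable_on_def using c c' by (auto intro: continuous_on_subset)
  then have "valid_path c"
    unfolding valid_path_def by (rule C1_differentiable_imp_piecewise)
  then have "winding_number c z = 1 / (2 * pi * \<i>) * contour_integral c (\<lambda>u. 1 / (u - z))"
    using z by (intro winding_number_valid_path) (auto simp: path_image_def)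
  also have "contour_integral c (\<lambda>u. 1 / (u - z)) = integral {0..1} (\<lambda>s. c' s / (c s - z))"
    unfolding contour_integral_integral by (simp add: vector_derivative_at[OF c])
  finally show ?thesis by simp
qed

context compact_scalar_field
begin

text \<open>Real and imaginary parts are the two classical formulas, for the integrals of
  \<open>F dx\<close> and \<open>F dy\<close>. After the Cauchy-Pompeiu formula is inserted for the
  values of \<open>F\<close> on the curve, Fubini turns the inner integral into a winding number,
  whose value is known at almost every point.\<close>

theorem green_winding_number:
  fixes c c' :: "real \<Rightarrow> complex" and n :: complex
  assumes c: "\<And>s. (c has_vector_derivative c' s) (at s)" and c': "continuous_on UNIV c'"
    and closed: "c 0 = c 1"
    and avoid: "\<And>s. s \<in> {0..1} \<Longrightarrow> (Re (c s), Im (c s)) \<notin> S"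
    and \<Omega>: "open \<Omega>" "\<And>w. w \<in> \<Omega> \<Longrightarrow> cpx w \<notin> c ` {0..1} \<and> winding_number c (cpx w) = n"
    and outer: "\<And>w. w \<notin> \<Omega> \<Longrightarrow> cpx w \<notin> c ` {0..1} \<Longrightarrow> winding_number c (cpx w) = 0"
  shows "integral {0..1} (\<lambda>s. of_real (F (Re (c s), Im (c s))) * c' s) =
           \<i> * n * (LINT w:\<Omega>|lborel. E w)"
proof -
  define pt where "pt s = (Re (c s), Im (c s))" for s
  have cpt: "cpx (pt s) = c s" for s by (simp add: pt_def)
  have contc: "continuous_on UNIV c"
    using c by (auto intro!: continuous_at_imp_continuous_on has_vector_derivative_continuous)
  have contpt: "continuous_on A pt" for A
    unfolding pt_def using contc by (intro continuous_intros) (auto intro: continuous_on_subset)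
  have mc [measurable]: "c \<in> borel_measurable borel" "c' \<in> borel_measurable borel"
    "pt \<in> borel_measurable borel"
    using contc c' contpt by (auto intro: borel_measurable_continuous_onI)
  have cmp: "compact (pt ` {0..1})"
    by (intro compact_continuous_image contpt) auto
  have disj: "pt ` {0..1} \<inter> S = {}"
    using avoid by (auto simp: pt_def)
  obtain d where d: "d > 0" "\<And>s t. s \<in> S \<Longrightarrow> t \<in> {0..1} \<Longrightarrow> d \<le> dist (pt t) s"
    using separate_compact_closed[OF cmp finite_imp_closed[OF finite_S] disj] by blast
  obtain K where K: "K \<ge> 0" "\<And>t. t \<in> {0..1} \<Longrightarrow> norm (pt t) \<le> K"
    using compact_imp_bounded[OF cmp] unfolding bounded_pos by (metis imageI less_imp_le)
  obtain B where B: "B \<ge> 0" "\<And>z. norm z \<le> K \<Longrightarrow> (\<And>s. s \<in> S \<Longrightarrow> d \<le> dist z s) \<Longrightarrow>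
     integrable lborel (\<lambda>w. norm (E w) / dist w z) \<and> (LINT w|lborel. norm (E w) / dist w z) \<le> B"
    using E_kernel_bound[OF d(1) K(1)] by blast
  have B': "integrable lborel (\<lambda>w. norm (E w) / dist w (pt t))"
    "(LINT w|lborel. norm (E w) / dist w (pt t)) \<le> B" if "t \<in> {0..1}" for t
    using B(2)[OF K(2)[OF that] d(2)[OF _ that]] by blast+
  have "compact (c' ` {0..1})"
    using c' by (intro compact_continuous_image) (auto intro: continuous_on_subset)
  then have "bounded (c' ` {0..1})" by (rule compact_imp_bounded)
  then obtain C where C: "C > 0" "\<And>t. t \<in> {0..1} \<Longrightarrow> norm (c' t) \<le> C"
    unfolding bounded_pos by (metis imageI)
  \<comment> \<open>The parameter interval enters as an indicator, so that Fubini is applied on the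
    product of the full spaces.\<close>
  define q where "q = (\<lambda>s w. indicator {0..1} s *\<^sub>R (c' s * (E w / (cpx w - c s))))"
  have mq: "(\<lambda>(s, w). q s w) \<in> borel_measurable (lborel \<Otimes>\<^sub>M lborel)"
    unfolding q_def by measurable
  have normq: "norm (q s w) = indicator {0..1} s * norm (c' s) * (norm (E w) / dist w (pt s))" for s w
  proof -
    have "norm (cpx w - c s) = dist w (pt s)"
      by (simp flip: dist_norm cpt)
    then show ?thesis by (simp add: q_def norm_mult norm_divide)
  qed
  have intq: "integrable lborel (q s)" for s
  proof (cases "s \<in> {0..1}")
    case True
    show ?thesis
    proof (rule Bochner_Integration.integrable_bound)
      show "integrable lborel (\<lambda>w. norm (c' s) * (norm (E w) / dist w (pt s)))"
        by (intro integrable_mult_right B'(1)[OF True])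
      show "AE w in lborel. norm (q s w) \<le> norm (norm (c' s) * (norm (E w) / dist w (pt s)))"
        using True by (intro AE_I2) (simp add: normq)
      show "q s \<in> borel_measurable lborel" unfolding q_def by measurable
    qed
  qed (simp add: q_def)
  have int2: "integrable (lborel \<Otimes>\<^sub>M lborel) (\<lambda>(s, w). q s w)"
  proof (rule lborel_pair.Fubini_integrable[OF mq])
    show "AE s in lborel. integrable lborel (\<lambda>w. case (s, w) of (s, w) \<Rightarrow> q s w)"
      using intq by simp
    \<comment> \<open>Here the uniform bound is used: the curve stays in a bounded set and at
      distance at least \<open>d\<close> from \<open>S\<close>, so the inner integral is at most
      \<open>C * B\<close>.\<close>
    show "integrable lborel (\<lambda>s. LINT w|lborel. norm (case (s, w) of (s, w) \<Rightarrow> q s w))"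
    proof (rule Bochner_Integration.integrable_bound)
      show "integrable lborel (\<lambda>s::real. indicator {0..1} s * (C * B))"
        by (intro integrable_mult_left integrable_real_indicator) auto
      have "(\<lambda>(s, w). norm (q s w)) \<in> borel_measurable (lborel \<Otimes>\<^sub>M lborel)"
        using mq by measurable
      then show "(\<lambda>s. LINT w|lborel. norm (case (s, w) of (s, w) \<Rightarrow> q s w)) \<in> borel_measurable lborel"
        by (simp add: lborel.borel_measurable_lebesgue_integral)
      show "AE s in lborel. norm (LINT w|lborel. norm (case (s, w) of (s, w) \<Rightarrow> q s w))
          \<le> norm (indicator {0..1} s * (C * B) :: real)"
      proof (rule AE_I2)
        fix s :: real
        show "norm (LINT w|lborel. norm (case (s, w) of (s, w) \<Rightarrow> q s w)) \<le> norm (indicator {0..1} s * (C * B) :: real)"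
        proof (cases "s \<in> {0..1}")
          case True
          have "(LINT w|lborel. norm (q s w)) = norm (c' s) * (LINT w|lborel. norm (E w) / dist w (pt s))"
            using True by (simp add: normq del: times_divide_eq_right)
          also have "\<dots> \<le> C * B"
            using C B(1) B'(2) True by (intro mult_mono) (auto intro: integral_nonneg_AE)
          finally show ?thesis
            using True C B by (simp add: integral_nonneg_AE)
        qed (simp add: q_def)
      qed
    qed
  qed
  have inner_w: "(LINT w|lborel. q s w) = - 2 * pi * (indicator {0..1} s *\<^sub>R (of_real (F (pt s)) * c' s))" for s
  proof (cases "s \<in> {0..1}")
    case True
    have "(LINT w|lborel. q s w) = c' s * (LINT w|lborel. E w / (cpx w - cpx (pt s)))"
      using True by (simp add: q_def cpt del: times_divide_eq_right)
    also have "\<dots> = c' s * (- 2 * pi * F (pt s))"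
      using cauchy_pompeiu[of "pt s"] avoid[OF True] by (simp add: pt_def)
    finally show ?thesis using True by simp
  qed (simp add: q_def)
  \<comment> \<open>Winding numbers are only controlled off the curve, which is a null set as a
    differentiable image of an interval.\<close>
  have AEpath: "AE w in lborel. w \<notin> pt ` {0..1}"
  proof (rule AE_lborel_closed_negligible)
    show "negligible (pt ` {0..1})"
    proof (rule negligible_differentiable_image_lowdim)
      show "DIM(real) < DIM(real \<times> real)" by simp
      have "c differentiable (at s)" for s
        using c by (auto simp: has_vector_derivative_def differentiable_def)
      then have "(\<lambda>s. (Re (c s), Im (c s))) differentiable (at s)" for s
        by (intro differentiable_Pair) (auto intro: differentiable_compose[OF bounded_linear_imp_differentiable] bounded_linear_Re bounded_linear_Im)
      then show "pt differentiable_on {0..1}"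
        unfolding pt_def by (auto intro: differentiable_at_imp_differentiable_on)
    qed
    show "closed (pt ` {0..1})" using cmp by (rule compact_imp_closed)
  qed
  have inner_s: "(LINT s|lborel. q s w) = - 2 * pi * \<i> * n * (indicator \<Omega> w *\<^sub>R E w)"
    if w: "w \<notin> pt ` {0..1}" for w
  proof -
    have w': "cpx w \<notin> c ` {0..1}" using w by (auto simp flip: cpt)
    then have nz: "c s - cpx w \<noteq> 0" if "s \<in> {0..1}" for s
      using imageI[OF that, of c] w' by (metis eq_iff_diff_eq_0)
    have "continuous_on {0..1} (\<lambda>s. c' s / (c s - cpx w))"
      using nz contc c' by (intro continuous_intros) (auto intro: continuous_on_subset)
    then have int: "set_integrable lborel {0..1} (\<lambda>s. c' s / (c s - cpx w))"
      by (intro borel_integrable_compact[unfolded set_integrable_def[symmetric]] compact_Icc)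
    have wn: "(LINT s:{0..1}|lborel. c' s / (c s - cpx w)) = 2 * pi * \<i> * winding_number c (cpx w)"
      using winding_number_integral[OF c c' w'] set_borel_integral_eq_integral(2)[OF int] by simp
    \<comment> \<open>The Cauchy-Pompeiu kernel has \<open>cpx w - c s\<close> in the denominator,
      the winding number integral has \<open>c s - cpx w\<close>; hence the minus sign.\<close>
    have "q s w = - E w * (indicator {0..1} s *\<^sub>R (c' s / (c s - cpx w)))" for s
    proof -
      have "E w / (cpx w - c s) = - (E w / (c s - cpx w))"
        by (metis minus_diff_eq divide_minus_right)
      then show ?thesis by (simp only: q_def) (simp add: mult.commute)
    qed
    then have "(LINT s|lborel. q s w) = - E w * (LINT s:{0..1}|lborel. c' s / (c s - cpx w))"
      by (simp only: set_lebesgue_integral_def integral_mult_right_zero)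
    also have "winding_number c (cpx w) = n * indicator \<Omega> w"
      using \<Omega>(2)[of w] outer[of w] w' by (auto simp: indicator_def)
    then have "- E w * (LINT s:{0..1}|lborel. c' s / (c s - cpx w)) = - 2 * pi * \<i> * n * (indicator \<Omega> w *\<^sub>R E w)"
      unfolding wn by (simp add: indicator_def)
    finally show ?thesis .
  qed
  have contF: "continuous_on {0..1} (\<lambda>s. of_real (F (pt s)) * c' s)"
    using disj by (intro continuous_intros continuous_on_compose2[OF cont(1) contpt] continuous_on_subset[OF c']) auto
  then have intF: "set_integrable lborel {0..1} (\<lambda>s. of_real (F (pt s)) * c' s)"
    by (intro borel_integrable_compact[unfolded set_integrable_def[symmetric]] compact_Icc)
  have "- 2 * pi * integral {0..1} (\<lambda>s. of_real (F (pt s)) * c' s) =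
      - 2 * pi * (LINT s:{0..1}|lborel. of_real (F (pt s)) * c' s)"
    using set_borel_integral_eq_integral(2)[OF intF] by simp
  also have "\<dots> = (LINT s|lborel. LINT w|lborel. q s w)"
    by (simp only: inner_w set_lebesgue_integral_def integral_mult_right_zero)
  also have "\<dots> = (LINT w|lborel. LINT s|lborel. q s w)"
    using lborel_pair.Fubini_integral[of q] int2 by simp
  also have "\<dots> = (LINT w|lborel. - 2 * pi * \<i> * n * (indicator \<Omega> w *\<^sub>R E w))"
  proof (rule Bochner_Integration.integral_cong_AE)
    show "AE w in lborel. (LINT s|lborel. q s w) = - 2 * pi * \<i> * n * (indicator \<Omega> w *\<^sub>R E w)"
      using AEpath by eventually_elim (rule inner_s)
    show "(\<lambda>w. LINT s|lborel. q s w) \<in> borel_measurable lborel"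
      using lborel_pair.integrable_snd[OF int2] by (rule borel_measurable_integrable)
    show "(\<lambda>w. - 2 * pi * \<i> * n * (indicator \<Omega> w *\<^sub>R E w)) \<in> borel_measurable lborel"
    proof -
      have [measurable]: "\<Omega> \<in> sets borel" using \<Omega>(1) by (rule borel_open)
      show ?thesis by measurable
    qed
  qed
  also have "\<dots> = - 2 * pi * (\<i> * n * (LINT w:\<Omega>|lborel. E w))"
    by (simp only: set_lebesgue_integral_def integral_mult_right_zero mult.assoc)
  finally have "- 2 * pi * integral {0..1} (\<lambda>s. of_real (F (pt s)) * c' s) = - 2 * pi * (\<i> * n * (LINT w:\<Omega>|lborel. E w))" .
  then show ?thesis by (simp add: pt_def)
qed

end

subsection \<open>Rotation number of a closed curve\<close>

text \<open>\<open>p - q\<close> is continuous and all its values are logarithms of the fixed number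
  \<open>k\<close>. Such values lie at least \<open>2 * pi\<close> apart, so the difference is
  constant. The factor \<open>k\<close> admits a comparison with a branch of \<open>Ln\<close> taken
  after a rotation.\<close>

lemma continuous_log_increment_eq:
  fixes p q :: "real \<Rightarrow> complex"
  assumes p: "continuous_on {0..1} p" and q: "continuous_on {0..1} q"
    and eq: "\<And>s. s \<in> {0..1} \<Longrightarrow> exp (p s) = k * exp (q s)"
  shows "p 1 - p 0 = q 1 - q 0"
proof -
  have k: "exp (p s - q s) = k" if "s \<in> {0..1}" for s
    using eq[OF that] by (simp add: exp_diff)
  have "(\<lambda>s. p s - q s) constant_on {0..1}"
  proof (rule continuous_discrete_range_constant)
    show "connected {0..1::real}" by simp
    show "continuous_on {0..1} (\<lambda>s. p s - q s)" using p q by (intro continuous_intros)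
    fix x :: real assume x: "x \<in> {0..1}"
    show "\<exists>e>0. \<forall>y. y \<in> {0..1} \<and> p y - q y \<noteq> p x - q x \<longrightarrow> e \<le> norm (p y - q y - (p x - q x))"
    proof (intro exI[of _ "2 * pi"] conjI allI impI)
      fix y assume y: "y \<in> {0..1} \<and> p y - q y \<noteq> p x - q x"
      show "2 * pi \<le> norm (p y - q y - (p x - q x))"
      proof (rule ccontr)
        assume "\<not> ?thesis"
        then have "\<bar>Im (p y - q y) - Im (p x - q x)\<bar> < 2 * pi"
          using abs_Im_le_cmod[of "p y - q y - (p x - q x)"] by simp
        moreover have "exp (p y - q y) = exp (p x - q x)"
          using k[OF x] k[of y] y by (metis (no_types))
        ultimately have "p y - q y = p x - q x"
          by (rule exp_complex_eqI)
        with y show False by blast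
      qed
    qed simp
  qed
  then obtain D where "p s - q s = D" if "s \<in> {0..1}" for s
    unfolding constant_on_def by blast
  from this[of 0] this[of 1] show ?thesis by (simp add: algebra_simps)
qed

text \<open>The primitive \<open>A\<close> of \<open>v' / v\<close> is a logarithm of
  \<open>v\<close> up to a constant factor, because \<open>v * exp (- A)\<close> has derivative 0.
  It therefore has the same increment as any other continuous logarithm.\<close>

lemma log_derivative_integral:
  fixes v v' G :: "real \<Rightarrow> complex"
  assumes v: "\<And>s. (v has_vector_derivative v' s) (at s)" and v': "continuous_on UNIV v'"
    and nz: "\<And>s. v s \<noteq> 0"
    and G: "continuous_on {0..1} G" "\<And>s. s \<in> {0..1} \<Longrightarrow> v s = exp (G s)"
  shows "integral {0..1} (\<lambda>s. v' s / v s) = G 1 - G 0"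
proof -
  have contv: "continuous_on UNIV v"
    using v by (auto intro!: continuous_at_imp_continuous_on has_vector_derivative_continuous)
  define A where "A u = integral {0..u} (\<lambda>s. v' s / v s)" for u
  have "continuous_on {0..1} (\<lambda>s. v' s / v s)"
    using contv v' nz by (intro continuous_intros) (auto intro: continuous_on_subset)
  then have A: "(A has_vector_derivative v' s / v s) (at s within {0..1})" if "s \<in> {0..1}" for s
    unfolding A_def[abs_def] using that by (rule integral_has_vector_derivative)
  have contA: "continuous_on {0..1} A"
    using A by (rule continuous_on_vector_derivative)
  have "((\<lambda>s. v s * exp (- A s)) has_vector_derivative 0) (at s within {0..1})" if "s \<in> {0..1}" for s
  proof -
    have "((\<lambda>s. exp (- A s)) has_vector_derivative - (v' s / v s) * exp (- A s)) (at s within {0..1})"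
      using field_vector_diff_chain_within[OF has_vector_derivative_minus[OF A[OF that]], of exp "exp (- A s)"]
      by (auto simp: o_def intro: DERIV_exp has_field_derivative_at_within)
    from has_vector_derivative_mult[OF has_vector_derivative_at_within[OF v] this]
    show ?thesis using nz[of s] by (simp add: field_simps)
  qed
  then obtain k where k: "\<And>s. s \<in> {0..1} \<Longrightarrow> v s * exp (- A s) = k"
    using has_vector_derivative_zero_constant[of "{0..1}" "\<lambda>s. v s * exp (- A s)"] by auto
  have "exp (G s) = k * exp (A s)" if "s \<in> {0..1}" for s
    using k[OF that] G(2)[OF that] by (simp add: exp_minus field_simps)
  from continuous_log_increment_eq[OF G(1) contA this] have "G 1 - G 0 = A 1 - A 0" .
  then show ?thesis by (simp add: A_def)
qed

lemma integral_shift_periodic: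
  fixes f :: "real \<Rightarrow> complex"
  assumes cont: "continuous_on UNIV f" and per: "\<And>s. f (s + 1) = f s" and a: "a \<in> {0..1}"
  shows "integral {0..1} (\<lambda>s. f (s + a)) = integral {0..1} f"
proof -
  have int: "f integrable_on {u..v}" for u v
    using cont by (intro integrable_continuous_interval) (auto intro: continuous_on_subset)
  have "integral {0..1} (\<lambda>s. f (s + a)) = integral {a..1 + a} f"
    using integral_shift[of 0 a 1 f] continuous_on_subset[OF cont] by (simp add: o_def)
  also have "\<dots> = integral {a..1} f + integral {1..1 + a} f"
    using a by (intro Henstock_Kurzweil_Integration.integral_combine[symmetric] int) auto
  also have "integral {1..1 + a} f = integral {0..a} f"
    using integral_shift[of 0 1 a f] continuous_on_subset[OF cont] by (simp add: o_def per add.commute)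
  also have "integral {a..1} f + integral {0..a} f = integral {0..1} f"
    using a by (subst add.commute, intro Henstock_Kurzweil_Integration.integral_combine int) auto
  finally show ?thesis .
qed

text \<open>The principal arguments are \<open>pi / 2\<close> and \<open>- pi / 2\<close> in an
  order decided by the sign of \<open>x\<close>. This is the half turn made along each leg of the
  triangle in Hopf's argument.\<close>

lemma Ln_ii_times_real_diff:
  fixes x :: real
  assumes "x \<noteq> 0"
  shows "Ln (\<i> * of_real x) - Ln (- \<i> * of_real x) = \<i> * pi * sgn x"
proof (cases "x > 0")
  case True
  then show ?thesis
    using Ln_times_of_real[of x \<i>] Ln_times_of_real[of x "- \<i>"] by (simp add: mult.commute)
next
  case False
  with assms have "x < 0" by simp
  then show ?thesis
    using Ln_times_of_real[of "-x" \<i>] Ln_times_of_real[of "-x" "- \<i>"] by (simp add: mult.commute)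
qed

section \<open>Hopf's secant map of a simple closed curve\<close>

locale regular_loop =
  fixes c c' :: "real \<Rightarrow> complex"
  assumes deriv: "\<And>s. (c has_vector_derivative c' s) (at s)"
    and deriv_cont: "continuous_on UNIV c'"
    and period: "\<And>s. c (s + 1) = c s"
    and regular: "\<And>s. c' s \<noteq> 0"
    and simple: "inj_on c {0..<1}"
begin

lemma cont: "continuous_on A c"
  using deriv by (auto intro!: continuous_at_imp_continuous_on has_vector_derivative_continuous)

lemma deriv_cont': "continuous_on A c'"
  using deriv_cont by (rule continuous_on_subset) simp

lemma deriv_period: "c' (s + 1) = c' s"
proof -
  have "((\<lambda>s. s + 1) has_vector_derivative (1::real)) (at s)"
    by (auto intro!: derivative_eq_intros)
  from vector_diff_chain_at[OF this deriv]
  have "((\<lambda>s. c (s + 1)) has_vector_derivative c' (s + 1)) (at s)"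
    by (simp add: o_def)
  then show ?thesis
    using deriv[of s] by (simp add: period vector_derivative_unique_at)
qed

lemma Im_deriv_eq_0:
  assumes "\<And>s. Im (c t0) \<le> Im (c s)"
  shows "Im (c' t0) = 0"
proof (rule DERIV_local_min[where d = 1])
  show "((\<lambda>s. Im (c s)) has_real_derivative Im (c' t0)) (at t0)"
    using bounded_linear.has_vector_derivative[OF bounded_linear_Im deriv]
    by (simp add: has_real_derivative_iff_has_vector_derivative)
qed (use assms in auto)

lemma c_eq_iff:
  assumes "0 \<le> s" "s < t" "t \<le> 1" "(s, t) \<noteq> (0, 1)"
  shows "c t \<noteq> c s"
proof (cases "t = 1")
  case True
  then have "c t = c 0" using period[of 0] by simp
  moreover have "c 0 \<noteq> c s"
    using assms True inj_onD[OF simple, of 0 s] by auto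
  ultimately show ?thesis by simp
next
  case False
  then show ?thesis using assms inj_onD[OF simple, of t s] by auto
qed

text \<open>The mean \<open>m(s, t)\<close> of \<open>c'\<close> over \<open>[s, t]\<close> is the difference quotient. Since \<open>m(s + 1, t)\<close> is
  a difference quotient for the complementary arc, partial fractions give
  \<open>m(s, t) - m(s + 1, t) = (c(t) - c(s)) / ((t - s) (1 - t + s))\<close>, a version of Hopf's secant map that
  extends continuously to all of the triangle \<open>0 \<le> s \<le> t \<le> 1\<close>.\<close>

definition mean_deriv :: "real \<Rightarrow> real \<Rightarrow> complex" where
  "mean_deriv s t = integral {0..1} (\<lambda>l. c' (s + l * (t - s)))"

definition secant :: "real \<times> real \<Rightarrow> complex" where
  "secant p = mean_deriv (fst p) (snd p) - mean_deriv (fst p + 1) (snd p)"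

lemma mean_deriv_eq: "(t - s) *\<^sub>R mean_deriv s t = c t - c s"
proof -
  have "((\<lambda>l. (t - s) *\<^sub>R c' (s + l * (t - s))) has_integral c (s + 1 * (t - s)) - c (s + 0 * (t - s))) {0..1}"
  proof (rule fundamental_theorem_of_calculus)
    fix l :: real
    have "((\<lambda>l. s + l * (t - s)) has_vector_derivative (t - s)) (at l)"
      by (auto intro!: derivative_eq_intros)
    from vector_diff_chain_at[OF this deriv]
    show "((\<lambda>l. c (s + l * (t - s))) has_vector_derivative (t - s) *\<^sub>R c' (s + l * (t - s))) (at l within {0..1})"
      by (auto simp: o_def intro: has_vector_derivative_at_within)
  qed simp
  from integral_unique[OF this] show ?thesis
    by (simp add: mean_deriv_def)
qed

lemma continuous_on_secant: "continuous_on A secant"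
proof -
  have "continuous_on UNIV (\<lambda>p::real \<times> real. integral (cbox 0 1) (\<lambda>l. c' (fst p + l * (snd p - fst p))))"
    by (intro integral_continuous_on_param)
      (auto simp: case_prod_unfold intro!: continuous_intros continuous_on_compose2[OF deriv_cont])
  then have m: "continuous_on UNIV (\<lambda>p. mean_deriv (fst p) (snd p))"
    by (simp add: mean_deriv_def)
  have "continuous_on UNIV (\<lambda>p. mean_deriv (fst (fst p + 1, snd p)) (snd (fst p + 1, snd p)))"
    by (rule continuous_on_compose2[OF m]) (auto intro!: continuous_intros)
  with m have "continuous_on UNIV secant"
    unfolding secant_def[abs_def] by (auto intro: continuous_on_diff)
  then show ?thesis by (rule continuous_on_subset) simp
qed

lemma secant_eq: "((t - s) * (1 - (t - s))) *\<^sub>R secant (s, t) = c t - c s"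
proof -
  have "((t - s) * (1 - (t - s))) *\<^sub>R secant (s, t) =
     (1 - (t - s)) *\<^sub>R ((t - s) *\<^sub>R mean_deriv s t) + (t - s) *\<^sub>R ((t - (s + 1)) *\<^sub>R mean_deriv (s + 1) t)"
    by (simp add: secant_def scaleR_diff_right algebra_simps scaleR_conv_of_real)
  also have "\<dots> = (1 - (t - s)) *\<^sub>R (c t - c s) + (t - s) *\<^sub>R (c t - c s)"
    unfolding mean_deriv_eq by (simp add: period)
  also have "\<dots> = c t - c s"
    by (simp add: algebra_simps scaleR_conv_of_real)
  finally show ?thesis .
qed

text \<open>One of the two means runs over a full period and vanishes, the other over a degenerate
  interval and gives the derivative. At the corner \<open>(0, 1)\<close> the roles are exchanged,
  which produces the sign there.\<close>

lemma secant_diagonal: "secant (s, s) = c' s"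
proof -
  have "mean_deriv (s + 1) s = 0"
    using mean_deriv_eq[of s "s + 1"] by (simp add: period)
  then show ?thesis by (simp add: secant_def mean_deriv_def)
qed

lemma secant_corner: "secant (0, 1) = - c' 0"
proof -
  have "mean_deriv 0 1 = 0"
    using mean_deriv_eq[of 1 0] period[of 0] by simp
  then show ?thesis using deriv_period[of 0] by (simp add: secant_def mean_deriv_def)
qed

text \<open>Regularity covers the diagonal and the corner, simplicity everything else.\<close>

lemma secant_nonzero:
  assumes "0 \<le> s" "s \<le> t" "t \<le> 1"
  shows "secant (s, t) \<noteq> 0"
proof (cases "s = t \<or> (s, t) = (0, 1)")
  case True
  then show ?thesis using secant_diagonal secant_corner regular by auto
next
  case False
  then have "c t \<noteq> c s" using assms by (intro c_eq_iff) auto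
  then show ?thesis using secant_eq[of t s] by auto
qed

text \<open>Hopf's homotopy. Along the diagonal of the triangle a continuous argument of
  \<open>secant\<close> measures the turning of \<open>c'\<close>; the same increment is obtained
  along the two legs. Seen from a lowest point all secants point upwards, and those leading back to
  it downwards, so each leg contributes a half turn whose sign is given by the horizontal direction
  at that point.\<close>

lemma rotation_number_0:
  assumes d2: "\<And>s. (c' has_vector_derivative c'' s) (at s)" and cont2: "continuous_on UNIV c''"
    and low: "\<And>s. Im (c 0) \<le> Im (c s)"
  shows "integral {0..1} (\<lambda>s. c'' s / c' s) = 2 * pi * \<i> * sgn (Re (c' 0))"
proof -
  define x where "x = Re (c' 0)"
  have c'0: "c' 0 = of_real x" "c' 1 = of_real x"
    using Im_deriv_eq_0[OF low] deriv_period[of 0] by (simp_all add: complex_eq_iff x_def)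
  have x: "x \<noteq> 0" using regular[of 0] c'0 by auto
  define Tri where "Tri = {p::real \<times> real. 0 \<le> fst p \<and> fst p \<le> snd p \<and> snd p \<le> 1}"
  have "convex Tri"
  proof -
    have "Tri = {p. (-1, 0) \<bullet> p \<le> 0} \<inter> {p. (1, -1) \<bullet> p \<le> 0} \<inter> {p. (0, 1) \<bullet> p \<le> (1::real)}"
      by (auto simp: Tri_def)
    then show ?thesis by (auto intro!: convex_Int convex_halfspace_le)
  qed
  \<comment> \<open>The triangle is contractible and \<open>secant\<close> has no zero on it, so a
    logarithm exists on all of it; this is what makes the two ways from \<open>(0, 0)\<close> to
    \<open>(1, 1)\<close> comparable.\<close>
  then obtain g where g: "continuous_on Tri g" "\<And>p. p \<in> Tri \<Longrightarrow> secant p = exp (g p)"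
    using continuous_logarithm_on_contractible[OF continuous_on_secant convex_imp_contractible]
      secant_nonzero unfolding Tri_def by (metis (mono_tags, lifting) mem_Collect_eq prod.collapse)
  have gc: "continuous_on {0..1} (\<lambda>s. g (k s))" if "continuous_on {0..1} k" "k ` {0..1} \<subseteq> Tri" for k :: "real \<Rightarrow> real \<times> real"
    by (rule continuous_on_compose2[OF g(1) that])
  have up: "Im (secant (0, t)) \<ge> 0" if t: "t \<in> {0..1}" for t
  proof (cases "t = 0 \<or> t = 1")
    case True
    then show ?thesis using secant_diagonal[of 0] secant_corner c'0 by auto
  next
    case False
    have "(t * (1 - t)) * Im (secant (0, t)) = Im (c t - c 0)"
      using arg_cong[OF secant_eq[of t 0], of Im] by simp
    then have "(t * (1 - t)) * Im (secant (0, t)) \<ge> 0" using low by simp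
    moreover have "t * (1 - t) > 0" using False t by auto
    ultimately show ?thesis by (meson mult_pos_neg not_le)
  qed
  have down: "Im (secant (s, 1)) \<le> 0" if s: "s \<in> {0..1}" for s
  proof (cases "s = 0 \<or> s = 1")
    case True
    then show ?thesis using secant_diagonal[of 1] secant_corner c'0 by auto
  next
    case False
    have "((1 - s) * s) * Im (secant (s, 1)) = Im (c 1 - c s)"
      using arg_cong[OF secant_eq[of 1 s], of Im] by simp
    then have "((1 - s) * s) * Im (secant (s, 1)) \<le> 0" using low[of s] period[of 0] by simp
    moreover have "(1 - s) * s > 0" using False s by auto
    ultimately show ?thesis by (meson mult_pos_pos not_le)
  qed
  have tri: "(0, t) \<in> Tri" "(t, 1) \<in> Tri" "(t, t) \<in> Tri" if "t \<in> {0..1}" for t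
    using that by (auto simp: Tri_def)
  have nz: "secant p \<noteq> 0" if "p \<in> Tri" for p
    using g(2)[OF that] by simp
  \<comment> \<open>On this leg \<open>secant\<close> is nonzero with nonnegative imaginary part, so
    after multiplication by \<open>- \<i>\<close> it avoids the branch cut of \<open>Ln\<close>;
    \<open>k = \<i>\<close> undoes the rotation. The other leg is rotated the opposite way.\<close>
  have "g (0, 1) - g (0, 0) = Ln (- \<i> * secant (0, 1)) - Ln (- \<i> * secant (0, 0))"
  proof (rule continuous_log_increment_eq[where k = \<i>])
    show "continuous_on {0..1} (\<lambda>t. g (0, t))"
      by (rule gc) (auto intro!: continuous_intros tri)
    show "continuous_on {0..1} (\<lambda>t. Ln (- \<i> * secant (0, t)))"
    proof (intro continuous_intros continuous_on_compose2[OF continuous_on_secant[of UNIV]])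
      fix t :: real assume t: "t \<in> {0..1}"
      show "- \<i> * secant (0, t) \<notin> \<real>\<^sub>\<le>\<^sub>0"
        using up[OF t] nz[OF tri(1)[OF t]] by (auto simp: complex_nonpos_Reals_iff complex_eq_iff)
    qed auto
    fix t :: real assume "t \<in> {0..1}"
    then show "exp (g (0, t)) = \<i> * exp (Ln (- \<i> * secant (0, t)))"
      using tri g(2) nz by (simp flip: g(2))
  qed
  also have "\<dots> = \<i> * pi * sgn x"
    using Ln_ii_times_real_diff[OF x] by (simp add: secant_diagonal secant_corner c'0)
  finally have 1: "g (0, 1) - g (0, 0) = \<i> * pi * sgn x" .
  have "g (1, 1) - g (0, 1) = Ln (\<i> * secant (1, 1)) - Ln (\<i> * secant (0, 1))"
  proof (rule continuous_log_increment_eq[where k = "- \<i>"])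
    show "continuous_on {0..1} (\<lambda>t. g (t, 1))"
      by (rule gc) (auto intro!: continuous_intros tri)
    show "continuous_on {0..1} (\<lambda>t. Ln (\<i> * secant (t, 1)))"
    proof (intro continuous_intros continuous_on_compose2[OF continuous_on_secant[of UNIV]])
      fix t :: real assume t: "t \<in> {0..1}"
      show "\<i> * secant (t, 1) \<notin> \<real>\<^sub>\<le>\<^sub>0"
        using down[OF t] nz[OF tri(2)[OF t]] by (auto simp: complex_nonpos_Reals_iff complex_eq_iff)
    qed auto
    fix t :: real assume "t \<in> {0..1}"
    then show "exp (g (t, 1)) = - \<i> * exp (Ln (\<i> * secant (t, 1)))"
      using tri g(2) nz by (simp flip: g(2))
  qed
  also have "\<dots> = \<i> * pi * sgn x"
    using Ln_ii_times_real_diff[OF x] by (simp add: secant_diagonal secant_corner c'0)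
  finally have 2: "g (1, 1) - g (0, 1) = \<i> * pi * sgn x" .
  have "integral {0..1} (\<lambda>s. c'' s / c' s) = g (1, 1) - g (0, 0)"
  proof (rule log_derivative_integral[OF d2 cont2 regular])
    show "continuous_on {0..1} (\<lambda>s. g (s, s))"
      by (rule gc) (auto intro!: continuous_intros tri)
    show "c' s = exp (g (s, s))" if "s \<in> {0..1}" for s
      using g(2)[OF tri(3)[OF that]] by (simp add: secant_diagonal)
  qed
  also have "\<dots> = 2 * pi * \<i> * sgn x"
    using 1 2 by (simp add: algebra_simps)
  finally show ?thesis by (simp add: x_def)
qed

end

subsection \<open>Functions with mild singularities at finitely many points\<close>

definition weight :: "(real \<times> real) set \<Rightarrow> real \<times> real \<Rightarrow> real" where
  "weight S w = 1 + (\<Sum>s\<in>S. 1 / dist w s)"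

lemma weight_ge_1: "weight S w \<ge> 1"
  by (auto simp: weight_def intro!: sum_nonneg)

lemma inverse_dist_le_weight:
  assumes "finite S" "s \<in> S"
  shows "1 / dist w s \<le> weight S w"
  using member_le_sum[of s S "\<lambda>s. 1 / dist w s"] assms by (simp add: weight_def)

definition has_partials ::
    "(real \<times> real) set \<Rightarrow> (real \<times> real \<Rightarrow> real) \<Rightarrow> (real \<times> real \<Rightarrow> real) \<Rightarrow> (real \<times> real \<Rightarrow> real) \<Rightarrow> bool" where
  "has_partials S f fx fy \<longleftrightarrow> (\<forall>x y. (x, y) \<notin> S \<longrightarrow>
     ((\<lambda>x. f (x, y)) has_real_derivative fx (x, y)) (at x) \<and>
     ((\<lambda>y. f (x, y)) has_real_derivative fy (x, y)) (at y))"

text \<open>A local version of \<open>compact_scalar_field\<close>: the bounds are required on every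
  disc, with a constant that may depend on it. This makes the class stable under algebraic
  operations, so that membership of a composite field can be read off from its formula.\<close>

definition regular_off :: "(real \<times> real) set \<Rightarrow> (real \<times> real \<Rightarrow> real) \<Rightarrow> bool" where
  "regular_off S f \<longleftrightarrow> (\<exists>fx fy. has_partials S f fx fy \<and>
     continuous_on (- S) f \<and> continuous_on (- S) fx \<and> continuous_on (- S) fy \<and>
     (\<forall>R. \<exists>M\<ge>0. \<forall>w\<in>cball 0 R - S. \<bar>f w\<bar> \<le> M \<and> \<bar>fx w\<bar> \<le> M * weight S w \<and> \<bar>fy w\<bar> \<le> M * weight S w))"

lemma regular_offI:
  assumes "has_partials S f fx fy"
    "continuous_on (- S) f" "continuous_on (- S) fx" "continuous_on (- S) fy"
    "\<And>R. \<exists>M\<ge>0. \<forall>w\<in>cball 0 R - S. \<bar>f w\<bar> \<le> M \<and> \<bar>fx w\<bar> \<le> M * weight S w \<and> \<bar>fy w\<bar> \<le> M * weight S w"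
  shows "regular_off S f"
  using assms unfolding regular_off_def by blast

lemma has_partials_imp_eq:
  assumes "has_partials S f fx fy" "w \<notin> S"
  shows "partial1 f w = fx w" "partial2 f w = fy w"
  using assms by (cases w; auto simp: has_partials_def partial1_def partial2_def intro!: DERIV_imp_deriv)+

text \<open>Off \<open>S\<close> the witnesses coincide with the actual partial derivatives, which
  may therefore replace them in all bounds.\<close>

lemma regular_off_partial:
  assumes "regular_off S f"
  shows "has_partials S f (partial1 f) (partial2 f)"
    "continuous_on (- S) f" "continuous_on (- S) (partial1 f)" "continuous_on (- S) (partial2 f)"
    "\<exists>M\<ge>0. \<forall>w\<in>cball 0 R - S. \<bar>f w\<bar> \<le> M \<and> \<bar>partial1 f w\<bar> \<le> M * weight S w \<and> \<bar>partial2 f w\<bar> \<le> M * weight S w"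
proof -
  obtain fx fy where f: "has_partials S f fx fy"
    "continuous_on (- S) f" "continuous_on (- S) fx" "continuous_on (- S) fy"
    "\<forall>R. \<exists>M\<ge>0. \<forall>w\<in>cball 0 R - S. \<bar>f w\<bar> \<le> M \<and> \<bar>fx w\<bar> \<le> M * weight S w \<and> \<bar>fy w\<bar> \<le> M * weight S w"
    using assms unfolding regular_off_def by (elim exE conjE)
  note eq = has_partials_imp_eq[OF f(1)]
  show "has_partials S f (partial1 f) (partial2 f)"
    using f(1) eq by (simp add: has_partials_def)
  show "continuous_on (- S) f" by (rule f(2))
  show "continuous_on (- S) (partial1 f)" "continuous_on (- S) (partial2 f)"
    using eq by (auto intro: continuous_on_eq[OF f(3)] continuous_on_eq[OF f(4)])
  show "\<exists>M\<ge>0. \<forall>w\<in>cball 0 R - S. \<bar>f w\<bar> \<le> M \<and> \<bar>partial1 f w\<bar> \<le> M * weight S w \<and> \<bar>partial2 f w\<bar> \<le> M * weight S w"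
    using f(5)[rule_format, of R] by (simp add: eq)
qed

lemma regular_off_smooth:
  assumes "has_partials {} f fx fy" "continuous_on UNIV f" "continuous_on UNIV fx" "continuous_on UNIV fy"
  shows "regular_off S f"
proof (rule regular_offI)
  show "has_partials S f fx fy" using assms(1) by (simp add: has_partials_def)
  show "continuous_on (- S) f" "continuous_on (- S) fx" "continuous_on (- S) fy"
    using assms by (auto intro: continuous_on_subset)
  fix R :: real
  have "\<exists>B. \<forall>w\<in>cball 0 R. \<bar>g w\<bar> \<le> B" if "continuous_on UNIV g" for g :: "real \<times> real \<Rightarrow> real"
  proof -
    have "bounded (g ` cball 0 R)"
      by (intro compact_imp_bounded compact_continuous_image continuous_on_subset[OF that]) auto
    then show ?thesis by (auto simp: bounded_iff)
  qed
  from this[OF assms(2)] this[OF assms(3)] this[OF assms(4)]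
  obtain A B C where "\<forall>w\<in>cball 0 R. \<bar>f w\<bar> \<le> A" "\<forall>w\<in>cball 0 R. \<bar>fx w\<bar> \<le> B" "\<forall>w\<in>cball 0 R. \<bar>fy w\<bar> \<le> C"
    by blast
  then have b: "\<bar>f w\<bar> \<le> \<bar>A\<bar> + \<bar>B\<bar> + \<bar>C\<bar>" "\<bar>fx w\<bar> \<le> \<bar>A\<bar> + \<bar>B\<bar> + \<bar>C\<bar>" "\<bar>fy w\<bar> \<le> \<bar>A\<bar> + \<bar>B\<bar> + \<bar>C\<bar>"
    if "w \<in> cball 0 R" for w
    using that by fastforce+
  have le: "M \<le> M * weight S w" if "M \<ge> 0" for M w
    using mult_left_mono[OF weight_ge_1 that, of S w] by simp
  show "\<exists>M\<ge>0. \<forall>w\<in>cball 0 R - S. \<bar>f w\<bar> \<le> M \<and> \<bar>fx w\<bar> \<le> M * weight S w \<and> \<bar>fy w\<bar> \<le> M * weight S w"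
    by (rule exI[of _ "\<bar>A\<bar> + \<bar>B\<bar> + \<bar>C\<bar>"]) (auto intro!: b order_trans[OF b(2) le] order_trans[OF b(3) le])
qed

section \<open>Closure properties of the class\<close>

lemma regular_off_const: "regular_off S (\<lambda>w. k)"
  by (rule regular_off_smooth[where fx = "\<lambda>_. 0" and fy = "\<lambda>_. 0"]) (auto simp: has_partials_def)

lemma regular_off_fst: "regular_off S fst"
  by (rule regular_off_smooth[where fx = "\<lambda>_. 1" and fy = "\<lambda>_. 0"])
    (auto simp: has_partials_def intro!: continuous_intros derivative_eq_intros)

lemma regular_off_snd: "regular_off S snd"
  by (rule regular_off_smooth[where fx = "\<lambda>_. 0" and fy = "\<lambda>_. 1"])
    (auto simp: has_partials_def intro!: continuous_intros derivative_eq_intros)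

text \<open>Each term of the Leibniz rule contains only one gradient, and the other factor is
  bounded, so the growth stays of order \<open>weight S\<close>.\<close>

lemma regular_off_mult:
  assumes "regular_off S f" "regular_off S g"
  shows "regular_off S (\<lambda>w. f w * g w)"
proof -
  note f = regular_off_partial[OF assms(1)] and g = regular_off_partial[OF assms(2)]
  show ?thesis
  proof (rule regular_offI)
    show "has_partials S (\<lambda>w. f w * g w) (\<lambda>w. f w * partial1 g w + partial1 f w * g w)
        (\<lambda>w. f w * partial2 g w + partial2 f w * g w)"
      using f(1) g(1) by (auto simp: has_partials_def intro!: DERIV_mult')
    show "continuous_on (- S) (\<lambda>w. f w * g w)" "continuous_on (- S) (\<lambda>w. f w * partial1 g w + partial1 f w * g w)"
        "continuous_on (- S) (\<lambda>w. f w * partial2 g w + partial2 f w * g w)"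
      using f g by (auto intro!: continuous_intros)
    fix R :: real
    obtain A B where A: "A \<ge> 0" "\<And>w. w \<in> cball 0 R - S \<Longrightarrow> \<bar>f w\<bar> \<le> A \<and> \<bar>partial1 f w\<bar> \<le> A * weight S w \<and> \<bar>partial2 f w\<bar> \<le> A * weight S w"
      and B: "B \<ge> 0" "\<And>w. w \<in> cball 0 R - S \<Longrightarrow> \<bar>g w\<bar> \<le> B \<and> \<bar>partial1 g w\<bar> \<le> B * weight S w \<and> \<bar>partial2 g w\<bar> \<le> B * weight S w"
      using f(5)[of R] g(5)[of R] by blast
    have mult: "\<bar>a * d + b * e\<bar> \<le> 2 * A * B * k"
      if "\<bar>a\<bar> \<le> A" "\<bar>d\<bar> \<le> B * k" "\<bar>b\<bar> \<le> A * k" "\<bar>e\<bar> \<le> B" for a d b e k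
    proof -
      have "\<bar>a * d + b * e\<bar> \<le> \<bar>a\<bar> * \<bar>d\<bar> + \<bar>b\<bar> * \<bar>e\<bar>"
        using abs_triangle_ineq[of "a * d" "b * e"] by (simp add: abs_mult)
      also have "\<dots> \<le> A * (B * k) + (A * k) * B"
        using that A(1) B(1) by (intro add_mono mult_mono) auto
      finally show ?thesis by (simp add: algebra_simps)
    qed
    have "\<bar>f w * g w\<bar> \<le> 2 * A * B" "\<bar>f w * partial1 g w + partial1 f w * g w\<bar> \<le> 2 * A * B * weight S w"
        "\<bar>f w * partial2 g w + partial2 f w * g w\<bar> \<le> 2 * A * B * weight S w"
      if w: "w \<in> cball 0 R - S" for w
    proof -
      show "\<bar>f w * partial1 g w + partial1 f w * g w\<bar> \<le> 2 * A * B * weight S w"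
        "\<bar>f w * partial2 g w + partial2 f w * g w\<bar> \<le> 2 * A * B * weight S w"
        using A(2)[OF w] B(2)[OF w] by (auto intro!: mult)
      have "\<bar>f w\<bar> * \<bar>g w\<bar> \<le> A * B" using A(2)[OF w] B(2)[OF w] A(1) B(1) by (intro mult_mono) auto
      then show "\<bar>f w * g w\<bar> \<le> 2 * A * B" using mult_nonneg_nonneg[OF A(1) B(1)] by (simp add: abs_mult)
    qed
    then show "\<exists>M\<ge>0. \<forall>w\<in>cball 0 R - S. \<bar>f w * g w\<bar> \<le> M \<and>
        \<bar>f w * partial1 g w + partial1 f w * g w\<bar> \<le> M * weight S w \<and>
        \<bar>f w * partial2 g w + partial2 f w * g w\<bar> \<le> M * weight S w"
      using A(1) B(1) by (intro exI[of _ "2 * A * B"]) auto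
  qed
qed

lemma regular_off_add:
  assumes "regular_off S f" "regular_off S g"
  shows "regular_off S (\<lambda>w. f w + g w)"
proof -
  note f = regular_off_partial[OF assms(1)] and g = regular_off_partial[OF assms(2)]
  show ?thesis
  proof (rule regular_offI)
    show "has_partials S (\<lambda>w. f w + g w) (\<lambda>w. partial1 f w + partial1 g w) (\<lambda>w. partial2 f w + partial2 g w)"
      using f(1) g(1) by (auto simp: has_partials_def intro!: DERIV_add)
    show "continuous_on (- S) (\<lambda>w. f w + g w)" "continuous_on (- S) (\<lambda>w. partial1 f w + partial1 g w)"
        "continuous_on (- S) (\<lambda>w. partial2 f w + partial2 g w)"
      using f g by (auto intro!: continuous_intros)
    fix R :: real
    obtain A B where A: "A \<ge> 0" "\<And>w. w \<in> cball 0 R - S \<Longrightarrow> \<bar>f w\<bar> \<le> A \<and> \<bar>partial1 f w\<bar> \<le> A * weight S w \<and> \<bar>partial2 f w\<bar> \<le> A * weight S w"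
      and B: "B \<ge> 0" "\<And>w. w \<in> cball 0 R - S \<Longrightarrow> \<bar>g w\<bar> \<le> B \<and> \<bar>partial1 g w\<bar> \<le> B * weight S w \<and> \<bar>partial2 g w\<bar> \<le> B * weight S w"
      using f(5)[of R] g(5)[of R] by blast
    have "\<bar>f w + g w\<bar> \<le> A + B \<and> \<bar>partial1 f w + partial1 g w\<bar> \<le> (A + B) * weight S w \<and>
        \<bar>partial2 f w + partial2 g w\<bar> \<le> (A + B) * weight S w"
      if w: "w \<in> cball 0 R - S" for w
      using A(2)[OF w] B(2)[OF w] by (auto simp: distrib_right)
    then show "\<exists>M\<ge>0. \<forall>w\<in>cball 0 R - S. \<bar>f w + g w\<bar> \<le> M \<and>
        \<bar>partial1 f w + partial1 g w\<bar> \<le> M * weight S w \<and> \<bar>partial2 f w + partial2 g w\<bar> \<le> M * weight S w"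
      using A(1) B(1) by (intro exI[of _ "A + B"]) auto
  qed
qed

text \<open>On a disc \<open>f\<close> takes values in the intersection of the closed set
  \<open>I\<close> with a bounded interval; this is compact, which bounds \<open>\<phi>\<close> and
  \<open>\<phi>'\<close> there.\<close>

lemma regular_off_compose:
  fixes \<phi> \<phi>' :: "real \<Rightarrow> real"
  assumes "regular_off S f" and I: "closed I" "\<And>w. w \<notin> S \<Longrightarrow> f w \<in> I"
    and \<phi>: "\<And>t. t \<in> I \<Longrightarrow> (\<phi> has_real_derivative \<phi>' t) (at t)" "continuous_on I \<phi>'"
  shows "regular_off S (\<lambda>w. \<phi> (f w))"
proof -
  note f = regular_off_partial[OF assms(1)]
  have cont: "continuous_on I \<phi>"
    using \<phi>(1) by (auto intro!: continuous_at_imp_continuous_on DERIV_isCont)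
  show ?thesis
  proof (rule regular_offI)
    show "has_partials S (\<lambda>w. \<phi> (f w)) (\<lambda>w. \<phi>' (f w) * partial1 f w) (\<lambda>w. \<phi>' (f w) * partial2 f w)"
      unfolding has_partials_def
    proof (intro allI impI conjI)
      fix x y assume w: "(x, y) \<notin> S"
      note d = \<phi>(1)[OF I(2)[OF w]]
      show "((\<lambda>x. \<phi> (f (x, y))) has_real_derivative \<phi>' (f (x, y)) * partial1 f (x, y)) (at x)"
        using f(1) w by (intro DERIV_chain2[where f = \<phi> and g = "\<lambda>x. f (x, y)", OF d]) (simp add: has_partials_def)
      show "((\<lambda>y. \<phi> (f (x, y))) has_real_derivative \<phi>' (f (x, y)) * partial2 f (x, y)) (at y)"
        using f(1) w by (intro DERIV_chain2[where f = \<phi> and g = "\<lambda>y. f (x, y)", OF d]) (simp add: has_partials_def)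
    qed
    show "continuous_on (- S) (\<lambda>w. \<phi> (f w))" "continuous_on (- S) (\<lambda>w. \<phi>' (f w) * partial1 f w)"
       "continuous_on (- S) (\<lambda>w. \<phi>' (f w) * partial2 f w)"
    proof -
      have im: "f ` (- S) \<subseteq> I" using I(2) by blast
      show "continuous_on (- S) (\<lambda>w. \<phi> (f w))"
        by (rule continuous_on_compose2[OF cont f(2) im])
      show "continuous_on (- S) (\<lambda>w. \<phi>' (f w) * partial1 f w)" "continuous_on (- S) (\<lambda>w. \<phi>' (f w) * partial2 f w)"
        by (intro continuous_on_mult continuous_on_compose2[OF \<phi>(2) f(2) im] f(3,4))+
    qed
    fix R :: real
    obtain A where A: "A \<ge> 0" "\<And>w. w \<in> cball 0 R - S \<Longrightarrow> \<bar>f w\<bar> \<le> A \<and> \<bar>partial1 f w\<bar> \<le> A * weight S w \<and> \<bar>partial2 f w\<bar> \<le> A * weight S w"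
      using f(5)[of R] by blast
    have cmp: "compact (I \<inter> {- A..A})" using I(1) by (simp add: closed_Int_compact)
    have "bounded (\<phi> ` (I \<inter> {- A..A}))" "bounded (\<phi>' ` (I \<inter> {- A..A}))"
      by (intro compact_imp_bounded compact_continuous_image cmp continuous_on_subset[OF cont] continuous_on_subset[OF \<phi>(2)]; blast)+
    then obtain B C where BC: "\<forall>t\<in>\<phi> ` (I \<inter> {- A..A}). norm t \<le> B" "\<forall>t\<in>\<phi>' ` (I \<inter> {- A..A}). norm t \<le> C"
      unfolding bounded_iff by blast
    have B: "\<bar>\<phi> t\<bar> \<le> B" and C: "\<bar>\<phi>' t\<bar> \<le> C" if "t \<in> I" "\<bar>t\<bar> \<le> A" for t
      using BC that by (auto simp: abs_le_iff)
    define M where "M = max \<bar>B\<bar> (\<bar>C\<bar> * A)"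
    have "\<bar>\<phi> (f w)\<bar> \<le> M \<and> \<bar>\<phi>' (f w) * partial1 f w\<bar> \<le> M * weight S w \<and> \<bar>\<phi>' (f w) * partial2 f w\<bar> \<le> M * weight S w"
      if w: "w \<in> cball 0 R - S" for w
    proof -
      have fw: "f w \<in> I" "\<bar>f w\<bar> \<le> A" using I(2) A(2)[OF w] w by auto
      have *: "\<bar>\<phi>' (f w) * d\<bar> \<le> M * weight S w" if "\<bar>d\<bar> \<le> A * weight S w" for d
      proof -
        have "\<bar>\<phi>' (f w)\<bar> * \<bar>d\<bar> \<le> \<bar>C\<bar> * (A * weight S w)"
          using C[OF fw] that by (intro mult_mono) auto
        also have "\<dots> \<le> M * weight S w"
          using weight_ge_1[of S w] by (simp add: M_def mult.assoc[symmetric] mult_right_mono)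
        finally show ?thesis by (simp add: abs_mult)
      qed
      show ?thesis using * A(2)[OF w] B[OF fw] by (auto simp: M_def)
    qed
    then show "\<exists>M\<ge>0. \<forall>w\<in>cball 0 R - S. \<bar>\<phi> (f w)\<bar> \<le> M \<and> \<bar>\<phi>' (f w) * partial1 f w\<bar> \<le> M * weight S w \<and>
        \<bar>\<phi>' (f w) * partial2 f w\<bar> \<le> M * weight S w"
      by (intro exI[of _ M]) (auto simp: M_def)
  qed
qed

lemma regular_off_diff:
  assumes "regular_off S f" "regular_off S g"
  shows "regular_off S (\<lambda>w. f w - g w)"
proof -
  have "regular_off S (\<lambda>w. f w + (- 1) * g w)"
    by (intro regular_off_add regular_off_mult regular_off_const assms)
  then show ?thesis by simp
qed

lemma regular_off_power2: "regular_off S f \<Longrightarrow> regular_off S (\<lambda>w. (f w)\<^sup>2)"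
  unfolding power2_eq_square by (rule regular_off_mult)

lemma regular_off_inverse:
  assumes "regular_off S f" "d > 0" "\<And>w. w \<notin> S \<Longrightarrow> f w \<ge> d"
  shows "regular_off S (\<lambda>w. inverse (f w))"
proof (rule regular_off_compose[OF assms(1)])
  show "closed {d..}" by simp
  show "(inverse has_real_derivative - (inverse (t ^ 2))) (at t)" if "t \<in> {d..}" for t
    using that assms(2) DERIV_inverse[of t] by (simp add: numeral_2_eq_2)
  show "continuous_on {d..} (\<lambda>t. - (inverse (t ^ 2)))"
    using assms(2) by (intro continuous_intros) auto
qed (use assms in auto)

text \<open>The positive part, squared so that it is continuously differentiable. It serves for the
  bump at the lowest point, for the cutoff and for bounding a denominator from below.\<close>

definition pos2 :: "real \<Rightarrow> real" where
  "pos2 t = (max 0 t)\<^sup>2"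

lemma pos2_eq_0 [simp]: "t \<le> 0 \<Longrightarrow> pos2 t = 0" and pos2_nonneg [simp]: "pos2 t \<ge> 0"
  and pos2_pos: "t > 0 \<Longrightarrow> pos2 t > 0"
  by (auto simp: pos2_def)

lemma DERIV_pos2: "(pos2 has_real_derivative 2 * max 0 t) (at t)"
proof (cases t "0::real" rule: linorder_cases)
  case less
  have "((\<lambda>_. 0) has_real_derivative 2 * max 0 t) (at t)"
    using less by (auto intro!: derivative_eq_intros)
  then show ?thesis
    by (rule has_field_derivative_transform_within_open[of _ _ _ "{..<0}"]) (use less in auto)
next
  case greater
  have "((\<lambda>t. t\<^sup>2) has_real_derivative 2 * max 0 t) (at t)"
    using greater by (auto intro!: derivative_eq_intros)
  then show ?thesis
    by (rule has_field_derivative_transform_within_open[of _ _ _ "{0<..}"]) (use greater in \<open>auto simp: pos2_def\<close>)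
next
  case equal
  have "((\<lambda>h. pos2 (0 + h) / h) \<longlongrightarrow> 0) (at 0)"
  proof (rule Lim_null_comparison)
    show "eventually (\<lambda>h. norm (pos2 (0 + h) / h) \<le> \<bar>h\<bar>) (at 0)"
      by (rule always_eventually) (auto simp: pos2_def max_def power2_eq_square)
    show "((\<lambda>h::real. \<bar>h\<bar>) \<longlongrightarrow> 0) (at 0)"
      using tendsto_rabs_zero[OF tendsto_ident_at] by simp
  qed
  then show ?thesis using equal by (simp add: DERIV_def)
qed

lemma regular_off_pos2: "regular_off S f \<Longrightarrow> regular_off S (\<lambda>w. pos2 (f w))"
  by (rule regular_off_compose[where I = UNIV and \<phi>' = "\<lambda>t. 2 * max 0 t"])
    (auto intro!: DERIV_pos2 continuous_intros)

lemma compact_scalar_field_if_regular_off: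
  assumes S: "finite S" "S \<subseteq> cball 0 R" and f: "regular_off S f"
    and supp: "\<And>w. w \<notin> cball 0 R \<Longrightarrow> f w = 0" and R: "R \<ge> 0"
  obtains M where "compact_scalar_field S R M f (partial1 f) (partial2 f)"
proof -
  note p = regular_off_partial[OF f]
  have zero: "partial1 f w = 0 \<and> partial2 f w = 0" if w: "w \<notin> cball 0 R" for w
  proof -
    obtain x y where xy: "w = (x, y)" by force
    have op: "open (- cball (0 :: real \<times> real) R)" by (intro open_Compl closed_cball)
    have ox: "open ((\<lambda>x::real. (x, y)) -` (- cball 0 R))"
      by (rule open_vimage[OF op]) (intro continuous_intros)
    have oy: "open ((\<lambda>y::real. (x, y)) -` (- cball 0 R))"
      by (rule open_vimage[OF op]) (intro continuous_intros)
    have "((\<lambda>x. f (x, y)) has_real_derivative 0) (at x)"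
      by (rule has_field_derivative_transform_within_open[OF DERIV_const[of 0] ox])
        (use w supp xy in auto)
    moreover have "((\<lambda>y. f (x, y)) has_real_derivative 0) (at y)"
      by (rule has_field_derivative_transform_within_open[OF DERIV_const[of 0] oy])
        (use w supp xy in auto)
    ultimately show ?thesis
      by (auto simp: xy partial1_def partial2_def intro: DERIV_imp_deriv)
  qed
  obtain M where M: "M \<ge> 0" "\<And>w. w \<in> cball 0 R - S \<Longrightarrow> \<bar>f w\<bar> \<le> M \<and> \<bar>partial1 f w\<bar> \<le> M * weight S w \<and> \<bar>partial2 f w\<bar> \<le> M * weight S w"
    using p(5)[of R] by blast
  have M': "\<bar>f w\<bar> \<le> M \<and> \<bar>partial1 f w\<bar> \<le> M * weight S w \<and> \<bar>partial2 f w\<bar> \<le> M * weight S w" if "w \<notin> S" for w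
  proof (cases "w \<in> cball 0 R")
    case True
    then show ?thesis using M(2) that by blast
  next
    case False
    then show ?thesis
      using zero[OF False] supp[OF False] M(1) weight_ge_1[of S w] by (auto intro!: mult_nonneg_nonneg)
  qed
  have "compact_scalar_field S R M f (partial1 f) (partial2 f)"
    by unfold_locales
      (use S R supp zero p(1-4) M' in \<open>auto simp: has_partials_def weight_def\<close>)
  then show ?thesis by (rule that)
qed

subsection \<open>Regular simple closed curves\<close>

context regular_loop
begin

lemma period_int: "c (s + of_int k) = c s"
proof -
  have nat: "c (s + of_nat n) = c s" for s n
  proof (induction n)
    case (Suc n)
    then show ?case using period[of "s + of_nat n"] by (simp add: ac_simps)
  qed simp
  show ?thesis
  proof (cases "k \<ge> 0")
    case True
    then show ?thesis using nat[of s "nat k"] by simp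
  next
    case False
    then show ?thesis using nat[of "s + of_int k" "nat (- k)"] by simp
  qed
qed

text \<open>Lets the parametrisation start at a lowest point, as \<open>rotation_number_0\<close>
  demands. Injectivity survives because parameters in \<open>{0..<1}\<close> whose shifts have equal
  fractional parts differ by an integer of modulus less than 1.\<close>

lemma regular_loop_shift: "regular_loop (\<lambda>s. c (s + a)) (\<lambda>s. c' (s + a))"
proof
  fix s
  have "((\<lambda>s. s + a) has_vector_derivative (1::real)) (at s)"
    by (auto intro!: derivative_eq_intros)
  from vector_diff_chain_at[OF this deriv]
  show "((\<lambda>s. c (s + a)) has_vector_derivative c' (s + a)) (at s)"
    by (simp add: o_def)
  show "continuous_on UNIV (\<lambda>s. c' (s + a))"
    by (rule continuous_on_compose2[OF deriv_cont]) (auto intro!: continuous_intros)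
  show "c (s + 1 + a) = c (s + a)" using period[of "s + a"] by (simp add: ac_simps)
  show "c' (s + a) \<noteq> 0" by (rule regular)
  show "inj_on (\<lambda>s. c (s + a)) {0..<1}"
  proof (rule inj_onI)
    fix s t :: real assume st: "s \<in> {0..<1}" "t \<in> {0..<1}" and eq: "c (s + a) = c (t + a)"
    have "c (frac (u + a)) = c (u + a)" for u
      using period_int[of "u + a" "- \<lfloor>u + a\<rfloor>"] by (simp add: frac_def)
    then have "frac (s + a) = frac (t + a)"
      using eq by (intro inj_onD[OF simple]) (auto simp: frac_lt_1)
    then have eq': "s - t = of_int (\<lfloor>s + a\<rfloor> - \<lfloor>t + a\<rfloor>)"
      by (simp add: frac_def)
    have "\<bar>s - t\<bar> < 1" using st by auto
    then have "\<bar>\<lfloor>s + a\<rfloor> - \<lfloor>t + a\<rfloor>\<bar> < 1"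
      unfolding eq' of_int_abs[symmetric] of_int_less_1_iff .
    with eq' show "s = t" by simp
  qed
qed

lemma rotation_number:
  assumes d2: "\<And>s. (c' has_vector_derivative c'' s) (at s)" and cont2: "continuous_on UNIV c''"
    and low: "\<And>s. Im (c t0) \<le> Im (c s)" and t0: "t0 \<in> {0..1}"
  shows "integral {0..1} (\<lambda>s. c'' s / c' s) = 2 * pi * \<i> * sgn (Re (c' t0))"
proof -
  interpret shift: regular_loop "\<lambda>s. c (s + t0)" "\<lambda>s. c' (s + t0)"
    by (rule regular_loop_shift)
  have sh: "((\<lambda>s. c' (s + a)) has_vector_derivative c'' (s + a)) (at s)" for s a
  proof -
    have "((\<lambda>s. s + a) has_vector_derivative (1::real)) (at s)"
      by (auto intro!: derivative_eq_intros)
    from vector_diff_chain_at[OF this d2] show ?thesis by (simp add: o_def)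
  qed
  have per: "c'' (s + 1) = c'' s" for s
    using sh[of 1 s] d2[of s] by (simp add: deriv_period vector_derivative_unique_at)
  have "integral {0..1} (\<lambda>s. c'' (s + t0) / c' (s + t0)) = 2 * pi * \<i> * sgn (Re (c' (0 + t0)))"
  proof (rule shift.rotation_number_0[OF sh])
    show "continuous_on UNIV (\<lambda>s. c'' (s + t0))"
      by (rule continuous_on_compose2[OF cont2]) (auto intro!: continuous_intros)
  qed (use low in simp)
  also have "integral {0..1} (\<lambda>s. c'' (s + t0) / c' (s + t0)) = integral {0..1} (\<lambda>s. c'' s / c' s)"
    using t0 regular by (intro integral_shift_periodic continuous_intros cont2 deriv_cont) (auto simp: per deriv_period)
  finally show ?thesis by simp
qed

end

text \<open>The enclosed region enters only as an open set described by winding numbers;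
  \<open>n\<close> is the orientation.\<close>

locale enclosing_loop = regular_loop +
  fixes \<Omega> :: "(real \<times> real) set" and n :: real
  assumes open_region: "open \<Omega>"
    and inner: "\<And>w. w \<in> \<Omega> \<Longrightarrow> cpx w \<notin> c ` {0..1} \<and> winding_number c (cpx w) = of_real n"
    and outer: "\<And>w. w \<notin> \<Omega> \<Longrightarrow> cpx w \<notin> c ` {0..1} \<Longrightarrow> winding_number c (cpx w) = 0"
    and n: "n = 1 \<or> n = -1"
begin

definition pt :: "real \<Rightarrow> real \<times> real" where
  "pt s = (Re (c s), Im (c s))"

lemma cpx_pt [simp]: "cpx (pt s) = c s"
  by (simp add: pt_def)

lemma continuous_on_pt: "continuous_on A pt"
  unfolding pt_def by (intro continuous_intros cont)

lemma green:
  assumes S: "finite S" "\<And>s. s \<in> {0..1} \<Longrightarrow> pt s \<notin> S" and f: "regular_off S f"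
    and supp: "\<And>w. norm w > R \<Longrightarrow> f w = 0"
  shows "set_integrable lborel \<Omega> (partial1 f)" "set_integrable lborel \<Omega> (partial2 f)"
    "integral {0..1} (\<lambda>s. f (pt s) * Im (c' s)) = n * (LINT w:\<Omega>|lborel. partial1 f w)"
    "integral {0..1} (\<lambda>s. f (pt s) * Re (c' s)) = - n * (LINT w:\<Omega>|lborel. partial2 f w)"
proof -
  \<comment> \<open>Enlarged to a nonnegative radius whose disc contains \<open>S\<close>.\<close>
  define R' where "R' = \<bar>R\<bar> + (\<Sum>s\<in>S. norm s)"
  have R': "R' \<ge> R" "R' \<ge> 0"
    using sum_nonneg[of S norm] by (auto simp: R'_def)
  have "S \<subseteq> cball 0 R'"
    using member_le_sum[of _ S norm] S(1) by (fastforce simp: R'_def)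
  then obtain M where "compact_scalar_field S R' M f (partial1 f) (partial2 f)"
    using compact_scalar_field_if_regular_off[OF S(1) _ f _ R'(2)] supp R'(1) by (auto simp: not_le)
  then interpret field: compact_scalar_field S R' M f "partial1 f" "partial2 f" .
  have int: "set_integrable lborel \<Omega> g" if "integrable lborel g" for g :: "real \<times> real \<Rightarrow> 'b::{banach, second_countable_topology}"
    unfolding set_integrable_def using open_region that by (intro integrable_mult_indicator) auto
  show i: "set_integrable lborel \<Omega> (partial1 f)" "set_integrable lborel \<Omega> (partial2 f)"
    by (intro int field.integrable_Fx field.integrable_Fy)+
  have iE: "set_integrable lborel \<Omega> field.E" by (intro int field.integrable_E)
  have E: "(LINT w:\<Omega>|lborel. field.E w) =
      of_real (LINT w:\<Omega>|lborel. partial1 f w) + \<i> * of_real (LINT w:\<Omega>|lborel. partial2 f w)"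
  proof (rule complex_eqI)
    have "Re (LINT w:\<Omega>|lborel. field.E w) = (LINT w:\<Omega>|lborel. partial1 f w)"
      using integral_Re[OF iE[unfolded set_integrable_def]] by (simp add: set_lebesgue_integral_def field.E_def)
    then show "Re (LINT w:\<Omega>|lborel. field.E w) = Re (of_real (LINT w:\<Omega>|lborel. partial1 f w) + \<i> * of_real (LINT w:\<Omega>|lborel. partial2 f w))"
      by simp
    have "Im (LINT w:\<Omega>|lborel. field.E w) = (LINT w:\<Omega>|lborel. partial2 f w)"
      using integral_Im[OF iE[unfolded set_integrable_def]] by (simp add: set_lebesgue_integral_def field.E_def)
    then show "Im (LINT w:\<Omega>|lborel. field.E w) = Im (of_real (LINT w:\<Omega>|lborel. partial1 f w) + \<i> * of_real (LINT w:\<Omega>|lborel. partial2 f w))"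
      by simp
  qed
  have g: "integral {0..1} (\<lambda>s. of_real (f (pt s)) * c' s) = \<i> * of_real n * (LINT w:\<Omega>|lborel. field.E w)"
    unfolding pt_def
    using period[of 0] S(2)
    by (intro field.green_winding_number deriv deriv_cont open_region inner outer) (auto simp: pt_def)
  have "continuous_on {0..1} (\<lambda>s. of_real (f (pt s)) * c' s)"
    using S(2) by (intro continuous_intros deriv_cont' continuous_on_compose2[OF field.cont(1) continuous_on_pt]) auto
  then have ii: "(\<lambda>s. of_real (f (pt s)) * c' s) integrable_on {0..1}"
    by (rule integrable_continuous_interval)
  have "integral {0..1} (\<lambda>s. f (pt s) * Im (c' s)) = Im (integral {0..1} (\<lambda>s. of_real (f (pt s)) * c' s))"
    using integral_linear[OF ii bounded_linear_Im] by (simp add: o_def)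
  then show "integral {0..1} (\<lambda>s. f (pt s) * Im (c' s)) = n * (LINT w:\<Omega>|lborel. partial1 f w)"
    unfolding g E by simp
  have "integral {0..1} (\<lambda>s. f (pt s) * Re (c' s)) = Re (integral {0..1} (\<lambda>s. of_real (f (pt s)) * c' s))"
    using integral_linear[OF ii bounded_linear_Re] by (simp add: o_def)
  then show "integral {0..1} (\<lambda>s. f (pt s) * Re (c' s)) = - n * (LINT w:\<Omega>|lborel. partial2 f w)"
    unfolding g E by simp
qed

text \<open>The curve lies in the half plane above its lowest point. This half plane is convex, so
  the winding number about any point outside it is 0 and not \<open>n\<close>.\<close>

lemma region_above:
  assumes low: "\<And>s. Im (c t0) \<le> Im (c s)" and w: "w \<in> \<Omega>"
  shows "Im (c t0) \<le> snd w"
proof (rule ccontr)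
  assume "\<not> ?thesis"
  then have "cpx w \<notin> {z. Im z \<ge> Im (c t0)}" by simp
  moreover have "path c" unfolding path_def by (rule cont)
  moreover have "convex {z. Im z \<ge> Im (c t0)}" by (rule convex_halfspace_Im_ge)
  ultimately have "winding_number c (cpx w) = 0"
    using low period[of 0]
    by (intro winding_number_zero_outside[of c "{z. Im z \<ge> Im (c t0)}"]) (auto simp: path_image_def pathstart_def pathfinish_def)
  then show False using inner[OF w] n by auto
qed

text \<open>Green's formula for a bump function at the lowest point, decreasing in the vertical direction,
  compares the orientation with the direction of the curve there.\<close>

lemma orientation_eq:
  assumes low: "\<And>s. Im (c t0) \<le> Im (c s)" and t0: "t0 \<in> {0..1}"
  shows "n = sgn (Re (c' t0))"
proof -
  define \<sigma> where "\<sigma> = sgn (Re (c' t0))"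
  obtain x0 y0 where c0: "Re (c t0) = x0" "Im (c t0) = y0" by blast
  have "Re (c' t0) \<noteq> 0"
    using regular[of t0] Im_deriv_eq_0[OF low] by (auto simp: complex_eq_iff)
  then have \<sigma>: "\<sigma> * Re (c' t0) > 0" "\<sigma> = 1 \<or> \<sigma> = -1"
    by (auto simp: \<sigma>_def sgn_if)
  \<comment> \<open>The parameters at which the horizontal direction is not that of the lowest
    point. Their images form a compact set that misses the lowest point, so a small bump around it
    sees only the good direction.\<close>
  define B where "B = {s \<in> {0..1}. \<sigma> * Re (c' s) \<le> 0}"
  have "B = {0..1} \<inter> (\<lambda>s. \<sigma> * Re (c' s)) -` {..0}" by (auto simp: B_def)
  moreover have "closed ((\<lambda>s. \<sigma> * Re (c' s)) -` {..0})"
    by (intro continuous_closed_vimage[OF closed_atMost] continuous_intros)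
      (use deriv_cont in \<open>auto simp: continuous_on_eq_continuous_at intro!: continuous_intros\<close>)
  ultimately have "compact B" by (simp add: compact_Int_closed)
  then have cmp: "compact (pt ` B)" by (intro compact_continuous_image continuous_on_pt)
  have "(x0, y0) \<notin> pt ` B"
  proof
    assume "(x0, y0) \<in> pt ` B"
    then obtain s where s: "s \<in> B" "c s = c t0"
      using c0 by (auto simp: pt_def complex_eq_iff)
    \<comment> \<open>The lowest point may be attained at both ends 0 and 1 of the parameter
      interval; there \<open>c'\<close> agrees by periodicity.\<close>
    have "s = t0 \<or> (s, t0) \<in> {(0, 1), (1, 0)}"
      using c_eq_iff[of s t0] c_eq_iff[of t0 s] s t0 by (cases s t0 rule: linorder_cases) (auto simp: B_def)
    then have "c' s = c' t0" using deriv_period[of 0] by auto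
    then show False using s(1) \<sigma>(1) by (simp add: B_def)
  qed
  then obtain \<epsilon> where \<epsilon>: "\<epsilon> > 0" "\<And>s. s \<in> B \<Longrightarrow> \<epsilon> \<le> dist (x0, y0) (pt s)"
    using separate_point_closed[OF compact_imp_closed[OF cmp]] by blast
  \<comment> \<open>The bump lives on a square of half side \<open>\<delta>\<close>; the factor 1/2
    keeps that square within distance \<open>\<epsilon>\<close> of its centre.\<close>
  define \<delta> where "\<delta> = \<epsilon> / 2"
  have \<delta>: "\<delta> > 0" using \<epsilon>(1) by (simp add: \<delta>_def)
  define F where "F w = pos2 (\<delta>\<^sup>2 - (fst w - x0)\<^sup>2) * pos2 (\<delta>\<^sup>2 - (snd w - y0)\<^sup>2)" for w :: "real \<times> real"
  have regF: "regular_off {} F"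
    unfolding F_def[abs_def]
    by (intro regular_off_mult regular_off_pos2 regular_off_diff regular_off_power2 regular_off_const regular_off_fst regular_off_snd)
  have near: "\<bar>fst w - x0\<bar> < \<delta>" "\<bar>snd w - y0\<bar> < \<delta>" if "F w \<noteq> 0" for w
  proof -
    have "\<delta>\<^sup>2 - (fst w - x0)\<^sup>2 > 0" "\<delta>\<^sup>2 - (snd w - y0)\<^sup>2 > 0"
      by (rule ccontr, use that in \<open>simp add: F_def not_less\<close>)+
    then have "\<bar>fst w - x0\<bar>\<^sup>2 < \<delta>\<^sup>2" "\<bar>snd w - y0\<bar>\<^sup>2 < \<delta>\<^sup>2" by auto
    then show "\<bar>fst w - x0\<bar> < \<delta>" "\<bar>snd w - y0\<bar> < \<delta>"
      using \<delta> by (auto intro: power2_less_imp_less simp del: power2_abs)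
  qed
  have dist: "dist w (x0, y0) < \<epsilon>" if "F w \<noteq> 0" for w
  proof -
    have "dist w (x0, y0) \<le> \<bar>fst w - x0\<bar> + \<bar>snd w - y0\<bar>"
      using norm_Pair_le[of "fst w - x0" "snd w - y0"] by (cases w) (simp add: dist_norm)
    then show ?thesis using near[OF that] by (simp add: \<delta>_def)
  qed
  have supp: "F w = 0" if "norm w > norm (x0, y0) + \<epsilon>" for w
  proof (rule ccontr)
    assume "F w \<noteq> 0"
    then show False using dist[of w] norm_triangle_ineq2[of w "(x0, y0)"] that by (simp add: dist_norm)
  qed
  have F_nonneg: "F w \<ge> 0" for w by (simp add: F_def)
  note gr = green[OF _ _ regF supp]
  have d2: "partial2 F w = pos2 (\<delta>\<^sup>2 - (fst w - x0)\<^sup>2) * (2 * max 0 (\<delta>\<^sup>2 - (snd w - y0)\<^sup>2) * (- 2 * (snd w - y0)))" for w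
  proof -
    obtain x y where w: "w = (x, y)" by force
    have "((\<lambda>y. \<delta>\<^sup>2 - (y - y0)\<^sup>2) has_real_derivative - 2 * (y - y0)) (at y)"
      by (auto intro!: derivative_eq_intros)
    from DERIV_chain2[OF DERIV_pos2 this]
    have "((\<lambda>y. pos2 (\<delta>\<^sup>2 - (y - y0)\<^sup>2)) has_real_derivative 2 * max 0 (\<delta>\<^sup>2 - (y - y0)\<^sup>2) * (- 2 * (y - y0))) (at y)" .
    from DERIV_cmult[OF this, of "pos2 (\<delta>\<^sup>2 - (x - x0)\<^sup>2)"] show ?thesis
      by (simp add: w partial2_def F_def DERIV_imp_deriv)
  qed
  \<comment> \<open>The region lies above the centre of the bump, where the bump does not increase
    with height.\<close>
  have "(LINT w:\<Omega>|lborel. - partial2 F w) \<ge> 0"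
    unfolding set_lebesgue_integral_def
  proof (rule integral_nonneg_AE, rule AE_I2)
    fix w
    show "0 \<le> indicator \<Omega> w *\<^sub>R - partial2 F w"
    proof (cases "w \<in> \<Omega>")
      case True
      then have "snd w - y0 \<ge> 0" using region_above[OF low] c0 by auto
      then have "0 \<le> pos2 (\<delta>\<^sup>2 - (fst w - x0)\<^sup>2) * (2 * max 0 (\<delta>\<^sup>2 - (snd w - y0)\<^sup>2) * (2 * (snd w - y0)))"
        by (intro mult_nonneg_nonneg) auto
      also have "\<dots> = - partial2 F w"
        unfolding d2 by (simp only: minus_mult_right minus_mult_left minus_minus)
      finally show ?thesis using True by simp
    qed simp
  qed
  then have A: "- (LINT w:\<Omega>|lborel. partial2 F w) \<ge> 0"
    by (simp add: set_lebesgue_integral_def)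
  have contk: "continuous_on {0..1} (\<lambda>s. F (pt s) * Re (c' s))"
    using regular_off_partial(2)[OF regF]
    by (intro continuous_intros deriv_cont' continuous_on_compose2[of UNIV F, OF _ continuous_on_pt]) auto
  have nonneg: "\<sigma> * (F (pt s) * Re (c' s)) \<ge> 0" if s: "s \<in> {0..1}" for s
  proof (cases "F (pt s) = 0")
    case False
    then have "s \<notin> B" using dist[of "pt s"] \<epsilon>(2)[of s] by (auto simp: dist_commute)
    then have "\<sigma> * Re (c' s) > 0" using s by (simp add: B_def)
    then have "F (pt s) * (\<sigma> * Re (c' s)) \<ge> 0" by (intro mult_nonneg_nonneg[OF F_nonneg less_imp_le])
    then show ?thesis by (simp add: ac_simps)
  qed simp
  have "F (pt t0) > 0" using c0 \<delta> by (simp add: F_def pt_def pos2_pos)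
  from mult_pos_pos[OF this \<sigma>(1)] have pos: "\<sigma> * (F (pt t0) * Re (c' t0)) > 0"
    by (simp add: ac_simps)
  have contk': "continuous_on {0..1} (\<lambda>s. \<sigma> * (F (pt s) * Re (c' s)))"
    by (rule continuous_on_mult[OF continuous_on_const contk])
  have "integral {0..1} (\<lambda>s. \<sigma> * (F (pt s) * Re (c' s))) \<noteq> 0"
    using integral_eq_0_iff[OF contk' _ nonneg] pos t0 by fastforce
  moreover have "integral {0..1} (\<lambda>s. \<sigma> * (F (pt s) * Re (c' s))) \<ge> 0"
    using nonneg by (intro integral_nonneg integrable_continuous_interval contk')
  ultimately have "integral {0..1} (\<lambda>s. \<sigma> * (F (pt s) * Re (c' s))) > 0"
    by (metis less_le)
  then have "\<sigma> * integral {0..1} (\<lambda>s. F (pt s) * Re (c' s)) > 0" by simp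
  \<comment> \<open>By Green's formula the positive line integral equals \<open>n\<close> times a
    nonnegative area integral, up to the factor \<open>\<sigma>\<close>, so \<open>\<sigma>\<close>
    and \<open>n\<close> must have the same sign.\<close>
  then have "\<sigma> * n * (- (LINT w:\<Omega>|lborel. partial2 F w)) > 0"
    using gr(4) by (simp add: mult.assoc)
  then have "\<sigma> * n > 0" using A by (meson mult_nonpos_nonneg not_le)
  then show ?thesis using n \<sigma>(2) unfolding \<sigma>_def[symmetric] by auto
qed

text \<open>Rotation number and winding number are linked through a third quantity: the sign of the
  horizontal velocity at a lowest point, which exists by compactness of a period.\<close>

theorem umlaufsatz:
  assumes d2: "\<And>s. (c' has_vector_derivative c'' s) (at s)" and cont2: "continuous_on UNIV c''"
  shows "integral {0..1} (\<lambda>s. c'' s / c' s) = 2 * pi * \<i> * n"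
proof -
  have "continuous_on {0..1} (\<lambda>s. Im (c s))" by (intro continuous_intros cont)
  then have "\<exists>t0\<in>{0..1}. \<forall>s\<in>{0..1}. Im (c t0) \<le> Im (c s)"
    by (intro continuous_attains_inf) auto
  then obtain t0 where t0: "t0 \<in> {0..1}" "\<And>s. s \<in> {0..1} \<Longrightarrow> Im (c t0) \<le> Im (c s)"
    by blast
  have low: "Im (c t0) \<le> Im (c s)" for s
  proof -
    have "c (frac s) = c s"
      using period_int[of s "- \<lfloor>s\<rfloor>"] by (simp add: frac_def)
    then show ?thesis using t0(2)[of "frac s"] by (simp add: frac_lt_1 less_imp_le)
  qed
  show ?thesis
    using rotation_number[OF d2 cont2 low t0(1)] orientation_eq[OF low t0(1)] by simp
qed

end

subsection \<open>Distances to the primaries\<close>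

lemma has_partials_local:
  assumes h: "has_partials S h hx hy" and N: "open N" "w \<in> N" and "w \<notin> S"
    and eq: "\<And>v. v \<in> N \<Longrightarrow> f v = h v"
  shows "partial1 f w = hx w" "partial2 f w = hy w"
proof -
  obtain x y where w: "w = (x, y)" by force
  have ox: "open ((\<lambda>x::real. (x, y)) -` N)"
    by (rule open_vimage[OF N(1)]) (intro continuous_intros)
  have oy: "open ((\<lambda>y::real. (x, y)) -` N)"
    by (rule open_vimage[OF N(1)]) (intro continuous_intros)
  have d: "((\<lambda>x. h (x, y)) has_real_derivative hx (x, y)) (at x)"
    "((\<lambda>y. h (x, y)) has_real_derivative hy (x, y)) (at y)"
    using h \<open>w \<notin> S\<close> by (auto simp: has_partials_def w)
  have "((\<lambda>x. f (x, y)) has_real_derivative hx (x, y)) (at x)"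
    by (rule has_field_derivative_transform_within_open[OF d(1) ox]) (use N eq w in auto)
  moreover have "((\<lambda>y. f (x, y)) has_real_derivative hy (x, y)) (at y)"
    by (rule has_field_derivative_transform_within_open[OF d(2) oy]) (use N eq w in auto)
  ultimately show "partial1 f w = hx w" "partial2 f w = hy w"
    by (auto simp: w partial1_def partial2_def intro: DERIV_imp_deriv)
qed

definition radius :: "real \<Rightarrow> real \<times> real \<Rightarrow> real" where
  "radius a w = sqrt ((fst w - a)\<^sup>2 + (snd w)\<^sup>2)"

text \<open>Cosine and sine of the polar angle about \<open>(a, 0)\<close>, which are also the
  partial derivatives of \<open>radius a\<close>. At the centre both are 0 by division by
  zero.\<close>

definition cosine :: "real \<Rightarrow> real \<times> real \<Rightarrow> real" where
  "cosine a w = (fst w - a) / radius a w"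

definition sine :: "real \<Rightarrow> real \<times> real \<Rightarrow> real" where
  "sine a w = snd w / radius a w"

lemma radius_eq_dist: "radius a w = dist w (a, 0)"
  by (cases w) (simp add: radius_def dist_prod_def dist_real_def)

lemma radius_nonneg [simp]: "radius a w \<ge> 0"
  by (simp add: radius_eq_dist)

lemma radius_eq_0_iff: "radius a w = 0 \<longleftrightarrow> w = (a, 0)"
  by (simp add: radius_eq_dist)

lemma radius_pos: "w \<noteq> (a, 0) \<Longrightarrow> radius a w > 0"
  by (simp add: radius_eq_dist)

lemma radius_power2: "(radius a w)\<^sup>2 = (fst w - a)\<^sup>2 + (snd w)\<^sup>2"
  by (simp add: radius_def)

lemma abs_cosine_le: "\<bar>cosine a w\<bar> \<le> 1" and abs_sine_le: "\<bar>sine a w\<bar> \<le> 1"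
proof -
  have "\<bar>fst w - a\<bar> \<le> radius a w" "\<bar>snd w\<bar> \<le> radius a w"
    by (simp_all add: radius_def real_le_rsqrt)
  then show "\<bar>cosine a w\<bar> \<le> 1" "\<bar>sine a w\<bar> \<le> 1"
    by (auto simp: cosine_def sine_def divide_le_eq_1)
qed

lemma cosine_sine_power2: "w \<noteq> (a, 0) \<Longrightarrow> (cosine a w)\<^sup>2 + (sine a w)\<^sup>2 = 1"
  using radius_pos[of w a]
  by (simp add: cosine_def sine_def power_divide add_divide_distrib[symmetric] radius_power2[symmetric])

lemma continuous_on_radius [continuous_intros]: "continuous_on A (radius a)"
  unfolding radius_def[abs_def] by (intro continuous_intros)

lemma continuous_on_cosine_sine:
  assumes "(a, 0) \<notin> A"
  shows "continuous_on A (cosine a)" "continuous_on A (sine a)"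
proof -
  have "radius a w \<noteq> 0" if "w \<in> A" for w
    using that assms by (auto simp: radius_eq_0_iff)
  then show "continuous_on A (cosine a)" "continuous_on A (sine a)"
    unfolding cosine_def[abs_def] sine_def[abs_def] by (auto intro!: continuous_intros)
qed

lemma has_partials_radius: "has_partials {(a, 0)} (radius a) (cosine a) (sine a)"
  unfolding has_partials_def
proof (intro allI impI conjI)
  fix x y :: real assume "(x, y) \<notin> {(a, 0)}"
  then have r: "radius a (x, y) > 0" by (intro radius_pos) auto
  then have pos: "(x - a)\<^sup>2 + y\<^sup>2 > 0" by (simp add: radius_def)
  show "((\<lambda>x. radius a (x, y)) has_real_derivative cosine a (x, y)) (at x)"
    using pos unfolding radius_def cosine_def
    by (auto intro!: derivative_eq_intros simp: divide_simps)
  show "((\<lambda>y. radius a (x, y)) has_real_derivative sine a (x, y)) (at y)"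
    using pos unfolding radius_def sine_def
    by (auto intro!: derivative_eq_intros simp: divide_simps)
qed

lemma has_partials_cosine:
  "has_partials {(a, 0)} (cosine a) (\<lambda>w. (sine a w)\<^sup>2 / radius a w) (\<lambda>w. - (cosine a w * sine a w) / radius a w)"
  unfolding has_partials_def
proof (intro allI impI conjI)
  fix x y :: real assume w: "(x, y) \<notin> {(a, 0)}"
  then have r: "radius a (x, y) \<noteq> 0" using radius_pos[of "(x, y)" a] by auto
  have cs: "(cosine a (x, y))\<^sup>2 + (sine a (x, y))\<^sup>2 = 1" using w by (intro cosine_sine_power2) auto
  note d = has_partials_radius[unfolded has_partials_def, rule_format, OF w]
  have "((\<lambda>x. (x - a) / radius a (x, y)) has_real_derivative
      (1 * radius a (x, y) - (x - a) * cosine a (x, y)) / (radius a (x, y) * radius a (x, y))) (at x)"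
    using d r by (auto intro!: derivative_eq_intros)
  also have "(1 * radius a (x, y) - (x - a) * cosine a (x, y)) / (radius a (x, y) * radius a (x, y)) =
      (1 - (cosine a (x, y))\<^sup>2) / radius a (x, y)"
    using r by (simp add: cosine_def field_simps power2_eq_square)
  finally show "((\<lambda>x. cosine a (x, y)) has_real_derivative (sine a (x, y))\<^sup>2 / radius a (x, y)) (at x)"
    using cs by (simp add: cosine_def eq_diff_eq add.commute flip: cs)
  have "((\<lambda>y. (x - a) / radius a (x, y)) has_real_derivative
      (0 * radius a (x, y) - (x - a) * sine a (x, y)) / (radius a (x, y) * radius a (x, y))) (at y)"
    using d r by (auto intro!: derivative_eq_intros)
  also have "(0 * radius a (x, y) - (x - a) * sine a (x, y)) / (radius a (x, y) * radius a (x, y)) =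
      - (cosine a (x, y) * sine a (x, y)) / radius a (x, y)"
    using r by (simp add: cosine_def field_simps)
  finally show "((\<lambda>y. cosine a (x, y)) has_real_derivative - (cosine a (x, y) * sine a (x, y)) / radius a (x, y)) (at y)"
    by (simp add: cosine_def)
qed

lemma has_partials_sine:
  "has_partials {(a, 0)} (sine a) (\<lambda>w. - (cosine a w * sine a w) / radius a w) (\<lambda>w. (cosine a w)\<^sup>2 / radius a w)"
  unfolding has_partials_def
proof (intro allI impI conjI)
  fix x y :: real assume w: "(x, y) \<notin> {(a, 0)}"
  then have r: "radius a (x, y) \<noteq> 0" using radius_pos[of "(x, y)" a] by auto
  have cs: "(cosine a (x, y))\<^sup>2 + (sine a (x, y))\<^sup>2 = 1" using w by (intro cosine_sine_power2) auto
  note d = has_partials_radius[unfolded has_partials_def, rule_format, OF w]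
  have "((\<lambda>y. y / radius a (x, y)) has_real_derivative
      (1 * radius a (x, y) - y * sine a (x, y)) / (radius a (x, y) * radius a (x, y))) (at y)"
    using d r by (auto intro!: derivative_eq_intros)
  also have "(1 * radius a (x, y) - y * sine a (x, y)) / (radius a (x, y) * radius a (x, y)) =
      (1 - (sine a (x, y))\<^sup>2) / radius a (x, y)"
    using r by (simp add: sine_def field_simps power2_eq_square)
  finally show "((\<lambda>y. sine a (x, y)) has_real_derivative (cosine a (x, y))\<^sup>2 / radius a (x, y)) (at y)"
    using cs by (simp add: sine_def eq_diff_eq add.commute flip: cs)
  have "((\<lambda>x. y / radius a (x, y)) has_real_derivative
      (0 * radius a (x, y) - y * cosine a (x, y)) / (radius a (x, y) * radius a (x, y))) (at x)"
    using d r by (auto intro!: derivative_eq_intros)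
  also have "(0 * radius a (x, y) - y * cosine a (x, y)) / (radius a (x, y) * radius a (x, y)) =
      - (cosine a (x, y) * sine a (x, y)) / radius a (x, y)"
    using r by (simp add: sine_def field_simps)
  finally show "((\<lambda>x. sine a (x, y)) has_real_derivative - (cosine a (x, y) * sine a (x, y)) / radius a (x, y)) (at x)"
    by (simp add: sine_def)
qed

lemma has_partials_mono: "has_partials S f fx fy \<Longrightarrow> S \<subseteq> S' \<Longrightarrow> has_partials S' f fx fy"
  unfolding has_partials_def by blast

lemma regular_off_radius:
  assumes S: "finite S" "(a, 0) \<in> S"
  shows "regular_off S (radius a)"
proof (rule regular_offI)
  show "has_partials S (radius a) (cosine a) (sine a)"
    using has_partials_radius by (rule has_partials_mono) (use S in auto)
  show "continuous_on (- S) (radius a)" "continuous_on (- S) (cosine a)" "continuous_on (- S) (sine a)"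
    using S by (auto intro!: continuous_intros continuous_on_cosine_sine)
  fix R :: real
  have "\<bar>radius a w\<bar> \<le> \<bar>R\<bar> + \<bar>a\<bar> + 1 \<and> \<bar>cosine a w\<bar> \<le> (\<bar>R\<bar> + \<bar>a\<bar> + 1) * weight S w \<and> \<bar>sine a w\<bar> \<le> (\<bar>R\<bar> + \<bar>a\<bar> + 1) * weight S w"
    if w: "w \<in> cball 0 R - S" for w
  proof -
    have "dist w (a, 0) \<le> norm w + norm (a, 0::real)"
      unfolding dist_norm by (rule norm_triangle_ineq4)
    then have 1: "\<bar>radius a w\<bar> \<le> \<bar>R\<bar> + \<bar>a\<bar> + 1"
      using w abs_ge_self[of R] by (simp add: radius_eq_dist)
    have "1 * 1 \<le> (\<bar>R\<bar> + \<bar>a\<bar> + 1) * weight S w"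
      using weight_ge_1[of S w] by (intro mult_mono) auto
    then show ?thesis
      using 1 abs_cosine_le[of a w] abs_sine_le[of a w] by linarith
  qed
  then show "\<exists>M\<ge>0. \<forall>w\<in>cball 0 R - S. \<bar>radius a w\<bar> \<le> M \<and> \<bar>cosine a w\<bar> \<le> M * weight S w \<and> \<bar>sine a w\<bar> \<le> M * weight S w"
    by (intro exI[of _ "\<bar>R\<bar> + \<bar>a\<bar> + 1"]) auto
qed

lemma regular_off_cosine_sine:
  assumes S: "finite S" "(a, 0) \<in> S"
  shows "regular_off S (cosine a)" "regular_off S (sine a)"
proof -
  have nz: "radius a w \<noteq> 0" if "w \<notin> S" for w
    using that S by (auto simp: radius_eq_0_iff)
  have inv: "1 / radius a w \<le> weight S w" for w
    using inverse_dist_le_weight[OF S] by (simp add: radius_eq_dist)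
  have b: "\<bar>t / radius a w\<bar> \<le> 1 * weight S w" if "\<bar>t\<bar> \<le> 1" for t w
  proof -
    have "\<bar>t / radius a w\<bar> \<le> 1 / radius a w"
      using that by (simp add: divide_right_mono)
    then show ?thesis using inv[of w] by simp
  qed
  have le1: "\<bar>(cosine a w)\<^sup>2\<bar> \<le> 1" "\<bar>(sine a w)\<^sup>2\<bar> \<le> 1" "\<bar>- (cosine a w * sine a w)\<bar> \<le> 1" for w
    using abs_cosine_le[of a w] abs_sine_le[of a w]
    by (auto simp: abs_mult abs_square_le_1 intro: mult_le_one)
  show "regular_off S (cosine a)"
  proof (rule regular_offI)
    show "has_partials S (cosine a) (\<lambda>w. (sine a w)\<^sup>2 / radius a w) (\<lambda>w. - (cosine a w * sine a w) / radius a w)"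
      using has_partials_cosine by (rule has_partials_mono) (use S in auto)
    show "continuous_on (- S) (cosine a)" "continuous_on (- S) (\<lambda>w. (sine a w)\<^sup>2 / radius a w)"
      "continuous_on (- S) (\<lambda>w. - (cosine a w * sine a w) / radius a w)"
      using S nz by (auto intro!: continuous_intros continuous_on_cosine_sine)
    show "\<exists>M\<ge>0. \<forall>w\<in>cball 0 R - S. \<bar>cosine a w\<bar> \<le> M \<and> \<bar>(sine a w)\<^sup>2 / radius a w\<bar> \<le> M * weight S w \<and>
        \<bar>- (cosine a w * sine a w) / radius a w\<bar> \<le> M * weight S w" for R
      by (intro exI[of _ 1] conjI ballI abs_cosine_le b le1) simp
  qed
  show "regular_off S (sine a)"
  proof (rule regular_offI)
    show "has_partials S (sine a) (\<lambda>w. - (cosine a w * sine a w) / radius a w) (\<lambda>w. (cosine a w)\<^sup>2 / radius a w)"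
      using has_partials_sine by (rule has_partials_mono) (use S in auto)
    show "continuous_on (- S) (sine a)" "continuous_on (- S) (\<lambda>w. - (cosine a w * sine a w) / radius a w)"
      "continuous_on (- S) (\<lambda>w. (cosine a w)\<^sup>2 / radius a w)"
      using S nz by (auto intro!: continuous_intros continuous_on_cosine_sine)
    show "\<exists>M\<ge>0. \<forall>w\<in>cball 0 R - S. \<bar>sine a w\<bar> \<le> M \<and> \<bar>- (cosine a w * sine a w) / radius a w\<bar> \<le> M * weight S w \<and>
        \<bar>(cosine a w)\<^sup>2 / radius a w\<bar> \<le> M * weight S w" for R
      by (intro exI[of _ 1] conjI ballI abs_sine_le b le1) simp
  qed
qed

text \<open>\<open>cosine a / radius a\<close> and \<open>sine a / radius a\<close> are the partial derivatives of the harmonic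
  function \<open>ln (radius a)\<close>.\<close>

lemma has_partials_ln_radius_gradient:
  "has_partials {(a, 0)} (\<lambda>w. cosine a w / radius a w)
     (\<lambda>w. ((sine a w)\<^sup>2 - (cosine a w)\<^sup>2) / (radius a w)\<^sup>2) (\<lambda>w. - 2 * cosine a w * sine a w / (radius a w)\<^sup>2)"
  "has_partials {(a, 0)} (\<lambda>w. sine a w / radius a w)
     (\<lambda>w. - 2 * cosine a w * sine a w / (radius a w)\<^sup>2) (\<lambda>w. ((cosine a w)\<^sup>2 - (sine a w)\<^sup>2) / (radius a w)\<^sup>2)"
proof -
  have "((\<lambda>x. cosine a (x, y) / radius a (x, y)) has_real_derivative
      ((sine a (x, y))\<^sup>2 - (cosine a (x, y))\<^sup>2) / (radius a (x, y))\<^sup>2) (at x) \<and>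
    ((\<lambda>y. cosine a (x, y) / radius a (x, y)) has_real_derivative
      - 2 * cosine a (x, y) * sine a (x, y) / (radius a (x, y))\<^sup>2) (at y) \<and>
    ((\<lambda>x. sine a (x, y) / radius a (x, y)) has_real_derivative
      - 2 * cosine a (x, y) * sine a (x, y) / (radius a (x, y))\<^sup>2) (at x) \<and>
    ((\<lambda>y. sine a (x, y) / radius a (x, y)) has_real_derivative
      ((cosine a (x, y))\<^sup>2 - (sine a (x, y))\<^sup>2) / (radius a (x, y))\<^sup>2) (at y)"
    if w: "(x, y) \<notin> {(a, 0)}" for x y
  proof -
    have r: "radius a (x, y) \<noteq> 0" using w by (simp add: radius_eq_0_iff)
    note d = has_partials_radius[unfolded has_partials_def, rule_format, OF w]
      has_partials_cosine[unfolded has_partials_def, rule_format, OF w]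
      has_partials_sine[unfolded has_partials_def, rule_format, OF w]
    show ?thesis
      by (intro conjI; rule DERIV_cong[OF DERIV_divide])
        (use d r in \<open>auto simp: field_simps power2_eq_square\<close>)
  qed
  then show "has_partials {(a, 0)} (\<lambda>w. cosine a w / radius a w)
      (\<lambda>w. ((sine a w)\<^sup>2 - (cosine a w)\<^sup>2) / (radius a w)\<^sup>2) (\<lambda>w. - 2 * cosine a w * sine a w / (radius a w)\<^sup>2)"
    "has_partials {(a, 0)} (\<lambda>w. sine a w / radius a w)
      (\<lambda>w. - 2 * cosine a w * sine a w / (radius a w)\<^sup>2) (\<lambda>w. ((cosine a w)\<^sup>2 - (sine a w)\<^sup>2) / (radius a w)\<^sup>2)"
    unfolding has_partials_def by blast+
qed

subsection \<open>The gradient field of the logarithm of the speed\<close>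

definition primaries :: "real \<Rightarrow> (real \<times> real) set" where
  "primaries \<mu> = {(- \<mu>, 0), (1 - \<mu>, 0)}"

lemma primaries_eq: "primaries \<mu> = {primary1 \<mu>, primary2 \<mu>}"
  by (simp add: primaries_def primary1_def primary2_def)

lemma finite_primaries [simp]: "finite (primaries \<mu>)"
  by (simp add: primaries_def)

lemma open_Compl_primaries: "open (- primaries \<mu>)"
  by (intro open_Compl finite_imp_closed finite_primaries)

lemma radius_pos_primaries:
  assumes "w \<notin> primaries \<mu>"
  shows "radius (- \<mu>) w > 0" "radius (1 - \<mu>) w > 0"
  using assms by (auto simp: primaries_def intro!: radius_pos)

lemma omega_radius:
  "omega \<mu> w = ((fst w)\<^sup>2 + (snd w)\<^sup>2) / 2 + (1 - \<mu>) / radius (- \<mu>) w + \<mu> / radius (1 - \<mu>) w"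
  by (cases w) (simp add: omega_def radius_def add_diff_eq diff_diff_eq2)

definition omega1 :: "real \<Rightarrow> real \<times> real \<Rightarrow> real" where
  "omega1 \<mu> w = fst w - (1 - \<mu>) * cosine (- \<mu>) w / (radius (- \<mu>) w)\<^sup>2 - \<mu> * cosine (1 - \<mu>) w / (radius (1 - \<mu>) w)\<^sup>2"

definition omega2 :: "real \<Rightarrow> real \<times> real \<Rightarrow> real" where
  "omega2 \<mu> w = snd w - (1 - \<mu>) * sine (- \<mu>) w / (radius (- \<mu>) w)\<^sup>2 - \<mu> * sine (1 - \<mu>) w / (radius (1 - \<mu>) w)\<^sup>2"

lemma has_partials_omega: "has_partials (primaries \<mu>) (omega \<mu>) (omega1 \<mu>) (omega2 \<mu>)"
  unfolding has_partials_def
proof (intro allI impI)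
  fix x y assume w: "(x, y) \<notin> primaries \<mu>"
  have r: "radius (- \<mu>) (x, y) \<noteq> 0" "radius (1 - \<mu>) (x, y) \<noteq> 0"
    using radius_pos_primaries[OF w] by auto
  have "(x, y) \<notin> {(- \<mu>, 0)}" "(x, y) \<notin> {(1 - \<mu>, 0)}" using w by (auto simp: primaries_def)
  note d = this[THEN has_partials_radius[unfolded has_partials_def, rule_format]]
  show "((\<lambda>x. omega \<mu> (x, y)) has_real_derivative omega1 \<mu> (x, y)) (at x) \<and>
    ((\<lambda>y. omega \<mu> (x, y)) has_real_derivative omega2 \<mu> (x, y)) (at y)"
    unfolding omega_radius omega1_def omega2_def
    using r d by (auto intro!: derivative_eq_intros simp: power2_eq_square)
qed

lemmas partial_omega = has_partials_imp_eq[OF has_partials_omega]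

lemma continuous_on_omega_partials:
  "continuous_on (- primaries \<mu>) (omega1 \<mu>)" "continuous_on (- primaries \<mu>) (omega2 \<mu>)"
  unfolding omega1_def[abs_def] omega2_def[abs_def]
  by (auto intro!: continuous_intros continuous_on_cosine_sine simp: radius_eq_0_iff primaries_def)

text \<open>Clearing denominators in \<open>f\<^sup>2 = 2 \<omega> - C\<close> gives the function \<open>f\<^sup>2 r\<^sub>1 r\<^sub>2\<close>, which is positive at
  the primaries.\<close>

definition reg_energy :: "real \<Rightarrow> real \<Rightarrow> real \<times> real \<Rightarrow> real" where
  "reg_energy \<mu> C w = ((fst w)\<^sup>2 + (snd w)\<^sup>2 - C) * radius (- \<mu>) w * radius (1 - \<mu>) w
     + 2 * (1 - \<mu>) * radius (1 - \<mu>) w + 2 * \<mu> * radius (- \<mu>) w"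

definition reg_energy1 :: "real \<Rightarrow> real \<Rightarrow> real \<times> real \<Rightarrow> real" where
  "reg_energy1 \<mu> C w = 2 * fst w * radius (- \<mu>) w * radius (1 - \<mu>) w
     + ((fst w)\<^sup>2 + (snd w)\<^sup>2 - C) * (cosine (- \<mu>) w * radius (1 - \<mu>) w + radius (- \<mu>) w * cosine (1 - \<mu>) w)
     + 2 * (1 - \<mu>) * cosine (1 - \<mu>) w + 2 * \<mu> * cosine (- \<mu>) w"

definition reg_energy2 :: "real \<Rightarrow> real \<Rightarrow> real \<times> real \<Rightarrow> real" where
  "reg_energy2 \<mu> C w = 2 * snd w * radius (- \<mu>) w * radius (1 - \<mu>) w
     + ((fst w)\<^sup>2 + (snd w)\<^sup>2 - C) * (sine (- \<mu>) w * radius (1 - \<mu>) w + radius (- \<mu>) w * sine (1 - \<mu>) w)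
     + 2 * (1 - \<mu>) * sine (1 - \<mu>) w + 2 * \<mu> * sine (- \<mu>) w"

lemma reg_energy_eq:
  assumes "w \<notin> primaries \<mu>"
  shows "reg_energy \<mu> C w = (2 * omega \<mu> w - C) * (radius (- \<mu>) w * radius (1 - \<mu>) w)"
  using radius_pos_primaries[OF assms] by (simp add: reg_energy_def omega_radius field_simps)

text \<open>At a primary one radius is 0 and the other 1, which leaves
  \<open>2 * (1 - \<mu>)\<close> or \<open>2 * \<mu>\<close>.\<close>

lemma reg_energy_primaries:
  assumes "0 < \<mu>" "\<mu> < 1" "w \<in> primaries \<mu>"
  shows "reg_energy \<mu> C w > 0"
  using assms by (auto simp: primaries_def reg_energy_def radius_def)

lemma continuous_on_reg_energy: "continuous_on A (reg_energy \<mu> C)"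
  unfolding reg_energy_def[abs_def] by (intro continuous_intros)

text \<open>\<open>\<nabla> ln (f\<^sup>2 r\<^sub>1 r\<^sub>2) / 2 = \<nabla> ln f + (\<nabla> ln r\<^sub>1 + \<nabla> ln r\<^sub>2) / 2\<close>\<close>

lemma reg_energy_log_gradient:
  fixes a b r s x k m V :: real
  assumes "r \<noteq> 0" "s \<noteq> 0" "V \<noteq> 0" and V: "V = k + 2 * (1 - m) / r + 2 * m / s"
  shows "(2 * x * r * s + k * (a * s + r * b) + 2 * (1 - m) * b + 2 * m * a) * inverse (2 * (V * (r * s))) =
     (x - (1 - m) * a / r\<^sup>2 - m * b / s\<^sup>2) / V + (a / r + b / s) / 2"
proof -
  have k: "k = V - 2 * (1 - m) / r - 2 * m / s" using V by simp
  show ?thesis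
    unfolding k using assms(1-3) by (simp add: field_simps power2_eq_square)
qed

lemma reg_energy_log_partials:
  assumes w: "w \<notin> primaries \<mu>" and V: "2 * omega \<mu> w - C \<noteq> 0"
  shows "reg_energy1 \<mu> C w * inverse (2 * reg_energy \<mu> C w) =
      omega1 \<mu> w / (2 * omega \<mu> w - C) + (cosine (- \<mu>) w / radius (- \<mu>) w + cosine (1 - \<mu>) w / radius (1 - \<mu>) w) / 2"
    "reg_energy2 \<mu> C w * inverse (2 * reg_energy \<mu> C w) =
      omega2 \<mu> w / (2 * omega \<mu> w - C) + (sine (- \<mu>) w / radius (- \<mu>) w + sine (1 - \<mu>) w / radius (1 - \<mu>) w) / 2"
proof -
  have "2 * omega \<mu> w - C = ((fst w)\<^sup>2 + (snd w)\<^sup>2 - C) + 2 * (1 - \<mu>) / radius (- \<mu>) w + 2 * \<mu> / radius (1 - \<mu>) w"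
    by (simp add: omega_radius field_simps)
  note * = reg_energy_log_gradient[OF _ _ V this]
  show "reg_energy1 \<mu> C w * inverse (2 * reg_energy \<mu> C w) =
      omega1 \<mu> w / (2 * omega \<mu> w - C) + (cosine (- \<mu>) w / radius (- \<mu>) w + cosine (1 - \<mu>) w / radius (1 - \<mu>) w) / 2"
    unfolding reg_energy_eq[OF w] reg_energy1_def omega1_def
    using radius_pos_primaries[OF w] by (intro *) auto
  show "reg_energy2 \<mu> C w * inverse (2 * reg_energy \<mu> C w) =
      omega2 \<mu> w / (2 * omega \<mu> w - C) + (sine (- \<mu>) w / radius (- \<mu>) w + sine (1 - \<mu>) w / radius (1 - \<mu>) w) / 2"
    unfolding reg_energy_eq[OF w] reg_energy2_def omega2_def
    using radius_pos_primaries[OF w] by (intro *) auto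
qed

text \<open>The field \<open>\<nabla> ln (f\<^sup>2 r\<^sub>1 r\<^sub>2) / 2\<close>, cut off outside the disc of radius \<open>sqrt R\<close> and with the
  denominator bounded below, so that it is defined on the whole plane. Where \<open>f\<^sup>2 r\<^sub>1 r\<^sub>2 \<ge> d\<close>
  inside the disc it is unchanged.\<close>

definition cutoff :: "real \<Rightarrow> real \<times> real \<Rightarrow> real" where
  "cutoff R w = pos2 (1 - pos2 ((fst w)\<^sup>2 + (snd w)\<^sup>2 - R))"

definition denom :: "real \<Rightarrow> real \<Rightarrow> real \<Rightarrow> real \<times> real \<Rightarrow> real" where
  "denom \<mu> C d w = reg_energy \<mu> C w + pos2 (d - reg_energy \<mu> C w) * (1 / d)"

definition field1 :: "real \<Rightarrow> real \<Rightarrow> real \<Rightarrow> real \<Rightarrow> real \<times> real \<Rightarrow> real" where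
  "field1 \<mu> C d R w = cutoff R w * (reg_energy1 \<mu> C w * inverse (2 * denom \<mu> C d w))"

definition field2 :: "real \<Rightarrow> real \<Rightarrow> real \<Rightarrow> real \<Rightarrow> real \<times> real \<Rightarrow> real" where
  "field2 \<mu> C d R w = cutoff R w * (reg_energy2 \<mu> C w * inverse (2 * denom \<mu> C d w))"

text \<open>With \<open>u = d - reg_energy \<mu> C w\<close> positive, completing the square turns
  \<open>d - u + u\<^sup>2 / d\<close> into \<open>(u - d / 2)\<^sup>2 / d + 3 * d / 4\<close>. The
  added term vanishes together with its derivative at \<open>u = 0\<close>, so the modification is
  continuously differentiable in the energy.\<close>

lemma denom_ge:
  assumes "d > 0"
  shows "denom \<mu> C d w \<ge> 3 * d / 4"
proof (cases "reg_energy \<mu> C w < d")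
  case True
  define u where "u = d - reg_energy \<mu> C w"
  have "denom \<mu> C d w = d - u + u\<^sup>2 / d"
    using True by (simp add: denom_def pos2_def u_def max_def)
  moreover have "d - u + u\<^sup>2 / d - 3 * d / 4 = (u - d / 2)\<^sup>2 / d"
    using assms by (simp add: field_simps power2_eq_square)
  moreover have "(u - d / 2)\<^sup>2 / d \<ge> 0" using assms by simp
  ultimately show ?thesis by linarith
next
  case False
  then show ?thesis using assms by (simp add: denom_def)
qed

lemma regular_off_field:
  assumes "d > 0"
  shows "regular_off (primaries \<mu>) (field1 \<mu> C d R)" "regular_off (primaries \<mu>) (field2 \<mu> C d R)"
proof -
  let ?S = "primaries \<mu>"
  have p: "(- \<mu>, 0) \<in> ?S" "(1 - \<mu>, 0) \<in> ?S" by (auto simp: primaries_def)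
  note r = p[THEN regular_off_radius[OF finite_primaries]]
  note c = p[THEN regular_off_cosine_sine(1)[OF finite_primaries]]
    and s = p[THEN regular_off_cosine_sine(2)[OF finite_primaries]]
  note reg = regular_off_mult regular_off_add regular_off_diff regular_off_power2 regular_off_pos2
    regular_off_const regular_off_fst regular_off_snd
  have e: "regular_off ?S (reg_energy \<mu> C)" "regular_off ?S (reg_energy1 \<mu> C)" "regular_off ?S (reg_energy2 \<mu> C)"
    unfolding reg_energy_def[abs_def] reg_energy1_def[abs_def] reg_energy2_def[abs_def]
    by (intro reg r c s)+
  have k: "regular_off ?S (cutoff R)"
    unfolding cutoff_def[abs_def] by (intro reg)
  have i: "regular_off ?S (\<lambda>w. inverse (2 * denom \<mu> C d w))"
  proof (rule regular_off_inverse)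
    show "regular_off ?S (\<lambda>w. 2 * denom \<mu> C d w)"
      unfolding denom_def[abs_def] by (intro reg e)
    show "d \<le> 2 * denom \<mu> C d w" for w using denom_ge[OF assms, of \<mu> C w] assms by simp
  qed (rule assms)
  show "regular_off ?S (field1 \<mu> C d R)" "regular_off ?S (field2 \<mu> C d R)"
    unfolding field1_def[abs_def] field2_def[abs_def] by (intro reg e k i)+
qed

text \<open>\<open>R\<close> is the square of a radius: the cutoff vanishes once the squared norm
  reaches \<open>R + 1\<close>. Norms above \<open>R + 2\<close> exceed 1, so their squares are
  larger still.\<close>

lemma field_support:
  assumes "norm w > R + 2" "R \<ge> 0"
  shows "field1 \<mu> C d R w = 0" "field2 \<mu> C d R w = 0"
proof -
  have "(norm w)\<^sup>2 = (fst w)\<^sup>2 + (snd w)\<^sup>2" by (simp add: norm_prod_def)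
  moreover have "(norm w)\<^sup>2 \<ge> norm w * 1"
    unfolding power2_eq_square using assms by (intro mult_left_mono) auto
  ultimately have "(fst w)\<^sup>2 + (snd w)\<^sup>2 - R \<ge> 1" using assms by linarith
  then have "pos2 ((fst w)\<^sup>2 + (snd w)\<^sup>2 - R) \<ge> 1"
    by (simp add: pos2_def max_def power2_eq_square mult_ge1_I)
  then have "cutoff R w = 0" by (simp add: cutoff_def)
  then show "field1 \<mu> C d R w = 0" "field2 \<mu> C d R w = 0" by (simp_all add: field1_def field2_def)
qed

lemma field_eq:
  assumes w: "w \<notin> primaries \<mu>" "2 * omega \<mu> w - C \<noteq> 0"
    and R: "(fst w)\<^sup>2 + (snd w)\<^sup>2 \<le> R" and d: "reg_energy \<mu> C w \<ge> d"
  shows "field1 \<mu> C d R w = omega1 \<mu> w / (2 * omega \<mu> w - C) +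
      (cosine (- \<mu>) w / radius (- \<mu>) w + cosine (1 - \<mu>) w / radius (1 - \<mu>) w) / 2"
    "field2 \<mu> C d R w = omega2 \<mu> w / (2 * omega \<mu> w - C) +
      (sine (- \<mu>) w / radius (- \<mu>) w + sine (1 - \<mu>) w / radius (1 - \<mu>) w) / 2"
proof -
  have "cutoff R w = 1" using R by (simp add: cutoff_def) (simp add: pos2_def)
  moreover have "denom \<mu> C d w = reg_energy \<mu> C w" using d by (simp add: denom_def)
  ultimately show "field1 \<mu> C d R w = omega1 \<mu> w / (2 * omega \<mu> w - C) +
      (cosine (- \<mu>) w / radius (- \<mu>) w + cosine (1 - \<mu>) w / radius (1 - \<mu>) w) / 2"
    "field2 \<mu> C d R w = omega2 \<mu> w / (2 * omega \<mu> w - C) +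
      (sine (- \<mu>) w / radius (- \<mu>) w + sine (1 - \<mu>) w / radius (1 - \<mu>) w) / 2"
    by (simp_all only: field1_def field2_def reg_energy_log_partials[OF w] mult_1)
qed

lemma partial_ln_speed:
  assumes w: "w \<notin> primaries \<mu>" "2 * omega \<mu> w - C > 0"
  shows "partial1 (\<lambda>p. ln (speed \<mu> C p)) w = omega1 \<mu> w / (2 * omega \<mu> w - C)"
    "partial2 (\<lambda>p. ln (speed \<mu> C p)) w = omega2 \<mu> w / (2 * omega \<mu> w - C)"
proof -
  obtain x y where xy: "w = (x, y)" by force
  have pos: "2 * omega \<mu> (x, y) - C > 0" using w(2) xy by simp
  have d: "((\<lambda>x. omega \<mu> (x, y)) has_real_derivative omega1 \<mu> (x, y)) (at x)"
    "((\<lambda>y. omega \<mu> (x, y)) has_real_derivative omega2 \<mu> (x, y)) (at y)"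
    using has_partials_omega[of \<mu>] w(1) by (auto simp: has_partials_def xy)
  have "((\<lambda>x. ln (sqrt (2 * omega \<mu> (x, y) - C))) has_real_derivative omega1 \<mu> (x, y) / (2 * omega \<mu> (x, y) - C)) (at x)"
    using pos d by (auto intro!: derivative_eq_intros simp: field_simps)
  moreover have "((\<lambda>y. ln (sqrt (2 * omega \<mu> (x, y) - C))) has_real_derivative omega2 \<mu> (x, y) / (2 * omega \<mu> (x, y) - C)) (at y)"
    using pos d by (auto intro!: derivative_eq_intros simp: field_simps)
  ultimately show "partial1 (\<lambda>p. ln (speed \<mu> C p)) w = omega1 \<mu> w / (2 * omega \<mu> w - C)"
    "partial2 (\<lambda>p. ln (speed \<mu> C p)) w = omega2 \<mu> w / (2 * omega \<mu> w - C)"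
    by (auto simp: xy partial1_def partial2_def speed_def intro: DERIV_imp_deriv)
qed

text \<open>On a whole neighbourhood the gradient of ln f is the field minus half the gradients of
  the two \<open>ln (radius a)\<close>, so it may be differentiated once more. The subtracted
  gradients are divergence free, because those logarithms are harmonic.\<close>

lemma laplacian_ln_speed:
  assumes N: "open N" "w \<in> N" and d: "d > 0"
    and good: "\<And>v. v \<in> N \<Longrightarrow> v \<notin> primaries \<mu> \<and> 2 * omega \<mu> v - C > 0 \<and>
        (fst v)\<^sup>2 + (snd v)\<^sup>2 \<le> R \<and> reg_energy \<mu> C v \<ge> d"
  shows "laplacian (\<lambda>p. ln (speed \<mu> C p)) w = partial1 (field1 \<mu> C d R) w + partial2 (field2 \<mu> C d R) w"
proof -
  let ?S = "primaries \<mu>"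
  have wS: "w \<notin> ?S" using good N(2) by blast
  have F: "has_partials ?S (field1 \<mu> C d R) (partial1 (field1 \<mu> C d R)) (partial2 (field1 \<mu> C d R))"
    "has_partials ?S (field2 \<mu> C d R) (partial1 (field2 \<mu> C d R)) (partial2 (field2 \<mu> C d R))"
    using regular_off_field[OF d] by (auto intro: regular_off_partial)
  have sub: "{(- \<mu>, 0)} \<subseteq> ?S" "{(1 - \<mu>, 0)} \<subseteq> ?S" by (auto simp: primaries_def)
  note q = sub[THEN has_partials_mono[OF has_partials_ln_radius_gradient(1)]]
    sub[THEN has_partials_mono[OF has_partials_ln_radius_gradient(2)]]
  have comb: "has_partials ?S (\<lambda>w. f w - (g w + h w) / 2) (\<lambda>w. fx w - (gx w + hx w) / 2) (\<lambda>w. fy w - (gy w + hy w) / 2)"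
    if "has_partials ?S f fx fy" "has_partials ?S g gx gy" "has_partials ?S h hx hy" for f fx fy g gx gy h hx hy
    using that by (auto simp: has_partials_def intro!: derivative_eq_intros)
  have eq: "partial1 (\<lambda>p. ln (speed \<mu> C p)) v = field1 \<mu> C d R v -
      (cosine (- \<mu>) v / radius (- \<mu>) v + cosine (1 - \<mu>) v / radius (1 - \<mu>) v) / 2"
    "partial2 (\<lambda>p. ln (speed \<mu> C p)) v = field2 \<mu> C d R v -
      (sine (- \<mu>) v / radius (- \<mu>) v + sine (1 - \<mu>) v / radius (1 - \<mu>) v) / 2" if "v \<in> N" for v
    using partial_ln_speed[of v \<mu> C] field_eq[of v \<mu> C R d] good[OF that] by simp_all
  have "partial1 (partial1 (\<lambda>p. ln (speed \<mu> C p))) w = partial1 (field1 \<mu> C d R) w -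
      (((sine (- \<mu>) w)\<^sup>2 - (cosine (- \<mu>) w)\<^sup>2) / (radius (- \<mu>) w)\<^sup>2 +
       ((sine (1 - \<mu>) w)\<^sup>2 - (cosine (1 - \<mu>) w)\<^sup>2) / (radius (1 - \<mu>) w)\<^sup>2) / 2"
    by (rule has_partials_local(1)[OF comb[OF F(1) q(1,2)] N wS]) (rule eq)
  moreover have "partial2 (partial2 (\<lambda>p. ln (speed \<mu> C p))) w = partial2 (field2 \<mu> C d R) w -
      (((cosine (- \<mu>) w)\<^sup>2 - (sine (- \<mu>) w)\<^sup>2) / (radius (- \<mu>) w)\<^sup>2 +
       ((cosine (1 - \<mu>) w)\<^sup>2 - (sine (1 - \<mu>) w)\<^sup>2) / (radius (1 - \<mu>) w)\<^sup>2) / 2"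
    by (rule has_partials_local(2)[OF comb[OF F(2) q(3,4)] N wS]) (rule eq)
  moreover have "((cosine a w)\<^sup>2 - (sine a w)\<^sup>2) / (radius a w)\<^sup>2 = - (((sine a w)\<^sup>2 - (cosine a w)\<^sup>2) / (radius a w)\<^sup>2)" for a
    by (simp add: minus_divide_left)
  ultimately show ?thesis
    by (simp only: laplacian_def)
      (simp only: minus_add_distrib[symmetric] minus_divide_left[symmetric] diff_minus_eq_add
        diff_add_cancel add_diff_eq add_diff_cancel diff_add_eq)
qed

subsection \<open>Periodic orbits\<close>

lemma has_vector_derivative_Complex:
  assumes "(f has_real_derivative f') (at t)" "(g has_real_derivative g') (at t)"
  shows "((\<lambda>t. Complex (f t) (g t)) has_vector_derivative Complex f' g') (at t)"
proof -
  have "((\<lambda>t. complex_of_real (f t) + \<i> * complex_of_real (g t)) has_vector_derivative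
      complex_of_real f' + \<i> * complex_of_real g') (at t)"
    using assms by (intro has_vector_derivative_add has_vector_derivative_mult_right has_vector_derivative_of_real)
  then show ?thesis by (simp add: Complex_eq)
qed

text \<open>The outside consists of the points whose component in the complement is unbounded; the
  isometry maps such a component to an unbounded connected set avoiding the image.\<close>

lemma outside_image_cpx:
  assumes "w \<in> outside A"
  shows "cpx w \<in> outside (cpx ` A)"
proof -
  let ?K = "connected_component_set (- A) w"
  have "w \<notin> A" and unb: "\<not> bounded ?K" using assms by (auto simp: outside_def)
  have "cpx ` ?K \<subseteq> connected_component_set (- (cpx ` A)) (cpx w)"
  proof (rule connected_component_maximal)
    show "cpx w \<in> cpx ` ?K" using \<open>w \<notin> A\<close> by (intro imageI) (simp add: connected_component_refl)
    show "connected (cpx ` ?K)" by (intro connected_continuous_image continuous_intros connected_connected_component)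
    show "cpx ` ?K \<subseteq> - (cpx ` A)" using connected_component_subset[of "- A" w] by auto
  qed
  moreover have "\<not> bounded (cpx ` ?K)"
    using unb by (simp add: bounded_iff)
  ultimately have "\<not> bounded (connected_component_set (- (cpx ` A)) (cpx w))"
    using bounded_subset by blast
  then show ?thesis using \<open>w \<notin> A\<close> by (auto simp: outside_def)
qed

text \<open>\<open>1 / u\<close> is the conjugate of the gradient of \<open>ln (norm u)\<close>.
  Hence the flux of that gradient through a curve is the imaginary part of its winding number
  integral.\<close>

lemma cosine_sine_inverse:
  assumes "w \<noteq> (a, 0)"
  shows "Complex (cosine a w / radius a w) (- (sine a w / radius a w)) = 1 / (cpx w - of_real a)"
proof -
  have r: "radius a w > 0" using assms by (rule radius_pos)
  have u: "cpx w - of_real a = Complex (fst w - a) (snd w)" by (simp add: complex_eq_iff)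
  show ?thesis
    unfolding u inverse_eq_divide[symmetric]
    using r radius_power2[of a w] by (simp add: complex_eq_iff cosine_def sine_def power2_eq_square)
qed

text \<open>All four cases at once. On the right, \<open>- 2 * pi * n\<close> is the total turning
  of the velocity, \<open>- 2 * T\<close> comes from the Coriolis terms, and each enclosed primary
  adds the flux \<open>pi * n\<close> of half the logarithm of its distance.\<close>

lemma rtbp_orbit_integral:
  fixes \<mu> C T n :: real and y1 y2 :: "real \<Rightarrow> real" and \<alpha> :: "real \<Rightarrow> real \<times> real"
  assumes mu: "0 < \<mu>" "\<mu> < 1"
    and alpha: "\<And>t. \<alpha> t = (y1 t, y2 t)"
    and solution: "pcrtbp_solution \<mu> y1 y2"
    and jacobian: "has_jacobian_integral \<mu> C y1 y2"
    and periodic: "0 < T" "\<And>t. \<alpha> (t + T) = \<alpha> t"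
    and regular: "\<And>t. norm (deriv y1 t, deriv y2 t) \<noteq> 0"
    and simple: "inj_on \<alpha> {0..<T}"
    and Omega: "\<Omega> = enclosed_region \<alpha>"
    and ln_f_defined: "\<And>p. p \<in> \<Omega> - {primary1 \<mu>, primary2 \<mu>} \<Longrightarrow> speed \<mu> C p \<noteq> 0"
    and sub: "\<Omega> \<subseteq> U \<mu> C \<union> {primary1 \<mu>, primary2 \<mu>}"
    and n: "n = 1 \<or> n = -1" "\<And>w. w \<in> \<Omega> \<Longrightarrow> winding_number (complex_loop \<alpha> T) (cpx w) = of_real n"
  shows "ln_f_lap_integrable \<mu> C \<Omega>"
    "n * ln_f_lap_integral \<mu> C \<Omega> = - 2 * pi * n - 2 * T +
       pi * ((if primary1 \<mu> \<in> \<Omega> then n else 0) + (if primary2 \<mu> \<in> \<Omega> then n else 0))"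
proof -
  let ?S = "primaries \<mu>"
  let ?V = "\<lambda>w. 2 * omega \<mu> w - C"
  define v1 v2 where "v1 = deriv y1" and "v2 = deriv y2"
  have not_S: "\<alpha> t \<notin> ?S" for t
    using solution by (simp add: pcrtbp_solution_def alpha primaries_eq)
  have y: "(y1 has_real_derivative v1 t) (at t)" "(y2 has_real_derivative v2 t) (at t)" for t
    using solution by (auto simp: pcrtbp_solution_def v1_def v2_def)
  have v: "(v1 has_real_derivative omega1 \<mu> (\<alpha> t) + 2 * v2 t) (at t)"
    "(v2 has_real_derivative omega2 \<mu> (\<alpha> t) - 2 * v1 t) (at t)" for t
    using solution partial_omega[OF not_S] by (auto simp: pcrtbp_solution_def v1_def v2_def alpha)
  have energy: "?V (\<alpha> t) = (v1 t)\<^sup>2 + (v2 t)\<^sup>2" for t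
    using jacobian by (simp add: has_jacobian_integral_def v1_def v2_def alpha algebra_simps)
  have speed_pos: "(v1 t)\<^sup>2 + (v2 t)\<^sup>2 > 0" for t
    using regular[of t] by (simp add: v1_def v2_def zero_prod_def sum_power2_gt_zero_iff)
  define c where "c = complex_loop \<alpha> T"
  define c' where "c' s = of_real T * Complex (v1 (T * s)) (v2 (T * s))" for s
  define c'' where "c'' s = (of_real T)\<^sup>2 * Complex (omega1 \<mu> (\<alpha> (T * s)) + 2 * v2 (T * s))
      (omega2 \<mu> (\<alpha> (T * s)) - 2 * v1 (T * s))" for s
  have c_eq: "c s = Complex (y1 (T * s)) (y2 (T * s))" for s
    by (simp add: c_def complex_loop_def alpha)
  have cpx_alpha: "cpx (\<alpha> (T * s)) = c s" for s
    by (simp add: c_eq alpha complex_eq_iff)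
  have sc: "((\<lambda>s. T * s) has_vector_derivative T) (at s)" for s
    by (auto intro!: derivative_eq_intros)
  have dc: "(c has_vector_derivative c' s) (at s)" for s
    using vector_diff_chain_at[OF sc has_vector_derivative_Complex[OF y]]
    by (simp add: o_def c_eq[abs_def] c'_def scaleR_conv_of_real)
  have dc': "(c' has_vector_derivative c'' s) (at s)" for s
    using has_vector_derivative_mult_right[OF vector_diff_chain_at[OF sc has_vector_derivative_Complex[OF v]], of "of_real T"]
    by (simp add: o_def c'_def[abs_def] c''_def scaleR_conv_of_real power2_eq_square mult.assoc)
  have cont_v: "continuous_on UNIV (\<lambda>s. v1 (T * s))" "continuous_on UNIV (\<lambda>s. v2 (T * s))"
  proof -
    have cv: "continuous_on UNIV v1" "continuous_on UNIV v2"
      using v by (auto intro!: continuous_at_imp_continuous_on DERIV_isCont)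
    show "continuous_on UNIV (\<lambda>s. v1 (T * s))" "continuous_on UNIV (\<lambda>s. v2 (T * s))"
      by (rule continuous_on_compose2[OF cv(1)] continuous_on_compose2[OF cv(2)]; auto intro!: continuous_intros)+
  qed
  have cont_y: "continuous_on UNIV y1" "continuous_on UNIV y2"
    using y by (auto intro!: continuous_at_imp_continuous_on DERIV_isCont)
  then have cont_alpha: "continuous_on UNIV \<alpha>"
    by (simp add: alpha[abs_def] continuous_on_Pair)
  have cont_alpha': "continuous_on UNIV (\<lambda>s. \<alpha> (T * s))"
    by (rule continuous_on_compose2[OF cont_alpha]) (auto intro!: continuous_intros)
  have im_alpha: "(\<lambda>s. \<alpha> (T * s)) ` UNIV \<subseteq> - ?S" using not_S by auto
  have cont_c': "continuous_on UNIV c'"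
    using dc' by (auto intro!: continuous_at_imp_continuous_on has_vector_derivative_continuous)
  have cont_omega: "continuous_on UNIV (\<lambda>s. omega1 \<mu> (\<alpha> (T * s)))" "continuous_on UNIV (\<lambda>s. omega2 \<mu> (\<alpha> (T * s)))"
    by (intro continuous_on_compose2[OF continuous_on_omega_partials(1) cont_alpha' im_alpha]
      continuous_on_compose2[OF continuous_on_omega_partials(2) cont_alpha' im_alpha])+
  have cont_c'': "continuous_on UNIV c''"
    unfolding c''_def[abs_def] Complex_eq by (intro continuous_intros cont_omega cont_v)
  have period: "c (s + 1) = c s" for s
    using periodic(2)[of "T * s"] by (simp add: cpx_alpha[symmetric] distrib_left)
  interpret regular_loop c c'
  proof
    show "c' s \<noteq> 0" for s
      using speed_pos[of "T * s"] periodic(1) by (auto simp: c'_def complex_eq_iff)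
    show "inj_on c {0..<1}"
    proof (rule inj_onI)
      fix s t :: real assume st: "s \<in> {0..<1}" "t \<in> {0..<1}" and "c s = c t"
      then have "\<alpha> (T * s) = \<alpha> (T * t)" by (simp flip: cpx_alpha)
      then have "T * s = T * t" using st periodic(1) by (intro inj_onD[OF simple]) auto
      then show "s = t" using periodic(1) by simp
    qed
  qed (use dc cont_c' period in auto)
  have c_image: "c ` {0..1} = cpx ` range \<alpha>"
  proof (intro equalityI subsetI)
    fix z assume "z \<in> cpx ` range \<alpha>"
    then obtain t where z: "z = cpx (\<alpha> t)" by blast
    have "z = c (t / T)" using periodic(1) by (simp add: z flip: cpx_alpha)
    also have "\<dots> = c (frac (t / T))"
      using period_int[of "t / T" "- \<lfloor>t / T\<rfloor>"] by (simp add: frac_def)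
    finally show "z \<in> c ` {0..1}" by (auto simp: frac_lt_1 less_imp_le)
  qed (auto simp flip: cpx_alpha)
  have c_path: "path_image c = cpx ` range \<alpha>" by (simp add: path_image_def c_image)
  have range_image: "range \<alpha> = (\<lambda>z. (Re z, Im z)) ` c ` {0..1}"
    unfolding c_image image_image by simp
  have cmp: "compact (range \<alpha>)"
    unfolding range_image by (intro compact_continuous_image continuous_intros cont) auto
  have inside: "\<Omega> = inside (range \<alpha>)" by (simp add: Omega enclosed_region_def)
  interpret enclosing_loop c c' \<Omega> n
  proof
    show "open \<Omega>" unfolding inside by (intro open_inside compact_imp_closed cmp)
    show "cpx w \<notin> c ` {0..1} \<and> winding_number c (cpx w) = of_real n" if "w \<in> \<Omega>" for w
    proof -
      have "w \<notin> range \<alpha>" using that inside_no_overlap[of "range \<alpha>"] unfolding inside by blast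
      then have "cpx w \<notin> c ` {0..1}" unfolding c_image by auto
      then show ?thesis using n(2)[OF that] by (simp add: c_def)
    qed
    show "winding_number c (cpx w) = 0" if "w \<notin> \<Omega>" "cpx w \<notin> c ` {0..1}" for w
    proof (rule winding_number_zero_in_outside)
      have "w \<in> outside (range \<alpha>)"
      \<comment> \<open>Off the curve, a point that is not inside is outside.\<close>
      proof -
        have "w \<notin> range \<alpha>" using that(2) unfolding c_image by blast
        then show ?thesis using that(1) inside_Un_outside[of "range \<alpha>"] unfolding inside by blast
      qed
      then show "cpx w \<in> outside (path_image c)"
        unfolding c_path by (rule outside_image_cpx)
      show "path c" unfolding path_def by (rule cont)
      show "pathfinish c = pathstart c" using period[of 0] by (simp add: pathfinish_def pathstart_def)
    qed
  qed (rule n(1))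
  have pt_eq: "pt s = \<alpha> (T * s)" for s by (simp add: pt_def alpha c_eq)
  \<comment> \<open>The closed region. It is compact, as the bounded complement of the open
    outside.\<close>
  define K where "K = \<Omega> \<union> range \<alpha>"
  have "bounded K"
    unfolding K_def inside using compact_imp_bounded[OF cmp] by (simp add: bounded_inside)
  moreover have "closed K"
  proof -
    have "K = - outside (range \<alpha>)"
      unfolding K_def inside using union_with_inside[of "range \<alpha>"] by (simp add: Un_commute)
    then show ?thesis using open_outside[OF compact_imp_closed[OF cmp]] by (simp add: closed_open)
  qed
  ultimately have "compact K" by (simp add: compact_eq_bounded_closed)
  \<comment> \<open>Membership in \<open>U\<close> gives only a weak inequality; definedness of ln f
    makes it strict.\<close>
  have V_pos: "?V w > 0" if "w \<in> \<Omega> - ?S" for w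
  proof -
    have "?V w \<ge> 0" using sub that by (auto simp: U_def primaries_eq)
    moreover have "?V w \<noteq> 0"
      using ln_f_defined[of w] that by (auto simp: speed_def primaries_eq)
    ultimately show ?thesis by simp
  qed
  have K_pos: "reg_energy \<mu> C w > 0" if "w \<in> K" for w
  proof (cases "w \<in> ?S")
    case True
    then show ?thesis using reg_energy_primaries mu by blast
  next
    case False
    \<comment> \<open>On the orbit itself \<open>f\<close> is the speed, so regularity gives
      positivity.\<close>
    have "?V (\<alpha> t) > 0" for t unfolding energy by (rule speed_pos)
    then have "?V w > 0"
      using that V_pos[of w] False unfolding K_def by blast
    then show ?thesis
      using radius_pos_primaries[OF False] by (simp add: reg_energy_eq[OF False])
  qed
  have "K \<noteq> {}" by (auto simp: K_def)
  then obtain w0 where w0: "w0 \<in> K" "\<And>w. w \<in> K \<Longrightarrow> reg_energy \<mu> C w0 \<le> reg_energy \<mu> C w"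
    using continuous_attains_inf[OF \<open>compact K\<close> _ continuous_on_reg_energy] by blast
  \<comment> \<open>The minimum over the closed region: with this threshold the modified denominator
    agrees with the original one on all of \<open>K\<close>.\<close>
  define d where "d = reg_energy \<mu> C w0"
  have d: "d > 0" "\<And>w. w \<in> K \<Longrightarrow> d \<le> reg_energy \<mu> C w"
    using w0 K_pos by (auto simp: d_def)
  obtain B where B: "B > 0" "\<And>w. w \<in> K \<Longrightarrow> norm w \<le> B"
    using \<open>bounded K\<close> unfolding bounded_pos by blast
  define R where "R = B\<^sup>2"
  have R: "R \<ge> 0" "\<And>w. w \<in> K \<Longrightarrow> (fst w)\<^sup>2 + (snd w)\<^sup>2 \<le> R"
  proof -
    show "R \<ge> 0" by (simp add: R_def)
    fix w assume "w \<in> K"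
    then have "(norm w)\<^sup>2 \<le> B\<^sup>2" using B by (intro power_mono) auto
    then show "(fst w)\<^sup>2 + (snd w)\<^sup>2 \<le> R" by (simp add: R_def norm_prod_def)
  qed
  let ?F1 = "field1 \<mu> C d R" and ?F2 = "field2 \<mu> C d R"
  let ?L = "laplacian (\<lambda>p. ln (speed \<mu> C p))"
  note reg = regular_off_field[OF d(1)]
  have avoid: "pt s \<notin> ?S" for s using not_S by (simp add: pt_eq)
  note g1 = green[OF finite_primaries avoid reg(1) field_support(1)[OF _ R(1)]]
    and g2 = green[OF finite_primaries avoid reg(2) field_support(2)[OF _ R(1)]]
  have open_diff: "open (\<Omega> - ?S)"
    using open_region open_Compl_primaries by (simp add: Diff_eq open_Int)
  have lap: "?L w = partial1 ?F1 w + partial2 ?F2 w" if "w \<in> \<Omega> - ?S" for w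
  proof (rule laplacian_ln_speed[OF _ that d(1)])
    show "open (\<Omega> - ?S)" by (rule open_diff)
    show "u \<notin> ?S \<and> ?V u > 0 \<and> (fst u)\<^sup>2 + (snd u)\<^sup>2 \<le> R \<and> reg_energy \<mu> C u \<ge> d" if "u \<in> \<Omega> - ?S" for u
      using that V_pos[OF that] R(2)[of u] d(2)[of u] by (simp add: K_def)
  qed
  have int: "set_integrable lborel \<Omega> (\<lambda>w. partial1 ?F1 w + partial2 ?F2 w)"
    using g1(1) g2(2) by (rule set_integral_add)
  have "set_integrable lborel (\<Omega> - ?S) (\<lambda>w. partial1 ?F1 w + partial2 ?F2 w)"
    using int by (rule set_integrable_subset) (auto intro!: borel_open open_diff)
  moreover have "set_integrable lborel (\<Omega> - ?S) ?L \<longleftrightarrow>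
      set_integrable lborel (\<Omega> - ?S) (\<lambda>w. partial1 ?F1 w + partial2 ?F2 w)"
    by (rule set_integrable_cong[OF refl refl lap])
  ultimately have int': "set_integrable lborel (\<Omega> - ?S) ?L" by blast
  then show "ln_f_lap_integrable \<mu> C \<Omega>"
    by (simp add: ln_f_lap_integrable_def primaries_eq)
  have I: "ln_f_lap_integral \<mu> C \<Omega> = (LINT w:\<Omega>|lborel. partial1 ?F1 w) + (LINT w:\<Omega>|lborel. partial2 ?F2 w)"
  proof -
    \<comment> \<open>The primaries form a null set, so integrals over the punctured and the full
      region agree.\<close>
    have "AE w in lborel. w \<notin> ?S"
      by (intro AE_lborel_closed_negligible negligible_finite finite_imp_closed finite_primaries)
    then have "AE w in lborel. indicator (\<Omega> - ?S) w *\<^sub>R ?L w = indicator \<Omega> w *\<^sub>R (partial1 ?F1 w + partial2 ?F2 w)"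
      by eventually_elim (use lap in \<open>auto simp: indicator_def\<close>)
    then have "(LINT w:\<Omega> - ?S|lborel. ?L w) = (LINT w:\<Omega>|lborel. partial1 ?F1 w + partial2 ?F2 w)"
      unfolding set_lebesgue_integral_def using int int' unfolding set_integrable_def
      by (intro Bochner_Integration.integral_cong_AE) auto
    also have "\<dots> = (LINT w:\<Omega>|lborel. partial1 ?F1 w) + (LINT w:\<Omega>|lborel. partial2 ?F2 w)"
      using g1(1) g2(2) by (rule set_integral_add)
    finally show ?thesis by (simp add: ln_f_lap_integral_def primaries_eq)
  qed
  let ?f = "\<lambda>s. ?F1 (pt s) * Im (c' s) - ?F2 (pt s) * Re (c' s)"
  let ?w = "\<lambda>a s. c' s / (c s - of_real a)"
  have contF: "continuous_on {0..1} (\<lambda>s. ?F1 (pt s))" "continuous_on {0..1} (\<lambda>s. ?F2 (pt s))"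
    using avoid by (auto intro!: continuous_on_compose2[OF regular_off_partial(2)[OF reg(1)] continuous_on_pt]
      continuous_on_compose2[OF regular_off_partial(2)[OF reg(2)] continuous_on_pt])
  have i1: "(\<lambda>s. ?F1 (pt s) * Im (c' s)) integrable_on {0..1}" "(\<lambda>s. ?F2 (pt s) * Re (c' s)) integrable_on {0..1}"
    by (intro integrable_continuous_interval continuous_intros contF deriv_cont')+
  have nI: "integral {0..1} ?f = n * ln_f_lap_integral \<mu> C \<Omega>"
    using Henstock_Kurzweil_Integration.integral_diff[OF i1] g1(3) g2(4) by (simp add: I distrib_left)
  have cont_q: "continuous_on {0..1} (\<lambda>s. c'' s / c' s)"
    using regular_loop.regular[OF regular_loop_axioms]
    by (intro continuous_intros deriv_cont' continuous_on_subset[OF cont_c'']) auto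
  have c_ne: "c s \<noteq> of_real a" if "(a, 0) \<in> ?S" for a s
  proof
    assume "c s = of_real a"
    then have "cpx (\<alpha> (T * s)) = cpx (a, 0)" by (simp add: cpx_alpha complex_eq_iff)
    then have "\<alpha> (T * s) = (a, 0)" by simp
    then show False using not_S[of "T * s"] that by metis
  qed
  have cont_w: "continuous_on {0..1} (?w a)" if "(a, 0) \<in> ?S" for a
    using c_ne[OF that] by (intro continuous_intros deriv_cont' cont) auto
  \<comment> \<open>A primary off the curve is inside or outside it, so its winding number is
    \<open>n\<close> or 0.\<close>
  have wind: "integral {0..1} (?w a) = 2 * pi * \<i> * of_real (if (a, 0) \<in> \<Omega> then n else 0)" if "(a, 0) \<in> ?S" for a
  proof -
    have cpxa: "complex_of_real a = cpx (a, 0)" by (simp add: complex_eq_iff)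
    have "cpx (a, 0) \<notin> c ` {0..1}" using c_ne[OF that] unfolding cpxa by (metis imageE)
    then show ?thesis
      using winding_number_integral[OF dc cont_c'] inner[of "(a, 0)"] outer[of "(a, 0)"] unfolding cpxa by auto
  qed
  have S: "(- \<mu>, 0) \<in> ?S" "(1 - \<mu>, 0) \<in> ?S" by (auto simp: primaries_def)
  \<comment> \<open>The equation for the angular velocity of the velocity vector, with
    \<open>Im (c'' / c')\<close> as the derivative of its argument. Rescaling time to period 1
    multiplies everything by \<open>T\<close>.\<close>
  have pointwise: "?f s = Im (?w (- \<mu>) s) / 2 + Im (?w (1 - \<mu>) s) / 2 - Im (c'' s / c' s) - 2 * T" for s
  proof -
    define w where "w = \<alpha> (T * s)"
    define V where "V = ?V w"
    define a b where "a = v1 (T * s)" and "b = v2 (T * s)"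
    have V: "V = a\<^sup>2 + b\<^sup>2" "V > 0"
      using energy[of "T * s"] speed_pos[of "T * s"] by (simp_all add: V_def w_def a_def b_def)
    have wK: "w \<in> K" by (simp add: K_def w_def)
    have wS: "w \<notin> ?S" using not_S by (simp add: w_def)
    have F: "?F1 w = omega1 \<mu> w / V + (cosine (- \<mu>) w / radius (- \<mu>) w + cosine (1 - \<mu>) w / radius (1 - \<mu>) w) / 2"
      "?F2 w = omega2 \<mu> w / V + (sine (- \<mu>) w / radius (- \<mu>) w + sine (1 - \<mu>) w / radius (1 - \<mu>) w) / 2"
      using field_eq[OF wS _ R(2)[OF wK] d(2)[OF wK]] V by (simp_all add: V_def)
    have c': "c' s = of_real T * Complex a b" by (simp add: c'_def a_def b_def)
    have wi: "Im (?w p s) = T * (b * (cosine p w / radius p w) - a * (sine p w / radius p w))" if "(p, 0) \<in> ?S" for p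
    proof -
      have "w \<noteq> (p, 0)" using wS that by auto
      then have "1 / (c s - of_real p) = Complex (cosine p w / radius p w) (- (sine p w / radius p w))"
        by (simp add: cosine_sine_inverse w_def flip: cpx_alpha)
      then have "?w p s = c' s * Complex (cosine p w / radius p w) (- (sine p w / radius p w))"
        by (metis times_divide_eq_right mult.right_neutral)
      then show ?thesis unfolding c' by (simp add: algebra_simps)
    qed
    have q: "Im (c'' s / c' s) = T * ((a * (omega2 \<mu> w - 2 * a) - b * (omega1 \<mu> w + 2 * b)) / V)"
    proof -
      have "c'' s / c' s = of_real T * (Complex (omega1 \<mu> w + 2 * b) (omega2 \<mu> w - 2 * a) / Complex a b)"
        using periodic(1) unfolding c' by (simp add: c''_def w_def a_def b_def power2_eq_square)
      moreover have "Im (Complex (omega1 \<mu> w + 2 * b) (omega2 \<mu> w - 2 * a) / Complex a b) =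
          (a * (omega2 \<mu> w - 2 * a) - b * (omega1 \<mu> w + 2 * b)) / V"
        using V by (simp add: Im_divide algebra_simps)
      moreover have "Im (of_real T * z) = T * Im z" for z
        by simp
      ultimately show ?thesis by (simp only:)
    qed
    have "a * (omega2 \<mu> w - 2 * a) - b * (omega1 \<mu> w + 2 * b) = (a * omega2 \<mu> w - b * omega1 \<mu> w) - 2 * V"
      unfolding V(1) by (simp add: algebra_simps power2_eq_square)
    then have e: "(a * (omega2 \<mu> w - 2 * a) - b * (omega1 \<mu> w + 2 * b)) / V = (a * omega2 \<mu> w - b * omega1 \<mu> w) / V - 2"
      using V(2) by (simp only: diff_divide_distrib) simp
    have q': "Im (c'' s / c' s) = T * ((a * omega2 \<mu> w - b * omega1 \<mu> w) / V) - 2 * T"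
      unfolding q e by (simp add: right_diff_distrib)
    have "?f s = ?F1 w * (T * b) - ?F2 w * (T * a)"
      by (simp add: pt_eq w_def c')
    also have "\<dots> = T * ((b * omega1 \<mu> w - a * omega2 \<mu> w) / V) +
        Im (?w (- \<mu>) s) / 2 + Im (?w (1 - \<mu>) s) / 2"
      unfolding F wi[OF S(1)] wi[OF S(2)] using V(2) by (simp add: field_simps)
    also have "(b * omega1 \<mu> w - a * omega2 \<mu> w) / V = - ((a * omega2 \<mu> w - b * omega1 \<mu> w) / V)"
      by (simp add: minus_divide_left)
    finally show ?thesis using q' by simp
  qed
  have Im_int: "((\<lambda>s. Im (g s)) has_integral Im (integral {0..1} g)) {0..1}" if "continuous_on {0..1} g" for g :: "real \<Rightarrow> complex"
    using has_integral_linear[OF integrable_integral[OF integrable_continuous_interval[OF that]] bounded_linear_Im]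
    by (simp add: o_def)
  have "(?f has_integral
     pi * (if (- \<mu>, 0) \<in> \<Omega> then n else 0) + pi * (if (1 - \<mu>, 0) \<in> \<Omega> then n else 0) - 2 * pi * n - 2 * T) {0..1}"
  proof -
    have "((\<lambda>s. Im (?w (- \<mu>) s) / 2 + Im (?w (1 - \<mu>) s) / 2 - Im (c'' s / c' s) - 2 * T) has_integral
      Im (integral {0..1} (?w (- \<mu>))) / 2 + Im (integral {0..1} (?w (1 - \<mu>))) / 2 -
      Im (integral {0..1} (\<lambda>s. c'' s / c' s)) - 2 * T) {0..1}"
      using has_integral_const_real[of "2 * T" 0 1]
      by (intro has_integral_diff has_integral_add has_integral_divide Im_int cont_w cont_q S) simp
    then show ?thesis
      unfolding pointwise[symmetric] wind[OF S(1)] wind[OF S(2)] umlaufsatz[OF dc' cont_c''] by simp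
  qed
  from integral_unique[OF this] nI
  show "n * ln_f_lap_integral \<mu> C \<Omega> = - 2 * pi * n - 2 * T +
       pi * ((if primary1 \<mu> \<in> \<Omega> then n else 0) + (if primary2 \<mu> \<in> \<Omega> then n else 0))"
    by (simp add: primary1_def primary2_def algebra_simps)
qed

theorem theorem2p5:
  fixes \<mu> C T :: real
    and y1 y2 :: "real \<Rightarrow> real"
    and \<alpha> :: "real \<Rightarrow> real \<times> real"
    and \<Omega> :: "(real \<times> real) set"
  assumes mu: "0 < \<mu>" "\<mu> \<le> 1 / 2"
    and alpha: "\<And>t. \<alpha> t = (y1 t, y2 t)"
    and solution: "pcrtbp_solution \<mu> y1 y2"
    and jacobian: "has_jacobian_integral \<mu> C y1 y2"
    and periodic: "0 < T" "\<And>t. \<alpha> (t + T) = \<alpha> t"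
    and regular: "\<And>t. norm (deriv y1 t, deriv y2 t) \<noteq> 0"
    and simple: "inj_on \<alpha> {0..<T}"
    and Omega: "\<Omega> = enclosed_region \<alpha>"
    and ln_f_defined: "\<And>p. p \<in> \<Omega> - {primary1 \<mu>, primary2 \<mu>} \<Longrightarrow> speed \<mu> C p \<noteq> 0"
  shows
    "(primary2 \<mu> \<in> \<Omega> \<and> \<Omega> \<subseteq> U \<mu> C \<union> {primary2 \<mu>} \<and> clockwise \<alpha> T \<longrightarrow>
        ln_f_lap_integrable \<mu> C \<Omega> \<and> 2 * T = pi + ln_f_lap_integral \<mu> C \<Omega>) \<and>
     (primary2 \<mu> \<in> \<Omega> \<and> \<Omega> \<subseteq> U \<mu> C \<union> {primary2 \<mu>} \<and> counterclockwise \<alpha> T \<longrightarrow>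
        ln_f_lap_integrable \<mu> C \<Omega> \<and> 2 * T = - pi - ln_f_lap_integral \<mu> C \<Omega>) \<and>
     (primary1 \<mu> \<in> \<Omega> \<and> primary2 \<mu> \<in> \<Omega> \<and>
        \<Omega> \<subseteq> U \<mu> C \<union> {primary1 \<mu>, primary2 \<mu>} \<and> clockwise \<alpha> T \<longrightarrow>
        ln_f_lap_integrable \<mu> C \<Omega> \<and> 2 * T = ln_f_lap_integral \<mu> C \<Omega>) \<and>
     (primary1 \<mu> \<in> \<Omega> \<and> primary2 \<mu> \<in> \<Omega> \<and>
        \<Omega> \<subseteq> U \<mu> C \<union> {primary1 \<mu>, primary2 \<mu>} \<and> counterclockwise \<alpha> T \<longrightarrow>
        ln_f_lap_integrable \<mu> C \<Omega> \<and> 2 * T = - ln_f_lap_integral \<mu> C \<Omega>)"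
proof -
  have mu1: "\<mu> < 1" using mu by simp
  note main = rtbp_orbit_integral[OF mu(1) mu1 alpha solution jacobian periodic regular simple Omega ln_f_defined]
  have cw: "winding_number (complex_loop \<alpha> T) (cpx w) = of_real (- 1)"
    if "clockwise \<alpha> T" "w \<in> \<Omega>" for w
    using that by (auto simp: clockwise_def Omega cpx_def case_prod_beta)
  have ccw: "winding_number (complex_loop \<alpha> T) (cpx w) = of_real 1"
    if "counterclockwise \<alpha> T" "w \<in> \<Omega>" for w
    using that by (auto simp: counterclockwise_def Omega cpx_def case_prod_beta)
  \<comment> \<open>In the cases with one enclosed primary the other one cannot lie in the region:
    \<open>U\<close> excludes it, and it differs from \<open>primary2 \<mu>\<close>.\<close>
  have p1: "primary1 \<mu> \<notin> \<Omega>" if "\<Omega> \<subseteq> U \<mu> C \<union> {primary2 \<mu>}"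
    using that by (auto simp: U_def primary1_def primary2_def)
  show ?thesis
  proof (intro conjI impI; elim conjE)
    assume a: "primary2 \<mu> \<in> \<Omega>" "\<Omega> \<subseteq> U \<mu> C \<union> {primary2 \<mu>}" "clockwise \<alpha> T"
    then have sub: "\<Omega> \<subseteq> U \<mu> C \<union> {primary1 \<mu>, primary2 \<mu>}" by auto
    show "ln_f_lap_integrable \<mu> C \<Omega>" by (rule main(1)[OF _ sub _ cw[OF a(3)]]) auto
    show "2 * T = pi + ln_f_lap_integral \<mu> C \<Omega>"
      using main(2)[OF _ sub _ cw[OF a(3)]] a(1) p1[OF a(2)] by simp
  next
    assume a: "primary2 \<mu> \<in> \<Omega>" "\<Omega> \<subseteq> U \<mu> C \<union> {primary2 \<mu>}" "counterclockwise \<alpha> T"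
    then have sub: "\<Omega> \<subseteq> U \<mu> C \<union> {primary1 \<mu>, primary2 \<mu>}" by auto
    show "ln_f_lap_integrable \<mu> C \<Omega>" by (rule main(1)[OF _ sub _ ccw[OF a(3)]]) auto
    show "2 * T = - pi - ln_f_lap_integral \<mu> C \<Omega>"
      using main(2)[OF _ sub _ ccw[OF a(3)]] a(1) p1[OF a(2)] by simp
  next
    assume a: "primary1 \<mu> \<in> \<Omega>" "primary2 \<mu> \<in> \<Omega>" "\<Omega> \<subseteq> U \<mu> C \<union> {primary1 \<mu>, primary2 \<mu>}" "clockwise \<alpha> T"
    show "ln_f_lap_integrable \<mu> C \<Omega>" by (rule main(1)[OF _ a(3) _ cw[OF a(4)]]) auto
    show "2 * T = ln_f_lap_integral \<mu> C \<Omega>"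
      using main(2)[OF _ a(3) _ cw[OF a(4)]] a(1,2) by simp
  next
    assume a: "primary1 \<mu> \<in> \<Omega>" "primary2 \<mu> \<in> \<Omega>" "\<Omega> \<subseteq> U \<mu> C \<union> {primary1 \<mu>, primary2 \<mu>}" "counterclockwise \<alpha> T"
    show "ln_f_lap_integrable \<mu> C \<Omega>" by (rule main(1)[OF _ a(3) _ ccw[OF a(4)]]) auto
    show "2 * T = - ln_f_lap_integral \<mu> C \<Omega>"
      using main(2)[OF _ a(3) _ ccw[OF a(4)]] a(1,2) by simp
  qed
qed

end
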